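(* Let $(X,\Sigma,\mathfrak m)$ be a probability space and $(\Omega,\mathcal A)$ a measurable space. Let $\mu\in\mathcal P(\Omega;L^0(\mathfrak m))$ have a foliation $(\mu_x)_{x\in X}\subseteq\mathcal P(\Omega)$ by probability measures on $(\Omega,\mathcal A)$. Then there exists a unique isometric isomorphism of random normed modules \[ I\colon L^1_\mu(\Omega;L^0(\mathfrak m))\to\tilde L^1_\mu(\Omega;L^0(\mathfrak m)) \] such that, for every $A\in\mathcal A$, $I(\mathbf 1_A^\mu\mathbf 1_X^{\mathfrak m})$ is the equivalence class in $\tilde L^1_\mu(\Omega;L^0(\mathfrak m))$ of the function $\Omega\times X\ni(p,x)\mapsto\mathbf 1_A(p)$.
   Context: $L^0(\mathfrak m)$ is the algebra of $\mathfrak m$-a.e. equivalence classes $[f]_{\mathfrak m}$ of measurable functions $X\to\mathbb R$, with the $\mathfrak m$-a.e. order and the distance $\int|f-g|\wedge1\,\mathrm d\mathfrak m$; $L^0_+(\mathfrak m)$ is its positive cone; $\mathbf 1_X^{\mathfrak m}$ is the constant $1$. $\bar\Sigma_{\mathfrak m}$ denotes the $\mathfrak m$-completion of $\Sigma$; functions on $X$ are $\mathfrak m$-measurable if they are $\bar\Sigma_{\mathfrak m}$-measurable, and their classes are identified with elements of $L^0(\mathfrak m)$. A sequence in $L^0_+(\mathfrak m)$ is summable if its partial sums are order bounded in $L^0(\mathfrak m)$. A random normed module with base $(X,\Sigma,\mathfrak m)$ is a module $M$ over $L^0(\mathfrak m)$ with a map $|\cdot|\colon M\to L^0_+(\mathfrak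 m)$ such that $|v|=0$ iff $v=0$, $|v+w|\le|v|+|w|$, $|f\cdot v|=|f||v|$. Its completion is its metric completion for $d_M(v,w)=\int|v-w|\wedge1\,\mathrm d\mathfrak m$ with the extended operations and $L^0$-norm. An isometric isomorphism is an $L^0(\mathfrak m)$-linear bijection preserving the $L^0$-norm. $\mathcal P(\Omega;L^0(\mathfrak m))$ is the set of maps $\mu\colon\mathcal A\to L^0_+(\mathfrak m)$ with $\mu(\varnothing)=0$, $\mu(\Omega)=\mathbf 1_X^{\mathfrak m}$, such that for pairwise disjoint $(A_n)$ the sequence $(\mu(A_n))_n$ is summable with $\mu(\bigcup_nA_n)=\sum_n\mu(A_n)$. A foliation of $\mu$ by probability measures is a family $(\mu_x)_{x\in X}$ of probability measures on $(\Omega,\mathcal A)$ such that, for every $A\in\mathcal A$, $x\mapsto\mu_x(A)$ is $\mathfrak m$-measurable and $\mu(A)=[\mu_\cdot(A)]_{\mathfrak m}$. $L^1_\mu(\Omega;L^0(\mathfrak m))$: let $S^1_\mu$ be the space of simple maps $f=\sum_{i\in I}\mathbf 1_{A_i}\bar f^i\colon\Omega\to L^0(\mathfrak m)$ ($(A_i)_{i\in I}\subseteq\mathcal A$ an at most countable partition of $\Omega$, $\bar f^i\in L^0(\mathfrak m)$) with $\{\mu(A_i)|\bar f^i|\}_i$ summable, modulo equality outside sets $N\in\mathcal A$ with $\mu(N)=0$; the class is written $\sum_i\mathbf 1_{A_i}^\mu\bar f^i$. It is a random normed module with $|f|^{1,\mu}=\sum_i\mu(A_i)|\bar f^i|$,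 and $L^1_\mu(\Omega;L^0(\mathfrak m))$ is its completion. $\tilde L^1_\mu(\Omega;L^0(\mathfrak m))$: the set of all $\mathcal A\otimes\bar\Sigma_{\mathfrak m}$-measurable $F\colon\Omega\times X\to\mathbb R$ such that $F(\cdot,x)$ is $\mu_x$-integrable for $\mathfrak m$-a.e. $x\in X$, modulo the relation $F\sim\tilde F$ iff for $\mathfrak m$-a.e. $x$ one has $F(\cdot,x)=\tilde F(\cdot,x)$ $\mu_x$-a.e. It is a (complete) random normed module with pointwise addition, multiplication $(f\cdot F)(p,x)=f(x)F(p,x)$ for $f\in L^0(\mathfrak m)$, and $L^0$-norm $|F|^{1,\mu}_\sim(x)=\int|F(\cdot,x)|\,\mathrm d\mu_x$ for $\mathfrak m$-a.e. $x$. *)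

theory Defs
  imports "HOL-Probability.Probability" "HOL-Algebra.Module" "HOL-Algebra.Complete_Lattice"
begin

text \<open>
  All quotient spaces below are modelled as sets of equivalence classes, each class being the set
  of all its representatives.  Operations on classes are given on representatives picked by
  \<open>repr\<close>; they do not depend on the choice.
\<close>

definition repr :: "'a set \<Rightarrow> 'a"
  where "repr C = (SOME c. c \<in> C)"


section \<open>The algebra of measurable functions modulo almost everywhere equality\<close>

text \<open>
  \<open>L0_class M f\<close> consists of measurable functions even if \<open>f\<close> is only measurable with respect to
  the completion of \<open>M\<close>.  This is the identification of classes of \<open>completion M\<close>-measurable
  functions with elements of \<open>L0 M\<close>.
\<close>

definition L0_class :: "'x measure \<Rightarrow> ('x \<Rightarrow> real) \<Rightarrow> ('x \<Rightarrow> real) set"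
  where "L0_class M f = {g \<in> borel_measurable M. AE x in M. g x = f x}"

definition L0 :: "'x measure \<Rightarrow> ('x \<Rightarrow> real) set ring"
  where "L0 M =
    \<lparr>carrier = L0_class M ` borel_measurable M,
     monoid.mult = (\<lambda>F G. L0_class M (\<lambda>x. repr F x * repr G x)),
     one = L0_class M (\<lambda>_. 1),
     zero = L0_class M (\<lambda>_. 0),
     add = (\<lambda>F G. L0_class M (\<lambda>x. repr F x + repr G x))\<rparr>"

definition L0_order :: "'x measure \<Rightarrow> ('x \<Rightarrow> real) set gorder"
  where "L0_order M =
    \<lparr>carrier = carrier (L0 M),
     eq = (=),
     le = (\<lambda>F G. AE x in M. repr F x \<le> repr G x)\<rparr>"

definition L0_pos :: "'x measure \<Rightarrow> ('x \<Rightarrow> real) set set"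
  where "L0_pos M = {F \<in> carrier (L0 M). \<zero>\<^bsub>L0 M\<^esub> \<sqsubseteq>\<^bsub>L0_order M\<^esub> F}"

definition L0_abs :: "'x measure \<Rightarrow> ('x \<Rightarrow> real) set \<Rightarrow> ('x \<Rightarrow> real) set"
  where "L0_abs M F = L0_class M (\<lambda>x. \<bar>repr F x\<bar>)"

definition L0_dist :: "'x measure \<Rightarrow> ('x \<Rightarrow> real) set \<Rightarrow> ('x \<Rightarrow> real) set \<Rightarrow> real"
  where "L0_dist M F G = (\<integral>x. min \<bar>repr F x - repr G x\<bar> 1 \<partial>M)"

definition L0_partial_sum ::
    "'x measure \<Rightarrow> (nat \<Rightarrow> ('x \<Rightarrow> real) set) \<Rightarrow> nat \<Rightarrow> ('x \<Rightarrow> real) set"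
  where "L0_partial_sum M F n = finsum (L0 M) F {..<n}"

definition L0_summable :: "'x measure \<Rightarrow> (nat \<Rightarrow> ('x \<Rightarrow> real) set) \<Rightarrow> bool"
  where "L0_summable M F \<longleftrightarrow> F \<in> UNIV \<rightarrow> L0_pos M \<and>
    (\<exists>G\<in>carrier (L0 M). \<forall>n. L0_partial_sum M F n \<sqsubseteq>\<^bsub>L0_order M\<^esub> G)"

text \<open>The sum of a summable sequence is the supremum in \<open>L0_order M\<close> of its partial sums.\<close>

definition L0_suminf :: "'x measure \<Rightarrow> (nat \<Rightarrow> ('x \<Rightarrow> real) set) \<Rightarrow> ('x \<Rightarrow> real) set"
  where "L0_suminf M F = Lattice.sup (L0_order M) (range (L0_partial_sum M F))"


section \<open>Random normed modules\<close>

text \<open>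
  The fields \<open>mult\<close> and \<open>one\<close> that module records inherit from ring records are irrelevant and
  left undefined below.
\<close>

record ('a, 'b) rn_module = "('a, 'b) module" +
  lnorm :: "'b \<Rightarrow> 'a"

locale random_normed_module = prob_space M + mod: Module.module "L0 M" V
  for M :: "'x measure" and V :: "(('x \<Rightarrow> real) set, 'b) rn_module" +
  assumes lnorm_pos: "v \<in> carrier V \<Longrightarrow> lnorm V v \<in> L0_pos M"
    and lnorm_eq_zero_iff: "v \<in> carrier V \<Longrightarrow> lnorm V v = \<zero>\<^bsub>L0 M\<^esub> \<longleftrightarrow> v = \<zero>\<^bsub>V\<^esub>"
    and lnorm_triangle: "v \<in> carrier V \<Longrightarrow> w \<in> carrier V \<Longrightarrow>
      lnorm V (v \<oplus>\<^bsub>V\<^esub> w) \<sqsubseteq>\<^bsub>L0_order M\<^esub> lnorm V v \<oplus>\<^bsub>L0 M\<^esub> lnorm V w"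
    and lnorm_smult: "f \<in> carrier (L0 M) \<Longrightarrow> v \<in> carrier V \<Longrightarrow>
      lnorm V (f \<odot>\<^bsub>V\<^esub> v) = L0_abs M f \<otimes>\<^bsub>L0 M\<^esub> lnorm V v"

locale rn_module_isometric_iso =
  dom: random_normed_module M V + cod: random_normed_module M W
  for M :: "'x measure"
    and V :: "(('x \<Rightarrow> real) set, 'b) rn_module"
    and W :: "(('x \<Rightarrow> real) set, 'c) rn_module" +
  fixes I :: "'b \<Rightarrow> 'c"
  assumes iso_extensional: "I \<in> carrier V \<rightarrow>\<^sub>E carrier W"
    and iso_bij: "bij_betw I (carrier V) (carrier W)"
    and iso_add: "v \<in> carrier V \<Longrightarrow> w \<in> carrier V \<Longrightarrow> I (v \<oplus>\<^bsub>V\<^esub> w) = I v \<oplus>\<^bsub>W\<^esub> I w"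
    and iso_smult: "f \<in> carrier (L0 M) \<Longrightarrow> v \<in> carrier V \<Longrightarrow> I (f \<odot>\<^bsub>V\<^esub> v) = f \<odot>\<^bsub>W\<^esub> I v"
    and iso_lnorm: "v \<in> carrier V \<Longrightarrow> lnorm W (I v) = lnorm V v"


subsection \<open>Completion\<close>

definition rn_dist :: "'x measure \<Rightarrow> (('x \<Rightarrow> real) set, 'b) rn_module \<Rightarrow> 'b \<Rightarrow> 'b \<Rightarrow> real"
  where "rn_dist M V v w = (\<integral>x. min (repr (lnorm V (v \<ominus>\<^bsub>V\<^esub> w)) x) 1 \<partial>M)"

text \<open>
  The Cauchy condition is spelled out because \<open>Metric_space.MCauchy\<close> presupposes a distance that
  separates points; see the remark on \<open>S1\<close> below.
\<close>

definition rn_Cauchy :: "'x measure \<Rightarrow> (('x \<Rightarrow> real) set, 'b) rn_module \<Rightarrow> (nat \<Rightarrow> 'b) set"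
  where "rn_Cauchy M V =
    {u. range u \<subseteq> carrier V \<and> (\<forall>\<epsilon>>0. \<exists>N. \<forall>m\<ge>N. \<forall>n\<ge>N. rn_dist M V (u m) (u n) < \<epsilon>)}"

definition rn_completion_class ::
    "'x measure \<Rightarrow> (('x \<Rightarrow> real) set, 'b) rn_module \<Rightarrow> (nat \<Rightarrow> 'b) \<Rightarrow> (nat \<Rightarrow> 'b) set"
  where "rn_completion_class M V u =
    {v \<in> rn_Cauchy M V. (\<lambda>n. rn_dist M V (v n) (u n)) \<longlonglongrightarrow> 0}"

text \<open>
  Cauchy sequences modulo sequences at distance tending to 0.  Module operations and
  \<open>L0\<close>-norm are extended by continuity; the norm of a class is the limit in \<open>L0 M\<close> of the norms
  along a representative.
\<close>

definition rn_completion ::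
    "'x measure \<Rightarrow> (('x \<Rightarrow> real) set, 'b) rn_module \<Rightarrow> (('x \<Rightarrow> real) set, (nat \<Rightarrow> 'b) set) rn_module"
  where "rn_completion M V =
    \<lparr>carrier = rn_completion_class M V ` rn_Cauchy M V,
     monoid.mult = undefined,
     one = undefined,
     zero = rn_completion_class M V (\<lambda>_. \<zero>\<^bsub>V\<^esub>),
     add = (\<lambda>U W. rn_completion_class M V (\<lambda>n. repr U n \<oplus>\<^bsub>V\<^esub> repr W n)),
     smult = (\<lambda>f U. rn_completion_class M V (\<lambda>n. f \<odot>\<^bsub>V\<^esub> repr U n)),
     lnorm = (\<lambda>U. THE F. F \<in> L0_pos M \<and> (\<lambda>n. L0_dist M (lnorm V (repr U n)) F) \<longlonglongrightarrow> 0)\<rparr>"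

definition rn_completion_embed ::
    "'x measure \<Rightarrow> (('x \<Rightarrow> real) set, 'b) rn_module \<Rightarrow> 'b \<Rightarrow> (nat \<Rightarrow> 'b) set"
  where "rn_completion_embed M V v = rn_completion_class M V (\<lambda>_. v)"


section \<open>\<open>L0\<close>-valued probability measures\<close>

text \<open>
  Here and below, the measure \<open>\<Omega>\<close> only serves as a carrier of its measurable space.
\<close>

definition L0_prob_measures ::
    "'w measure \<Rightarrow> 'x measure \<Rightarrow> ('w set \<Rightarrow> ('x \<Rightarrow> real) set) set"
  where "L0_prob_measures \<Omega> M =
    {\<mu>. \<mu> \<in> sets \<Omega> \<rightarrow> L0_pos M \<and> \<mu> {} = \<zero>\<^bsub>L0 M\<^esub> \<and> \<mu> (space \<Omega>) = \<one>\<^bsub>L0 M\<^esub> \<and>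
      (\<forall>A :: nat \<Rightarrow> 'w set. range A \<subseteq> sets \<Omega> \<longrightarrow> disjoint_family A \<longrightarrow>
        L0_summable M (\<lambda>n. \<mu> (A n)) \<and> \<mu> (\<Union>n. A n) = L0_suminf M (\<lambda>n. \<mu> (A n)))}"

definition foliation ::
    "'w measure \<Rightarrow> 'x measure \<Rightarrow> ('w set \<Rightarrow> ('x \<Rightarrow> real) set) \<Rightarrow> ('x \<Rightarrow> 'w measure) \<Rightarrow> bool"
  where "foliation \<Omega> M \<mu> \<mu>x \<longleftrightarrow>
    (\<forall>x\<in>space M. prob_space (\<mu>x x) \<and> sets (\<mu>x x) = sets \<Omega>) \<and>
    (\<forall>A\<in>sets \<Omega>. (\<lambda>x. measure (\<mu>x x) A) \<in> borel_measurable (completion M) \<and>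
      \<mu> A = L0_class M (\<lambda>x. measure (\<mu>x x) A))"


section \<open>The space \<open>L1\<close> of an \<open>L0\<close>-valued probability measure\<close>

text \<open>
  \<open>simple_repr \<Omega> M \<mu> A c f\<close> means that \<open>f\<close> is the simple map taking the value \<open>c i\<close> on \<open>A i\<close>.
  Countable partitions are indexed by the natural numbers; sets \<open>A i\<close> are allowed to be empty, so
  that finite partitions are covered.  Values of \<open>f\<close> off \<open>space \<Omega>\<close> play no role.
\<close>

definition simple_repr ::
    "'w measure \<Rightarrow> 'x measure \<Rightarrow> ('w set \<Rightarrow> ('x \<Rightarrow> real) set) \<Rightarrow>
     (nat \<Rightarrow> 'w set) \<Rightarrow> (nat \<Rightarrow> ('x \<Rightarrow> real) set) \<Rightarrow> ('w \<Rightarrow> ('x \<Rightarrow> real) set) \<Rightarrow> bool"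
  where "simple_repr \<Omega> M \<mu> A c f \<longleftrightarrow>
    range A \<subseteq> sets \<Omega> \<and> disjoint_family A \<and> (\<Union>i. A i) = space \<Omega> \<and>
    range c \<subseteq> carrier (L0 M) \<and> (\<forall>i. \<forall>p\<in>A i. f p = c i) \<and>
    L0_summable M (\<lambda>i. \<mu> (A i) \<otimes>\<^bsub>L0 M\<^esub> L0_abs M (c i))"

definition simple_maps ::
    "'w measure \<Rightarrow> 'x measure \<Rightarrow> ('w set \<Rightarrow> ('x \<Rightarrow> real) set) \<Rightarrow> ('w \<Rightarrow> ('x \<Rightarrow> real) set) set"
  where "simple_maps \<Omega> M \<mu> = {f. \<exists>A c. simple_repr \<Omega> M \<mu> A c f}"

definition simple_norm ::
    "'w measure \<Rightarrow> 'x measure \<Rightarrow> ('w set \<Rightarrow> ('x \<Rightarrow> real) set) \<Rightarrow>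
     ('w \<Rightarrow> ('x \<Rightarrow> real) set) \<Rightarrow> ('x \<Rightarrow> real) set"
  where "simple_norm \<Omega> M \<mu> f =
    (THE s. \<exists>A c. simple_repr \<Omega> M \<mu> A c f \<and>
       s = L0_suminf M (\<lambda>i. \<mu> (A i) \<otimes>\<^bsub>L0 M\<^esub> L0_abs M (c i)))"

definition S1_class ::
    "'w measure \<Rightarrow> 'x measure \<Rightarrow> ('w set \<Rightarrow> ('x \<Rightarrow> real) set) \<Rightarrow>
     ('w \<Rightarrow> ('x \<Rightarrow> real) set) \<Rightarrow> ('w \<Rightarrow> ('x \<Rightarrow> real) set) set"
  where "S1_class \<Omega> M \<mu> f =
    {g \<in> simple_maps \<Omega> M \<mu>. \<exists>N\<in>sets \<Omega>. \<mu> N = \<zero>\<^bsub>L0 M\<^esub> \<and> (\<forall>p\<in>space \<Omega> - N. g p = f p)}"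

text \<open>
  The \<open>L0\<close>-norm of \<open>S1\<close> can vanish on a nonzero class: if \<open>\<mu> A = L0_class M (indicator B)\<close> and
  \<open>0 < measure M B < 1\<close>, then the map with value \<open>L0_class M (indicator (space M - B))\<close> on \<open>A\<close>
  and 0 elsewhere has norm zero.  The completion identifies such elements with zero, since Cauchy
  sequences at distance tending to 0 are identified there.
\<close>

definition S1 ::
    "'w measure \<Rightarrow> 'x measure \<Rightarrow> ('w set \<Rightarrow> ('x \<Rightarrow> real) set) \<Rightarrow>
     (('x \<Rightarrow> real) set, ('w \<Rightarrow> ('x \<Rightarrow> real) set) set) rn_module"
  where "S1 \<Omega> M \<mu> =
    \<lparr>carrier = S1_class \<Omega> M \<mu> ` simple_maps \<Omega> M \<mu>,
     monoid.mult = undefined,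
     one = undefined,
     zero = S1_class \<Omega> M \<mu> (\<lambda>_. \<zero>\<^bsub>L0 M\<^esub>),
     add = (\<lambda>f g. S1_class \<Omega> M \<mu> (\<lambda>p. repr f p \<oplus>\<^bsub>L0 M\<^esub> repr g p)),
     smult = (\<lambda>a f. S1_class \<Omega> M \<mu> (\<lambda>p. a \<otimes>\<^bsub>L0 M\<^esub> repr f p)),
     lnorm = (\<lambda>f. simple_norm \<Omega> M \<mu> (repr f))\<rparr>"

definition L1 ::
    "'w measure \<Rightarrow> 'x measure \<Rightarrow> ('w set \<Rightarrow> ('x \<Rightarrow> real) set) \<Rightarrow>
     (('x \<Rightarrow> real) set, (nat \<Rightarrow> ('w \<Rightarrow> ('x \<Rightarrow> real) set) set) set) rn_module"
  where "L1 \<Omega> M \<mu> = rn_completion M (S1 \<Omega> M \<mu>)"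

text \<open>The element of \<open>L1\<close> given by the simple map with value \<open>c\<close> on \<open>A\<close> and 0 elsewhere.\<close>

definition L1_indicator ::
    "'w measure \<Rightarrow> 'x measure \<Rightarrow> ('w set \<Rightarrow> ('x \<Rightarrow> real) set) \<Rightarrow>
     'w set \<Rightarrow> ('x \<Rightarrow> real) set \<Rightarrow> (nat \<Rightarrow> ('w \<Rightarrow> ('x \<Rightarrow> real) set) set) set"
  where "L1_indicator \<Omega> M \<mu> A c =
    rn_completion_embed M (S1 \<Omega> M \<mu>)
      (S1_class \<Omega> M \<mu> (\<lambda>p. if p \<in> A then c else \<zero>\<^bsub>L0 M\<^esub>))"


section \<open>The space \<open>L1\<close> of a foliation\<close>

definition L1t_functions ::
    "'w measure \<Rightarrow> 'x measure \<Rightarrow> ('x \<Rightarrow> 'w measure) \<Rightarrow> ('w \<times> 'x \<Rightarrow> real) set"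
  where "L1t_functions \<Omega> M \<mu>x =
    {F \<in> borel_measurable (\<Omega> \<Otimes>\<^sub>M completion M).
      AE x in M. integrable (\<mu>x x) (\<lambda>p. F (p, x))}"

definition L1t_class ::
    "'w measure \<Rightarrow> 'x measure \<Rightarrow> ('x \<Rightarrow> 'w measure) \<Rightarrow>
     ('w \<times> 'x \<Rightarrow> real) \<Rightarrow> ('w \<times> 'x \<Rightarrow> real) set"
  where "L1t_class \<Omega> M \<mu>x F =
    {G \<in> L1t_functions \<Omega> M \<mu>x. AE x in M. AE p in \<mu>x x. G (p, x) = F (p, x)}"

definition L1t ::
    "'w measure \<Rightarrow> 'x measure \<Rightarrow> ('x \<Rightarrow> 'w measure) \<Rightarrow>
     (('x \<Rightarrow> real) set, ('w \<times> 'x \<Rightarrow> real) set) rn_module"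
  where "L1t \<Omega> M \<mu>x =
    \<lparr>carrier = L1t_class \<Omega> M \<mu>x ` L1t_functions \<Omega> M \<mu>x,
     monoid.mult = undefined,
     one = undefined,
     zero = L1t_class \<Omega> M \<mu>x (\<lambda>_. 0),
     add = (\<lambda>F G. L1t_class \<Omega> M \<mu>x (\<lambda>z. repr F z + repr G z)),
     smult = (\<lambda>f F. L1t_class \<Omega> M \<mu>x (\<lambda>(p, x). repr f x * repr F (p, x))),
     lnorm = (\<lambda>F. L0_class M (\<lambda>x. \<integral>p. \<bar>repr F (p, x)\<bar> \<partial>\<mu>x x))\<rparr>"

end

theory Submission
  imports Defs
begin

text \<open>
  A simple map \<open>f\<close>, with values in \<open>L0 M\<close>, is sent to the function \<open>(p, x) \<mapsto> repr (f p) x\<close>.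
  Since \<open>f\<close> has countably many values, this is measurable and additive up to null sets, and
  summing over the values shows that it preserves the \<open>L0\<close>-norm.  As \<open>L1t\<close> is complete, this map
  extends to an isometric isomorphism from the completion as soon as its image is dense.  By a
  monotone class argument, a closed subset of \<open>L1t\<close> that is stable under sums and \<open>L0\<close>-multiples
  is everything if it contains the indicators of the sets \<open>A \<times> X\<close>: the indicator of a rectangle
  \<open>A \<times> B\<close> is the multiple of such an indicator by the scalar \<open>1\<^sub>B\<close>.  Applied to the closure of
  the image this gives density, and applied to the points where two isomorphisms agree it
  gives uniqueness.
\<close>

section \<open>The algebra \<open>L0\<close>\<close>

text \<open>Two obstacles shape the argument. The \<open>L0\<close>-norm of \<open>S1\<close> is in
  general only a seminorm, so its completion cannot be handled by a theory of completions of random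
  normed modules. Instead, a completion class is identified with the set of all sequences whose
  images have a common limit in \<open>L1t\<close>, and every axiom for the completion is pulled
  back from there. The second obstacle is that \<open>repr\<close> picks a representative for each
  element of \<open>L0 M\<close> separately: an identity between representatives fails on a null set
  that depends on the elements involved, hence on the point of \<open>\<Omega>\<close>. These null
  sets can be united only because a simple map has countably many values. Two features of
  \<open>L0\<close> recur. Scalars are unbounded, so multiplication is continuous for the truncated
  distance without having a Lipschitz constant in general. Fibre integrals are known to be
  measurable only for \<open>completion M\<close>, so distances in \<open>L1t\<close> are computed
  as integrals over the completion and then compared with representatives measurable for
  \<open>M\<close>.\<close>

lemma repr_mem: "c \<in> C \<Longrightarrow> repr C \<in> C"
  unfolding repr_def by (rule someI)

lemma L0_class_cong_AE:
  assumes "AE x in M. f x = g x"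
  shows "L0_class M f = L0_class M g"
proof -
  have "(AE x in M. h x = f x) \<longleftrightarrow> (AE x in M. h x = g x)" for h
    using assms by (auto elim: AE_mp)
  then show ?thesis by (auto simp: L0_class_def)
qed

text \<open>A function measurable for the completion agrees a.e. with an \<open>M\<close>-measurable
  one, so its class is nonempty and \<open>repr\<close> returns an actual member. This is what
  allows fibre integrals to serve as elements of \<open>L0 M\<close>.\<close>

lemma
  assumes "f \<in> borel_measurable (completion M)"
  shows measurable_repr_L0_class: "repr (L0_class M f) \<in> borel_measurable M"
    and AE_repr_L0_class: "AE x in M. repr (L0_class M f) x = f x"
proof -
  obtain g where "g \<in> borel_measurable M" "AE x in M. f x = g x"
    using completion_ex_borel_measurable_real[OF assms] by blast
  then have "g \<in> L0_class M f" by (auto simp: L0_class_def)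
  from repr_mem[OF this]
  show "repr (L0_class M f) \<in> borel_measurable M" "AE x in M. repr (L0_class M f) x = f x"
    by (auto simp: L0_class_def)
qed

lemma L0_carrierI:
  assumes "f \<in> borel_measurable (completion M)"
  shows "L0_class M f \<in> carrier (L0 M)"
proof -
  have "L0_class M f = L0_class M (repr (L0_class M f))"
    using AE_repr_L0_class[OF assms] by (intro L0_class_cong_AE) auto
  then show ?thesis
    using measurable_repr_L0_class[OF assms] by (auto simp: L0_def)
qed

lemma
  assumes "F \<in> carrier (L0 M)"
  shows measurable_repr_L0: "repr F \<in> borel_measurable M"
    and L0_class_repr: "L0_class M (repr F) = F"
proof -
  obtain f where f: "f \<in> borel_measurable M" "F = L0_class M f"
    using assms by (auto simp: L0_def)
  then have f': "f \<in> borel_measurable (completion M)" by (simp add: measurable_completion)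
  show "repr F \<in> borel_measurable M"
    using measurable_repr_L0_class[OF f'] f by simp
  show "L0_class M (repr F) = F"
    unfolding f(2) by (intro L0_class_cong_AE AE_repr_L0_class f')
qed

lemma measurable_repr_L0_completion:
  "F \<in> carrier (L0 M) \<Longrightarrow> repr F \<in> borel_measurable (completion M)"
  by (intro measurable_completion measurable_repr_L0)

lemma L0_eqI:
  assumes "F \<in> carrier (L0 M)" "G \<in> carrier (L0 M)" "AE x in M. repr F x = repr G x"
  shows "F = G"
  using L0_class_cong_AE[OF assms(3)] L0_class_repr assms(1,2) by metis

lemma L0_class_eq_iff:
  assumes "f \<in> borel_measurable (completion M)" "g \<in> borel_measurable (completion M)"
  shows "L0_class M f = L0_class M g \<longleftrightarrow> (AE x in M. f x = g x)"
proof
  assume "L0_class M f = L0_class M g"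
  then show "AE x in M. f x = g x"
    using AE_repr_L0_class[OF assms(1)] AE_repr_L0_class[OF assms(2)] by auto
qed (rule L0_class_cong_AE)

lemma L0_add_def: "F \<oplus>\<^bsub>L0 M\<^esub> G = L0_class M (\<lambda>x. repr F x + repr G x)"
  and L0_mult_def: "F \<otimes>\<^bsub>L0 M\<^esub> G = L0_class M (\<lambda>x. repr F x * repr G x)"
  by (simp_all add: L0_def)

lemma
  assumes "F \<in> carrier (L0 M)" "G \<in> carrier (L0 M)"
  shows L0_add_closed: "F \<oplus>\<^bsub>L0 M\<^esub> G \<in> carrier (L0 M)"
    and AE_repr_L0_add: "AE x in M. repr (F \<oplus>\<^bsub>L0 M\<^esub> G) x = repr F x + repr G x"
    and L0_mult_closed: "F \<otimes>\<^bsub>L0 M\<^esub> G \<in> carrier (L0 M)"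
    and AE_repr_L0_mult: "AE x in M. repr (F \<otimes>\<^bsub>L0 M\<^esub> G) x = repr F x * repr G x"
proof -
  note [measurable] = assms[THEN measurable_repr_L0_completion]
  show "F \<oplus>\<^bsub>L0 M\<^esub> G \<in> carrier (L0 M)" "F \<otimes>\<^bsub>L0 M\<^esub> G \<in> carrier (L0 M)"
    "AE x in M. repr (F \<oplus>\<^bsub>L0 M\<^esub> G) x = repr F x + repr G x"
    "AE x in M. repr (F \<otimes>\<^bsub>L0 M\<^esub> G) x = repr F x * repr G x"
    unfolding L0_add_def L0_mult_def by (auto intro!: L0_carrierI AE_repr_L0_class)
qed

lemma
  shows L0_zero_closed: "\<zero>\<^bsub>L0 M\<^esub> \<in> carrier (L0 M)"
    and AE_repr_L0_zero: "AE x in M. repr (\<zero>\<^bsub>L0 M\<^esub>) x = 0"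
    and L0_one_closed: "\<one>\<^bsub>L0 M\<^esub> \<in> carrier (L0 M)"
    and AE_repr_L0_one: "AE x in M. repr (\<one>\<^bsub>L0 M\<^esub>) x = 1"
  using L0_carrierI[of "\<lambda>_. 0" M] AE_repr_L0_class[of "\<lambda>_. 0" M]
    L0_carrierI[of "\<lambda>_. 1" M] AE_repr_L0_class[of "\<lambda>_. 1" M]
  by (simp_all add: L0_def)

lemma
  assumes "F \<in> carrier (L0 M)"
  shows L0_abs_closed: "L0_abs M F \<in> carrier (L0 M)"
    and AE_repr_L0_abs: "AE x in M. repr (L0_abs M F) x = \<bar>repr F x\<bar>"
proof -
  note [measurable] = assms[THEN measurable_repr_L0_completion]
  show "L0_abs M F \<in> carrier (L0 M)" "AE x in M. repr (L0_abs M F) x = \<bar>repr F x\<bar>"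
    unfolding L0_abs_def by (auto intro!: L0_carrierI AE_repr_L0_class)
qed

text \<open>Each law holds for representatives at almost every point, and an element of
  \<open>L0 M\<close> is determined by the a.e. values of its representative.\<close>

lemma cring_L0: "cring (L0 M)"
proof (rule cringI)
  show "abelian_group (L0 M)"
  proof (rule abelian_groupI)
    fix F G H assume [simp]: "F \<in> carrier (L0 M)" "G \<in> carrier (L0 M)" "H \<in> carrier (L0 M)"
    show "(F \<oplus>\<^bsub>L0 M\<^esub> G) \<oplus>\<^bsub>L0 M\<^esub> H = F \<oplus>\<^bsub>L0 M\<^esub> (G \<oplus>\<^bsub>L0 M\<^esub> H)"
      using AE_repr_L0_add[of "F \<oplus>\<^bsub>L0 M\<^esub> G" M H] AE_repr_L0_add[of F M G]
        AE_repr_L0_add[of F M "G \<oplus>\<^bsub>L0 M\<^esub> H"] AE_repr_L0_add[of G M H]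
      by (intro L0_eqI[of _ M]) (auto simp: L0_add_closed)
  next
    fix F G assume [simp]: "F \<in> carrier (L0 M)" "G \<in> carrier (L0 M)"
    show "F \<oplus>\<^bsub>L0 M\<^esub> G = G \<oplus>\<^bsub>L0 M\<^esub> F"
      by (simp add: L0_def add.commute)
  next
    fix F assume F[simp]: "F \<in> carrier (L0 M)"
    show "\<zero>\<^bsub>L0 M\<^esub> \<oplus>\<^bsub>L0 M\<^esub> F = F"
      using AE_repr_L0_add[of "\<zero>\<^bsub>L0 M\<^esub>" M F] AE_repr_L0_zero[of M]
      by (intro L0_eqI[of _ M]) (auto simp: L0_add_closed L0_zero_closed)
    note [measurable] = F[THEN measurable_repr_L0_completion]
    let ?G = "L0_class M (\<lambda>x. - repr F x)"
    have G: "?G \<in> carrier (L0 M)" "AE x in M. repr ?G x = - repr F x"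
      by (auto intro!: L0_carrierI AE_repr_L0_class)
    have "?G \<oplus>\<^bsub>L0 M\<^esub> F = \<zero>\<^bsub>L0 M\<^esub>"
      using AE_repr_L0_add[OF G(1) F] AE_repr_L0_zero[of M] G
      by (intro L0_eqI[of _ M]) (auto simp: L0_add_closed L0_zero_closed)
    with G show "\<exists>G\<in>carrier (L0 M). G \<oplus>\<^bsub>L0 M\<^esub> F = \<zero>\<^bsub>L0 M\<^esub>" by blast
  qed (auto simp: L0_add_closed L0_zero_closed)
  show "comm_monoid (L0 M)"
  proof (rule comm_monoidI)
    fix F G H assume [simp]: "F \<in> carrier (L0 M)" "G \<in> carrier (L0 M)" "H \<in> carrier (L0 M)"
    show "(F \<otimes>\<^bsub>L0 M\<^esub> G) \<otimes>\<^bsub>L0 M\<^esub> H = F \<otimes>\<^bsub>L0 M\<^esub> (G \<otimes>\<^bsub>L0 M\<^esub> H)"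
      using AE_repr_L0_mult[of "F \<otimes>\<^bsub>L0 M\<^esub> G" M H] AE_repr_L0_mult[of F M G]
        AE_repr_L0_mult[of F M "G \<otimes>\<^bsub>L0 M\<^esub> H"] AE_repr_L0_mult[of G M H]
      by (intro L0_eqI[of _ M]) (auto simp: L0_mult_closed)
  next
    fix F G assume [simp]: "F \<in> carrier (L0 M)" "G \<in> carrier (L0 M)"
    show "F \<otimes>\<^bsub>L0 M\<^esub> G = G \<otimes>\<^bsub>L0 M\<^esub> F"
      by (simp add: L0_def mult.commute)
  next
    fix F assume F[simp]: "F \<in> carrier (L0 M)"
    show "\<one>\<^bsub>L0 M\<^esub> \<otimes>\<^bsub>L0 M\<^esub> F = F"
      using AE_repr_L0_mult[of "\<one>\<^bsub>L0 M\<^esub>" M F] AE_repr_L0_one[of M]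
      by (intro L0_eqI[of _ M]) (auto simp: L0_mult_closed L0_one_closed)
  qed (auto simp: L0_mult_closed L0_one_closed)
next
  fix F G H assume [simp]: "F \<in> carrier (L0 M)" "G \<in> carrier (L0 M)" "H \<in> carrier (L0 M)"
  show "(F \<oplus>\<^bsub>L0 M\<^esub> G) \<otimes>\<^bsub>L0 M\<^esub> H = F \<otimes>\<^bsub>L0 M\<^esub> H \<oplus>\<^bsub>L0 M\<^esub> G \<otimes>\<^bsub>L0 M\<^esub> H"
    using AE_repr_L0_mult[of "F \<oplus>\<^bsub>L0 M\<^esub> G" M H] AE_repr_L0_add[of F M G]
      AE_repr_L0_add[of "F \<otimes>\<^bsub>L0 M\<^esub> H" M "G \<otimes>\<^bsub>L0 M\<^esub> H"]
      AE_repr_L0_mult[of F M H] AE_repr_L0_mult[of G M H]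
    by (intro L0_eqI[of _ M]) (auto simp: L0_mult_closed L0_add_closed distrib_right)
qed

lemma L0_le_iff: "F \<sqsubseteq>\<^bsub>L0_order M\<^esub> G \<longleftrightarrow> (AE x in M. repr F x \<le> repr G x)"
  by (simp add: L0_order_def)

lemma L0_pos_iff: "F \<in> L0_pos M \<longleftrightarrow> F \<in> carrier (L0 M) \<and> (AE x in M. 0 \<le> repr F x)"
proof -
  have "(AE x in M. repr \<zero>\<^bsub>L0 M\<^esub> x \<le> repr F x) \<longleftrightarrow> (AE x in M. 0 \<le> repr F x)"
    using AE_repr_L0_zero[of M] by (auto elim: AE_mp)
  then show ?thesis by (auto simp: L0_pos_def L0_le_iff)
qed

lemma L0_class_pos:
  assumes "f \<in> borel_measurable (completion M)" "AE x in M. 0 \<le> f x"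
  shows "L0_class M f \<in> L0_pos M"
  using AE_repr_L0_class[OF assms(1)] assms by (auto simp: L0_pos_iff intro: L0_carrierI)

lemma
  assumes "range F \<subseteq> carrier (L0 M)"
  shows L0_partial_sum_closed: "L0_partial_sum M F n \<in> carrier (L0 M)"
    and AE_repr_L0_partial_sum:
      "AE x in M. repr (L0_partial_sum M F n) x = (\<Sum>i<n. repr (F i) x)"
proof -
  interpret L: cring "L0 M" by (rule cring_L0)
  have F: "F i \<in> carrier (L0 M)" for i using assms by auto
  show closed: "L0_partial_sum M F n \<in> carrier (L0 M)" for n
    unfolding L0_partial_sum_def using F by (intro L.finsum_closed) auto
  show "AE x in M. repr (L0_partial_sum M F n) x = (\<Sum>i<n. repr (F i) x)"
  proof (induction n)
    case 0
    then show ?case using AE_repr_L0_zero[of M] by (simp add: L0_partial_sum_def)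
  next
    case (Suc n)
    have "L0_partial_sum M F (Suc n) = F n \<oplus>\<^bsub>L0 M\<^esub> L0_partial_sum M F n"
      unfolding L0_partial_sum_def lessThan_Suc using F by (subst L.finsum_insert) auto
    with Suc AE_repr_L0_add[OF F[of n] closed[of n]] show ?case by auto
  qed
qed

text \<open>Countably many null sets unite, so almost everywhere all terms are nonnegative and all
  partial sums are the pointwise ones. Order boundedness is then pointwise boundedness by a finite
  function, hence summability, and the pointwise sum is the least upper bound.\<close>

lemma
  assumes "F \<in> UNIV \<rightarrow> L0_pos M"
  shows L0_summable_iff: "L0_summable M F \<longleftrightarrow> (AE x in M. summable (\<lambda>i. repr (F i) x))"
    and L0_suminf_eq: "L0_summable M F \<Longrightarrow> L0_suminf M F = L0_class M (\<lambda>x. \<Sum>i. repr (F i) x)"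
proof -
  have F: "range F \<subseteq> carrier (L0 M)" and F': "F i \<in> carrier (L0 M)" for i
    using assms by (auto simp: L0_pos_iff)
  note [measurable] = F'[THEN measurable_repr_L0]
  have pos: "AE x in M. \<forall>i. 0 \<le> repr (F i) x"
    using assms by (auto simp: AE_all_countable L0_pos_iff Pi_iff)
  have ps: "AE x in M. \<forall>n. repr (L0_partial_sum M F n) x = (\<Sum>i<n. repr (F i) x)"
    by (subst AE_all_countable) (intro allI AE_repr_L0_partial_sum F)
  let ?S = "L0_class M (\<lambda>x. \<Sum>i. repr (F i) x)"
  have "(\<lambda>x. \<Sum>i. repr (F i) x) \<in> borel_measurable (completion M)"
    by (intro measurable_completion) measurable
  then have S: "?S \<in> carrier (L0 M)" "AE x in M. repr ?S x = (\<Sum>i. repr (F i) x)"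
    by (auto intro: L0_carrierI AE_repr_L0_class)
  have ub: "\<forall>n. L0_partial_sum M F n \<sqsubseteq>\<^bsub>L0_order M\<^esub> ?S" if "AE x in M. summable (\<lambda>i. repr (F i) x)"
  proof
    fix n
    show "L0_partial_sum M F n \<sqsubseteq>\<^bsub>L0_order M\<^esub> ?S"
      unfolding L0_le_iff using ps pos S(2) that
      by eventually_elim (auto intro: sum_le_suminf)
  qed
  have summ: "AE x in M. summable (\<lambda>i. repr (F i) x) \<and> (\<Sum>i. repr (F i) x) \<le> repr G x"
    if "\<forall>n. L0_partial_sum M F n \<sqsubseteq>\<^bsub>L0_order M\<^esub> G" for G
  proof -
    have "AE x in M. \<forall>n. repr (L0_partial_sum M F n) x \<le> repr G x"
      using that by (subst AE_all_countable) (auto simp: L0_le_iff)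
    with ps pos show ?thesis
    proof eventually_elim
      case (elim x)
      then have "summable (\<lambda>i. repr (F i) x)"
        by (intro summableI_nonneg_bounded[where x="repr G x"]) auto
      with elim show ?case by (auto intro: suminf_le_const)
    qed
  qed
  show iff: "L0_summable M F \<longleftrightarrow> (AE x in M. summable (\<lambda>i. repr (F i) x))"
    unfolding L0_summable_def using assms ub S(1) summ by (auto elim: AE_mp)
  assume "L0_summable M F"
  with iff have "AE x in M. summable (\<lambda>i. repr (F i) x)" by simp
  note ub = ub[OF this]
  have least: "least (L0_order M) ?S (Upper (L0_order M) (range (L0_partial_sum M F)))"
  proof (rule least_UpperI)
    show "G \<sqsubseteq>\<^bsub>L0_order M\<^esub> ?S" if "G \<in> range (L0_partial_sum M F)" for G
      using that ub by auto
    show "?S \<sqsubseteq>\<^bsub>L0_order M\<^esub> G" if "G \<in> Upper (L0_order M) (range (L0_partial_sum M F))" for G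
    proof -
      have "\<forall>n. L0_partial_sum M F n \<sqsubseteq>\<^bsub>L0_order M\<^esub> G"
        using that L0_partial_sum_closed[OF F] by (auto simp: Upper_def L0_order_def)
      from summ[OF this] S(2) show ?thesis unfolding L0_le_iff by eventually_elim auto
    qed
    show "range (L0_partial_sum M F) \<subseteq> carrier (L0_order M)" "?S \<in> carrier (L0_order M)"
      using L0_partial_sum_closed[OF F] S(1) by (auto simp: L0_order_def)
  qed
  \<comment> \<open>\<open>Lattice.sup\<close> is a Hilbert choice among least upper bounds;
    antisymmetry of the a.e. order shows that there is only one.\<close>
  have "T = ?S" if "least (L0_order M) T (Upper (L0_order M) (range (L0_partial_sum M F)))" for T
  proof -
    have T: "T \<in> carrier (L0 M)"
      using least_closed[OF that] by (simp add: L0_order_def)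
    have "T \<sqsubseteq>\<^bsub>L0_order M\<^esub> ?S" "?S \<sqsubseteq>\<^bsub>L0_order M\<^esub> T"
      using that least least_le[OF that] least_le[OF least] by (auto simp: least_def)
    then have "AE x in M. repr T x = repr ?S x"
      unfolding L0_le_iff by eventually_elim auto
    then show ?thesis using T S(1) by (intro L0_eqI)
  qed
  with least show "L0_suminf M F = ?S"
    unfolding L0_suminf_def Lattice.sup_def by (intro some_equality)
qed

section \<open>The distance of a random normed module\<close>

context prob_space
begin

lemma integrable_min_1:
  fixes f :: "'a \<Rightarrow> real"
  assumes "f \<in> borel_measurable M" "AE x in M. 0 \<le> f x"
  shows "integrable M (\<lambda>x. min (f x) 1)"
  by (rule integrable_const_bound[where B=1]) (use assms in auto)

lemma integral_min_1_nonneg: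
  fixes f :: "'a \<Rightarrow> real"
  assumes "AE x in M. 0 \<le> f x"
  shows "0 \<le> (\<integral>x. min (f x) 1 \<partial>M)"
  by (rule integral_nonneg_AE) (use assms in auto)

lemma integral_min_1_mono:
  fixes f g :: "'a \<Rightarrow> real"
  assumes "f \<in> borel_measurable M" "g \<in> borel_measurable M"
    and "AE x in M. 0 \<le> f x" "AE x in M. f x \<le> g x"
  shows "(\<integral>x. min (f x) 1 \<partial>M) \<le> (\<integral>x. min (g x) 1 \<partial>M)"
  by (rule integral_mono_AE) (use assms in \<open>auto intro!: integrable_min_1\<close>)

text \<open>Rests on \<open>min (a + b) 1 \<le> min a 1 + min b 1\<close> for nonnegative
  \<open>a\<close> and \<open>b\<close>. All triangle inequalities for truncated distances come from
  here.\<close>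

lemma integral_min_1_triangle:
  fixes f g h :: "'a \<Rightarrow> real"
  assumes "f \<in> borel_measurable M" "g \<in> borel_measurable M" "h \<in> borel_measurable M"
    and "AE x in M. 0 \<le> f x" "AE x in M. 0 \<le> g x" "AE x in M. 0 \<le> h x"
    and "AE x in M. h x \<le> f x + g x"
  shows "(\<integral>x. min (h x) 1 \<partial>M) \<le> (\<integral>x. min (f x) 1 \<partial>M) + (\<integral>x. min (g x) 1 \<partial>M)"
proof -
  have "(\<integral>x. min (h x) 1 \<partial>M) \<le> (\<integral>x. min (f x) 1 + min (g x) 1 \<partial>M)"
    by (rule integral_mono_AE) (use assms in \<open>auto intro!: integrable_min_1\<close>)
  also have "\<dots> = (\<integral>x. min (f x) 1 \<partial>M) + (\<integral>x. min (g x) 1 \<partial>M)"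
    by (rule Bochner_Integration.integral_add) (use assms in \<open>auto intro!: integrable_min_1\<close>)
  finally show ?thesis .
qed

lemma integral_min_1_eq_0_iff:
  fixes f :: "'a \<Rightarrow> real"
  assumes "f \<in> borel_measurable M" "AE x in M. 0 \<le> f x"
  shows "(\<integral>x. min (f x) 1 \<partial>M) = 0 \<longleftrightarrow> (AE x in M. f x = 0)"
proof -
  have "(\<integral>x. min (f x) 1 \<partial>M) = 0 \<longleftrightarrow> (AE x in M. min (f x) 1 = 0)"
    by (rule integral_nonneg_eq_0_iff_AE) (use assms in \<open>auto intro!: integrable_min_1\<close>)
  also have "\<dots> \<longleftrightarrow> (AE x in M. f x = 0)"
    by (rule AE_cong) (auto simp: min_def)
  finally show ?thesis .
qed

text \<open>At each point the indicators of the tails are eventually zero, and 1 dominates them.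
  Used to cut off an unbounded scalar.\<close>

lemma tendsto_prob_abs_gt_0:
  fixes f :: "'a \<Rightarrow> real"
  assumes [measurable]: "f \<in> borel_measurable M"
  shows "(\<lambda>n. prob {x \<in> space M. real n < \<bar>f x\<bar>}) \<longlonglongrightarrow> 0"
proof -
  have "(\<lambda>n. \<integral>x. indicator {x \<in> space M. real n < \<bar>f x\<bar>} x \<partial>M) \<longlonglongrightarrow> (\<integral>x. (0::real) \<partial>M)"
  proof (rule integral_dominated_convergence[where w="\<lambda>_. 1"])
    show "AE x in M. (\<lambda>n. indicator {x \<in> space M. real n < \<bar>f x\<bar>} x) \<longlonglongrightarrow> (0::real)"
    proof (rule AE_I2)
      fix x
      obtain N where "\<bar>f x\<bar> \<le> real N" using real_arch_simple by blast
      then have "eventually (\<lambda>n. indicator {x \<in> space M. real n < \<bar>f x\<bar>} x = (0::real)) sequentially"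
        by (intro eventually_sequentiallyI[of N]) (auto simp: indicator_def)
      then show "(\<lambda>n. indicator {x \<in> space M. real n < \<bar>f x\<bar>} x) \<longlonglongrightarrow> (0::real)"
        by (rule tendsto_eventually)
    qed
  qed (auto simp: indicator_def)
  moreover have "(\<integral>x. indicator {x \<in> space M. real n < \<bar>f x\<bar>} x \<partial>M) = prob {x \<in> space M. real n < \<bar>f x\<bar>}" for n
    by simp
  ultimately show ?thesis by simp
qed

text \<open>Where \<open>\<bar>f x\<bar> \<le> k\<close> the truncated product is at most
  \<open>k\<close> times the truncated factor; on the remaining set, of small probability, it is at
  most 1. This gives continuity of multiplication by an unbounded function.\<close>

lemma tendsto_integral_min_1_mult:
  fixes f :: "'a \<Rightarrow> real" and g :: "nat \<Rightarrow> 'a \<Rightarrow> real"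
  assumes f[measurable]: "f \<in> borel_measurable M" and g[measurable]: "\<And>n. g n \<in> borel_measurable M"
    and pos: "\<And>n. AE x in M. 0 \<le> g n x"
    and lim: "(\<lambda>n. \<integral>x. min (g n x) 1 \<partial>M) \<longlonglongrightarrow> 0"
  shows "(\<lambda>n. \<integral>x. min (\<bar>f x\<bar> * g n x) 1 \<partial>M) \<longlonglongrightarrow> 0"
proof (rule LIMSEQ_I)
  fix \<epsilon> :: real assume \<epsilon>: "0 < \<epsilon>"
  \<comment> \<open>The tail receives half of \<open>\<epsilon>\<close>. The condition
    \<open>1 \<le> k\<close> gives \<open>min (k * t) 1 \<le> k * min t 1\<close> for
    \<open>0 \<le> t\<close> and makes \<open>\<epsilon> / (2 * k)\<close> a legitimate tolerance
    for the other half.\<close>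
  have "eventually (\<lambda>k. prob {x \<in> space M. real k < \<bar>f x\<bar>} < \<epsilon> / 2 \<and> 1 \<le> k) sequentially"
    using order_tendstoD(2)[OF tendsto_prob_abs_gt_0[OF f], of "\<epsilon> / 2"] \<epsilon> eventually_ge_at_top
    by (intro eventually_conj) auto
  then obtain k where k: "prob {x \<in> space M. real k < \<bar>f x\<bar>} < \<epsilon> / 2" "1 \<le> k"
    using eventually_happens'[OF sequentially_bot] by blast
  let ?A = "{x \<in> space M. real k < \<bar>f x\<bar>}"
  have "eventually (\<lambda>n. (\<integral>x. min (g n x) 1 \<partial>M) < \<epsilon> / (2 * k)) sequentially"
    using order_tendstoD(2)[OF lim, of "\<epsilon> / (2 * k)"] \<epsilon> k by simp
  then obtain N where N: "\<And>n. n \<ge> N \<Longrightarrow> (\<integral>x. min (g n x) 1 \<partial>M) < \<epsilon> / (2 * k)"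
    by (auto simp: eventually_sequentially)
  show "\<exists>N. \<forall>n\<ge>N. norm ((\<integral>x. min (\<bar>f x\<bar> * g n x) 1 \<partial>M) - 0) < \<epsilon>"
  proof (intro exI[of _ N] allI impI)
    fix n assume "n \<ge> N"
    have int: "integrable M (\<lambda>x. min (g n x) 1)" by (intro integrable_min_1 pos) measurable
    have ind: "integrable M (indicator ?A :: 'a \<Rightarrow> real)"
      by (intro integrable_real_indicator) (auto simp: emeasure_eq_measure)
    have int': "integrable M (\<lambda>x. real k * min (g n x) 1 + indicator ?A x)"
      by (intro Bochner_Integration.integrable_add integrable_mult_right int ind)
    have pos': "AE x in M. 0 \<le> \<bar>f x\<bar> * g n x" using pos[of n] by auto
    have "(\<integral>x. min (\<bar>f x\<bar> * g n x) 1 \<partial>M) \<le> (\<integral>x. real k * min (g n x) 1 + indicator ?A x \<partial>M)"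
    proof (rule integral_mono_AE)
      show "AE x in M. min (\<bar>f x\<bar> * g n x) 1 \<le> real k * min (g n x) 1 + indicator ?A x"
        using pos[of n] AE_space
      proof eventually_elim
        case (elim x)
        show ?case
        proof (cases "real k < \<bar>f x\<bar>")
          case True
          have "min (\<bar>f x\<bar> * g n x) 1 \<le> 0 + 1" by simp
          also have "\<dots> \<le> real k * min (g n x) 1 + indicator ?A x"
            using True elim by (intro add_mono) auto
          finally show ?thesis .
        next
          case False
          then have "\<bar>f x\<bar> * g n x \<le> real k * g n x"
            using elim by (intro mult_right_mono) auto
          then have "min (\<bar>f x\<bar> * g n x) 1 \<le> real k * min (g n x) 1"
            using k(2) elim by (auto simp: min_def)
          then show ?thesis by (simp add: indicator_def)
        qed
      qed
    qed (use int' pos' in \<open>auto intro!: integrable_min_1\<close>)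
    also have "\<dots> = real k * (\<integral>x. min (g n x) 1 \<partial>M) + prob ?A"
      using int ind by (subst Bochner_Integration.integral_add) auto
    also have "\<dots> < real k * (\<epsilon> / (2 * k)) + \<epsilon> / 2"
      using N[OF \<open>n \<ge> N\<close>] k by (intro add_strict_mono mult_strict_left_mono) auto
    also have "\<dots> = \<epsilon>" using k(2) by simp
    finally show "norm ((\<integral>x. min (\<bar>f x\<bar> * g n x) 1 \<partial>M) - 0) < \<epsilon>"
      using integral_min_1_nonneg[OF pos'] by simp
  qed
qed

lemma L0_dist_eq_0_imp_eq:
  assumes "F \<in> carrier (L0 M)" "G \<in> carrier (L0 M)" "L0_dist M F G = 0"
  shows "F = G"
proof -
  note [measurable] = assms(1,2)[THEN measurable_repr_L0]
  have "AE x in M. \<bar>repr F x - repr G x\<bar> = 0"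
    using assms(3) unfolding L0_dist_def by (subst (asm) integral_min_1_eq_0_iff) auto
  then show ?thesis using assms by (intro L0_eqI) auto
qed

lemma L0_dist_nonneg: "0 \<le> L0_dist M F G"
  unfolding L0_dist_def by (rule integral_min_1_nonneg) simp

lemma L0_dist_triangle:
  assumes "F \<in> carrier (L0 M)" "G \<in> carrier (L0 M)" "H \<in> carrier (L0 M)"
  shows "L0_dist M F G \<le> L0_dist M H F + L0_dist M H G"
proof -
  note [measurable] = assms[THEN measurable_repr_L0]
  show ?thesis unfolding L0_dist_def by (intro integral_min_1_triangle) auto
qed

end

section \<open>Distances and limits in a random normed module\<close>

context random_normed_module
begin

lemma lnorm_closed [simp]: "v \<in> carrier V \<Longrightarrow> lnorm V v \<in> carrier (L0 M)"
  using lnorm_pos by (auto simp: L0_pos_iff)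

lemma measurable_lnorm: "v \<in> carrier V \<Longrightarrow> repr (lnorm V v) \<in> borel_measurable M"
  by (simp add: measurable_repr_L0)

lemma AE_lnorm_nonneg: "v \<in> carrier V \<Longrightarrow> AE x in M. 0 \<le> repr (lnorm V v) x"
  using lnorm_pos by (auto simp: L0_pos_iff)

lemma AE_lnorm_add:
  assumes "v \<in> carrier V" "w \<in> carrier V"
  shows "AE x in M. repr (lnorm V (v \<oplus>\<^bsub>V\<^esub> w)) x \<le> repr (lnorm V v) x + repr (lnorm V w) x"
  using lnorm_triangle[OF assms] AE_repr_L0_add[of "lnorm V v" M "lnorm V w"] assms
  by (auto simp: L0_le_iff elim!: AE_mp)

lemma AE_lnorm_smult:
  assumes "f \<in> carrier (L0 M)" "v \<in> carrier V"
  shows "AE x in M. repr (lnorm V (f \<odot>\<^bsub>V\<^esub> v)) x = \<bar>repr f x\<bar> * repr (lnorm V v) x"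
  using AE_repr_L0_mult[OF L0_abs_closed[OF assms(1)] lnorm_closed[OF assms(2)]]
    AE_repr_L0_abs[OF assms(1)]
  by (auto simp: lnorm_smult[OF assms])

lemma lnorm_uminus:
  assumes v: "v \<in> carrier V"
  shows "lnorm V (\<ominus>\<^bsub>V\<^esub> v) = lnorm V v"
proof -
  let ?m = "\<ominus>\<^bsub>L0 M\<^esub> \<one>\<^bsub>L0 M\<^esub>"
  have m: "?m \<in> carrier (L0 M)" by simp
  \<comment> \<open>The inverse is an abstract ring operation, so its representative is read off
    from the equation that defines it: adding 1 gives 0 a.e.\<close>
  have "?m \<oplus>\<^bsub>L0 M\<^esub> \<one>\<^bsub>L0 M\<^esub> = \<zero>\<^bsub>L0 M\<^esub>" by (simp add: mod.R.l_neg)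
  then have "AE x in M. repr ?m x = -1"
    using AE_repr_L0_add[OF m L0_one_closed] AE_repr_L0_zero[of M] AE_repr_L0_one[of M]
    by auto
  moreover have "\<ominus>\<^bsub>V\<^esub> v = ?m \<odot>\<^bsub>V\<^esub> v"
    using v by (simp add: mod.smult_l_minus)
  ultimately have "AE x in M. repr (lnorm V (\<ominus>\<^bsub>V\<^esub> v)) x = repr (lnorm V v) x"
    using AE_lnorm_smult[OF m v] by auto
  then show ?thesis using v by (intro L0_eqI) auto
qed

lemma lnorm_minus_commute:
  assumes "v \<in> carrier V" "w \<in> carrier V"
  shows "lnorm V (v \<ominus>\<^bsub>V\<^esub> w) = lnorm V (w \<ominus>\<^bsub>V\<^esub> v)"
proof -
  have "v \<ominus>\<^bsub>V\<^esub> w = \<ominus>\<^bsub>V\<^esub> (w \<ominus>\<^bsub>V\<^esub> v)"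
    using assms by (simp add: mod.M.minus_eq mod.M.minus_add mod.M.a_comm)
  then show ?thesis using assms by (simp add: lnorm_uminus)
qed

lemma AE_lnorm_minus_triangle:
  assumes "u \<in> carrier V" "v \<in> carrier V" "w \<in> carrier V"
  shows "AE x in M. repr (lnorm V (u \<ominus>\<^bsub>V\<^esub> w)) x
    \<le> repr (lnorm V (u \<ominus>\<^bsub>V\<^esub> v)) x + repr (lnorm V (v \<ominus>\<^bsub>V\<^esub> w)) x"
proof -
  have "u \<ominus>\<^bsub>V\<^esub> w = (u \<ominus>\<^bsub>V\<^esub> v) \<oplus>\<^bsub>V\<^esub> (v \<ominus>\<^bsub>V\<^esub> w)"
    using assms by (simp add: mod.M.minus_eq mod.M.a_ac mod.M.r_neg1 mod.M.r_neg2)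
  then show ?thesis using AE_lnorm_add[of "u \<ominus>\<^bsub>V\<^esub> v" "v \<ominus>\<^bsub>V\<^esub> w"] assms by simp
qed

lemma rn_dist_nonneg: "v \<in> carrier V \<Longrightarrow> w \<in> carrier V \<Longrightarrow> 0 \<le> rn_dist M V v w"
  unfolding rn_dist_def by (intro integral_min_1_nonneg AE_lnorm_nonneg) simp

lemma rn_dist_commute:
  "v \<in> carrier V \<Longrightarrow> w \<in> carrier V \<Longrightarrow> rn_dist M V v w = rn_dist M V w v"
  unfolding rn_dist_def by (simp add: lnorm_minus_commute)

lemma rn_dist_triangle:
  assumes "u \<in> carrier V" "v \<in> carrier V" "w \<in> carrier V"
  shows "rn_dist M V u w \<le> rn_dist M V u v + rn_dist M V v w"
  unfolding rn_dist_def using assms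
  by (intro integral_min_1_triangle measurable_lnorm AE_lnorm_nonneg AE_lnorm_minus_triangle) auto

lemma rn_dist_eq_0_iff:
  assumes "v \<in> carrier V" "w \<in> carrier V"
  shows "rn_dist M V v w = 0 \<longleftrightarrow> v = w"
proof -
  have "rn_dist M V v w = 0 \<longleftrightarrow> (AE x in M. repr (lnorm V (v \<ominus>\<^bsub>V\<^esub> w)) x = 0)"
    unfolding rn_dist_def using assms
    by (intro integral_min_1_eq_0_iff measurable_lnorm AE_lnorm_nonneg) auto
  also have "\<dots> \<longleftrightarrow> lnorm V (v \<ominus>\<^bsub>V\<^esub> w) = \<zero>\<^bsub>L0 M\<^esub>"
  proof
    assume "AE x in M. repr (lnorm V (v \<ominus>\<^bsub>V\<^esub> w)) x = 0"
    with AE_repr_L0_zero[of M]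
    have "AE x in M. repr (lnorm V (v \<ominus>\<^bsub>V\<^esub> w)) x = repr \<zero>\<^bsub>L0 M\<^esub> x" by auto
    then show "lnorm V (v \<ominus>\<^bsub>V\<^esub> w) = \<zero>\<^bsub>L0 M\<^esub>"
      using assms by (intro L0_eqI) auto
  qed (use AE_repr_L0_zero[of M] in simp)
  also have "\<dots> \<longleftrightarrow> v = w"
  proof -
    have "(v \<ominus>\<^bsub>V\<^esub> w) \<oplus>\<^bsub>V\<^esub> w = v"
      using assms by (simp add: mod.M.minus_eq mod.M.a_assoc mod.M.l_neg)
    then have "v \<ominus>\<^bsub>V\<^esub> w = \<zero>\<^bsub>V\<^esub> \<longleftrightarrow> v = w"
      using assms by (auto simp: mod.M.minus_eq mod.M.r_neg)
    then show ?thesis using assms by (simp add: lnorm_eq_zero_iff)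
  qed
  finally show ?thesis .
qed

lemma rn_dist_self: "v \<in> carrier V \<Longrightarrow> rn_dist M V v v = 0"
  by (simp add: rn_dist_eq_0_iff)

lemma rn_dist_add_le:
  assumes "u \<in> carrier V" "v \<in> carrier V" "u' \<in> carrier V" "v' \<in> carrier V"
  shows "rn_dist M V (u \<oplus>\<^bsub>V\<^esub> v) (u' \<oplus>\<^bsub>V\<^esub> v') \<le> rn_dist M V u u' + rn_dist M V v v'"
proof -
  have "(u \<oplus>\<^bsub>V\<^esub> v) \<ominus>\<^bsub>V\<^esub> (u' \<oplus>\<^bsub>V\<^esub> v') = (u \<ominus>\<^bsub>V\<^esub> u') \<oplus>\<^bsub>V\<^esub> (v \<ominus>\<^bsub>V\<^esub> v')"
    using assms by (simp add: mod.M.minus_eq mod.M.minus_add mod.M.a_ac)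
  then show ?thesis unfolding rn_dist_def using assms AE_lnorm_add[of "u \<ominus>\<^bsub>V\<^esub> u'" "v \<ominus>\<^bsub>V\<^esub> v'"]
    by (intro integral_min_1_triangle measurable_lnorm AE_lnorm_nonneg) auto
qed

lemma tendsto_rn_dist_add:
  assumes "range u \<subseteq> carrier V" "range u' \<subseteq> carrier V" "v \<in> carrier V" "v' \<in> carrier V"
    and "(\<lambda>n. rn_dist M V (u n) v) \<longlonglongrightarrow> 0" "(\<lambda>n. rn_dist M V (u' n) v') \<longlonglongrightarrow> 0"
  shows "(\<lambda>n. rn_dist M V (u n \<oplus>\<^bsub>V\<^esub> u' n) (v \<oplus>\<^bsub>V\<^esub> v')) \<longlonglongrightarrow> 0"
proof (rule Lim_null_comparison)
  have c: "u n \<in> carrier V" "u' n \<in> carrier V" for n using assms by auto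
  show "(\<lambda>n. rn_dist M V (u n) v + rn_dist M V (u' n) v') \<longlonglongrightarrow> 0"
    using tendsto_add[OF assms(5,6)] by simp
  show "\<forall>\<^sub>F n in sequentially. norm (rn_dist M V (u n \<oplus>\<^bsub>V\<^esub> u' n) (v \<oplus>\<^bsub>V\<^esub> v'))
      \<le> rn_dist M V (u n) v + rn_dist M V (u' n) v'"
    using assms c by (intro always_eventually allI) (simp add: rn_dist_nonneg rn_dist_add_le)
qed

text \<open>The norm of \<open>f\<close> times a difference is \<open>\<bar>f\<bar>\<close> times
  the norm of the difference, so this is the continuity of multiplication under truncated
  integrals.\<close>

lemma tendsto_rn_dist_smult:
  assumes "f \<in> carrier (L0 M)" "range u \<subseteq> carrier V" "v \<in> carrier V"
    and "(\<lambda>n. rn_dist M V (u n) v) \<longlonglongrightarrow> 0"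
  shows "(\<lambda>n. rn_dist M V (f \<odot>\<^bsub>V\<^esub> u n) (f \<odot>\<^bsub>V\<^esub> v)) \<longlonglongrightarrow> 0"
proof -
  have u: "u n \<in> carrier V" for n using assms(2) by auto
  have "rn_dist M V (f \<odot>\<^bsub>V\<^esub> u n) (f \<odot>\<^bsub>V\<^esub> v)
      = (\<integral>x. min (\<bar>repr f x\<bar> * repr (lnorm V (u n \<ominus>\<^bsub>V\<^esub> v)) x) 1 \<partial>M)" for n
  proof -
    have eq: "f \<odot>\<^bsub>V\<^esub> u n \<ominus>\<^bsub>V\<^esub> f \<odot>\<^bsub>V\<^esub> v = f \<odot>\<^bsub>V\<^esub> (u n \<ominus>\<^bsub>V\<^esub> v)"
      using assms u by (simp add: mod.M.minus_eq mod.smult_r_distr mod.smult_r_minus)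
    note [measurable] = measurable_repr_L0[OF assms(1)] measurable_lnorm[of "u n \<ominus>\<^bsub>V\<^esub> v"]
      measurable_lnorm[of "f \<odot>\<^bsub>V\<^esub> (u n \<ominus>\<^bsub>V\<^esub> v)"]
    show ?thesis unfolding rn_dist_def eq
      by (rule integral_cong_AE) (use AE_lnorm_smult[of f "u n \<ominus>\<^bsub>V\<^esub> v"] assms u in auto)
  qed
  moreover have "(\<lambda>n. \<integral>x. min (\<bar>repr f x\<bar> * repr (lnorm V (u n \<ominus>\<^bsub>V\<^esub> v)) x) 1 \<partial>M) \<longlonglongrightarrow> 0"
    using assms(4) unfolding rn_dist_def
    by (rule tendsto_integral_min_1_mult[rotated 3])
      (use assms u in \<open>auto intro: measurable_repr_L0 measurable_lnorm AE_lnorm_nonneg\<close>)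
  ultimately show ?thesis by simp
qed

text \<open>The reverse triangle inequality, obtained by applying the triangle inequality to
  \<open>v = (v - w) + w\<close> and to \<open>w = (w - v) + v\<close>. It makes the norms along a
  convergent sequence converge in \<open>L0 M\<close>.\<close>

lemma L0_dist_lnorm_le:
  assumes "v \<in> carrier V" "w \<in> carrier V"
  shows "L0_dist M (lnorm V v) (lnorm V w) \<le> rn_dist M V v w"
proof -
  have v: "v = (v \<ominus>\<^bsub>V\<^esub> w) \<oplus>\<^bsub>V\<^esub> w" and w: "w = (w \<ominus>\<^bsub>V\<^esub> v) \<oplus>\<^bsub>V\<^esub> v"
    using assms by (simp_all add: mod.M.minus_eq mod.M.a_assoc mod.M.l_neg)
  note [measurable] = assms[THEN measurable_lnorm]
  have "AE x in M. \<bar>repr (lnorm V v) x - repr (lnorm V w) x\<bar> \<le> repr (lnorm V (v \<ominus>\<^bsub>V\<^esub> w)) x"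
    using AE_lnorm_add[of "v \<ominus>\<^bsub>V\<^esub> w" w] AE_lnorm_add[of "w \<ominus>\<^bsub>V\<^esub> v" v] assms
    unfolding v[symmetric] w[symmetric] lnorm_minus_commute[OF assms(2,1)]
    by auto
  then show ?thesis unfolding L0_dist_def rn_dist_def using assms
    by (intro integral_min_1_mono measurable_lnorm) auto
qed

lemma rn_limit_unique:
  assumes "range u \<subseteq> carrier V" "v \<in> carrier V" "w \<in> carrier V"
    and "(\<lambda>n. rn_dist M V (u n) v) \<longlonglongrightarrow> 0" "(\<lambda>n. rn_dist M V (u n) w) \<longlonglongrightarrow> 0"
  shows "v = w"
proof -
  have u: "u n \<in> carrier V" for n using assms(1) by auto
  have "rn_dist M V v w \<le> rn_dist M V (u n) v + rn_dist M V (u n) w" for n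
    using rn_dist_triangle[OF assms(2) u assms(3)] rn_dist_commute[OF assms(2) u] by simp
  moreover have "(\<lambda>n. rn_dist M V (u n) v + rn_dist M V (u n) w) \<longlonglongrightarrow> 0"
    using tendsto_add[OF assms(4,5)] by simp
  ultimately have "rn_dist M V v w \<le> 0"
    by (intro LIMSEQ_le_const) auto
  then show ?thesis
    using rn_dist_eq_0_iff rn_dist_nonneg assms(2,3) by (metis antisym)
qed

text \<open>Turns equivalence of Cauchy sequences into equality of limits: once \<open>u\<close> has
  the limit \<open>w\<close>, being at vanishing distance from \<open>u\<close> can be stated
  without mentioning \<open>u\<close>.\<close>

lemma rn_limit_cong:
  assumes "range u \<subseteq> carrier V" "range v \<subseteq> carrier V" "w \<in> carrier V"
    and "(\<lambda>n. rn_dist M V (u n) w) \<longlonglongrightarrow> 0"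
  shows "(\<lambda>n. rn_dist M V (v n) (u n)) \<longlonglongrightarrow> 0 \<longleftrightarrow> (\<lambda>n. rn_dist M V (v n) w) \<longlonglongrightarrow> 0"
proof -
  have c: "u n \<in> carrier V" "v n \<in> carrier V" for n using assms by auto
  show ?thesis
  proof
    assume "(\<lambda>n. rn_dist M V (v n) (u n)) \<longlonglongrightarrow> 0"
    from tendsto_add[OF this assms(4)] show "(\<lambda>n. rn_dist M V (v n) w) \<longlonglongrightarrow> 0"
      by (intro tendsto_sandwich[of "\<lambda>_. 0" "\<lambda>n. rn_dist M V (v n) w" _
            "\<lambda>n. rn_dist M V (v n) (u n) + rn_dist M V (u n) w"])
        (auto intro!: always_eventually rn_dist_triangle rn_dist_nonneg c assms)
  next
    assume *: "(\<lambda>n. rn_dist M V (v n) w) \<longlonglongrightarrow> 0"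
    have "rn_dist M V (v n) (u n) \<le> rn_dist M V (v n) w + rn_dist M V (u n) w" for n
      using rn_dist_triangle[OF c(2) assms(3) c(1)] rn_dist_commute[OF c(1) assms(3)] by simp
    with tendsto_add[OF * assms(4)] show "(\<lambda>n. rn_dist M V (v n) (u n)) \<longlonglongrightarrow> 0"
      by (intro tendsto_sandwich[of "\<lambda>_. 0" "\<lambda>n. rn_dist M V (v n) (u n)" _
            "\<lambda>n. rn_dist M V (v n) w + rn_dist M V (u n) w"])
        (auto intro!: always_eventually rn_dist_nonneg c assms)
  qed
qed

lemma rn_Cauchy_if_limit:
  assumes u: "range u \<subseteq> carrier V" and w: "w \<in> carrier V" and lim: "(\<lambda>n. rn_dist M V (u n) w) \<longlonglongrightarrow> 0"
  shows "u \<in> rn_Cauchy M V"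
  unfolding rn_Cauchy_def
proof (intro CollectI conjI u allI impI)
  fix \<epsilon> :: real assume "0 < \<epsilon>"
  then have "eventually (\<lambda>n. rn_dist M V (u n) w < \<epsilon> / 2) sequentially"
    using order_tendstoD(2)[OF lim, of "\<epsilon> / 2"] by simp
  then obtain N where N: "\<And>n. n \<ge> N \<Longrightarrow> rn_dist M V (u n) w < \<epsilon> / 2"
    by (auto simp: eventually_sequentially)
  have c: "u n \<in> carrier V" for n using u by auto
  have "rn_dist M V (u m) (u n) < \<epsilon>" if "m \<ge> N" "n \<ge> N" for m n
    using rn_dist_triangle[OF c[of m] w c[of n]] rn_dist_commute[OF c[of n] w] N[OF that(1)] N[OF that(2)]
    by simp
  then show "\<exists>N. \<forall>m\<ge>N. \<forall>n\<ge>N. rn_dist M V (u m) (u n) < \<epsilon>" by blast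
qed

end

section \<open>Extension of dense isometric maps to the completion\<close>

text \<open>The module laws are equations, reflected by injectivity of \<open>I\<close>, and the
  norm is carried over unchanged. The completion of \<open>S1\<close> gets its structure this way,
  so that associativity, distributivity and the norm axioms are never checked on Cauchy
  sequences.\<close>

lemma random_normed_module_transport:
  fixes C :: "(('x \<Rightarrow> real) set, 'b) rn_module" and W :: "(('x \<Rightarrow> real) set, 'c) rn_module"
  assumes W: "random_normed_module M W"
    and bij: "bij_betw I (carrier C) (carrier W)"
    and zero: "\<zero>\<^bsub>C\<^esub> \<in> carrier C"
    and I_zero: "I \<zero>\<^bsub>C\<^esub> = \<zero>\<^bsub>W\<^esub>"
    and add: "\<And>v w. v \<in> carrier C \<Longrightarrow> w \<in> carrier C \<Longrightarrow> v \<oplus>\<^bsub>C\<^esub> w \<in> carrier C"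
    and I_add: "\<And>v w. v \<in> carrier C \<Longrightarrow> w \<in> carrier C \<Longrightarrow> I (v \<oplus>\<^bsub>C\<^esub> w) = I v \<oplus>\<^bsub>W\<^esub> I w"
    and smult: "\<And>f v. f \<in> carrier (L0 M) \<Longrightarrow> v \<in> carrier C \<Longrightarrow> f \<odot>\<^bsub>C\<^esub> v \<in> carrier C"
    and I_smult: "\<And>f v. f \<in> carrier (L0 M) \<Longrightarrow> v \<in> carrier C \<Longrightarrow> I (f \<odot>\<^bsub>C\<^esub> v) = f \<odot>\<^bsub>W\<^esub> I v"
    and lnorm: "\<And>v. v \<in> carrier C \<Longrightarrow> lnorm W (I v) = lnorm C v"
  shows "random_normed_module M C"
proof -
  interpret W: random_normed_module M W by (rule W)
  have I: "I v \<in> carrier W" if "v \<in> carrier C" for v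
    using bij that by (auto simp: bij_betw_def)
  have eqI: "v = w" if "I v = I w" "v \<in> carrier C" "w \<in> carrier C" for v w
    using bij that by (auto simp: bij_betw_def inj_on_def)
  have ex: "\<exists>v\<in>carrier C. I v = w" if "w \<in> carrier W" for w
    using bij that unfolding bij_betw_def by (metis imageE)
  have "Module.module (L0 M) C"
  proof (rule moduleI)
    show "abelian_group C"
    proof (rule abelian_groupI)
      fix v assume v: "v \<in> carrier C"
      \<comment> \<open>Inverses are the one axiom that asserts existence, and surjectivity of
        \<open>I\<close> provides them.\<close>
      obtain w where w: "w \<in> carrier C" "I w = \<ominus>\<^bsub>W\<^esub> I v"
        using ex[of "\<ominus>\<^bsub>W\<^esub> I v"] I v by auto
      then show "\<exists>w\<in>carrier C. w \<oplus>\<^bsub>C\<^esub> v = \<zero>\<^bsub>C\<^esub>"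
        using v by (intro bexI[of _ w] eqI) (auto simp: zero add I_zero I_add I W.mod.M.l_neg)
    qed (auto intro!: eqI simp: zero add I_zero I_add I W.mod.M.a_ac)
  qed (auto intro!: eqI simp: cring_L0 smult add I_smult I_add I
      W.mod.smult_l_distr W.mod.smult_r_distr W.mod.smult_assoc1)
  then show ?thesis
  proof (intro random_normed_module.intro random_normed_module_axioms.intro)
    show "prob_space M" by (rule W.prob_space_axioms)
    fix v assume v: "v \<in> carrier C"
    show "lnorm C v \<in> L0_pos M" using W.lnorm_pos[OF I[OF v]] by (simp add: lnorm v)
    show "lnorm C v = \<zero>\<^bsub>L0 M\<^esub> \<longleftrightarrow> v = \<zero>\<^bsub>C\<^esub>"
      using W.lnorm_eq_zero_iff[OF I[OF v]] eqI[of v "\<zero>\<^bsub>C\<^esub>"] v zero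
      by (auto simp: lnorm I_zero)
    show "lnorm C (v \<oplus>\<^bsub>C\<^esub> w) \<sqsubseteq>\<^bsub>L0_order M\<^esub> lnorm C v \<oplus>\<^bsub>L0 M\<^esub> lnorm C w"
      if w: "w \<in> carrier C" for w
      using W.lnorm_triangle[OF I[OF v] I[OF w]] v w add
      by (simp add: lnorm[symmetric] I_add)
    show "lnorm C (f \<odot>\<^bsub>C\<^esub> v) = L0_abs M f \<otimes>\<^bsub>L0 M\<^esub> lnorm C v" if f: "f \<in> carrier (L0 M)" for f
      using W.lnorm_smult[OF f I[OF v]] v f smult by (simp add: lnorm[symmetric] I_smult)
  qed
qed

text \<open>
  \<open>V\<close> is not required to be a random normed module: the \<open>L0\<close>-norm of \<open>S1\<close> need not separate points.
\<close>

locale rn_dense_map = cod: random_normed_module M W + dom: abelian_group V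
  for M :: "'x measure"
    and V :: "(('x \<Rightarrow> real) set, 'b) rn_module"
    and W :: "(('x \<Rightarrow> real) set, 'c) rn_module" +
  fixes T :: "'b \<Rightarrow> 'c"
  assumes smult_closed: "f \<in> carrier (L0 M) \<Longrightarrow> v \<in> carrier V \<Longrightarrow> f \<odot>\<^bsub>V\<^esub> v \<in> carrier V"
    and T_closed: "v \<in> carrier V \<Longrightarrow> T v \<in> carrier W"
    and T_add: "v \<in> carrier V \<Longrightarrow> w \<in> carrier V \<Longrightarrow> T (v \<oplus>\<^bsub>V\<^esub> w) = T v \<oplus>\<^bsub>W\<^esub> T w"
    and T_smult: "f \<in> carrier (L0 M) \<Longrightarrow> v \<in> carrier V \<Longrightarrow> T (f \<odot>\<^bsub>V\<^esub> v) = f \<odot>\<^bsub>W\<^esub> T v"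
    and T_lnorm: "v \<in> carrier V \<Longrightarrow> lnorm W (T v) = lnorm V v"
    and T_dense: "y \<in> carrier W \<Longrightarrow> 0 < \<epsilon> \<Longrightarrow> \<exists>v\<in>carrier V. rn_dist M W (T v) y < \<epsilon>"
    and cod_complete: "u \<in> rn_Cauchy M W \<Longrightarrow>
      \<exists>y\<in>carrier W. (\<lambda>n. rn_dist M W (u n) y) \<longlonglongrightarrow> 0"
begin

abbreviation converges :: "(nat \<Rightarrow> 'b) \<Rightarrow> 'c \<Rightarrow> bool"
  where "converges u w \<equiv> (\<lambda>n. rn_dist M W (T (u n)) w) \<longlonglongrightarrow> 0"

lemma T_zero: "T \<zero>\<^bsub>V\<^esub> = \<zero>\<^bsub>W\<^esub>"
proof -
  have "T \<zero>\<^bsub>V\<^esub> \<oplus>\<^bsub>W\<^esub> T \<zero>\<^bsub>V\<^esub> = T \<zero>\<^bsub>V\<^esub>"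
    using T_add[of "\<zero>\<^bsub>V\<^esub>" "\<zero>\<^bsub>V\<^esub>"] by simp
  then show ?thesis
    using T_closed[of "\<zero>\<^bsub>V\<^esub>"] by (simp add: cod.mod.M.add.r_cancel_one')
qed

lemma T_minus:
  assumes "v \<in> carrier V" "w \<in> carrier V"
  shows "T (v \<ominus>\<^bsub>V\<^esub> w) = T v \<ominus>\<^bsub>W\<^esub> T w"
proof -
  have "T (\<ominus>\<^bsub>V\<^esub> w) \<oplus>\<^bsub>W\<^esub> T w = \<zero>\<^bsub>W\<^esub>"
    using assms by (simp add: T_add[symmetric] T_zero dom.l_neg)
  then have "\<ominus>\<^bsub>W\<^esub> T w = T (\<ominus>\<^bsub>V\<^esub> w)"
    using assms by (intro cod.mod.M.minus_equality) (auto simp: T_closed)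
  then show ?thesis
    using assms by (simp add: dom.minus_eq cod.mod.M.minus_eq T_add)
qed

lemma rn_dist_T:
  "v \<in> carrier V \<Longrightarrow> w \<in> carrier V \<Longrightarrow> rn_dist M V v w = rn_dist M W (T v) (T w)"
  by (simp add: rn_dist_def T_minus[symmetric] T_lnorm)

lemma converges_unique:
  assumes "range u \<subseteq> carrier V" "v \<in> carrier W" "w \<in> carrier W" "converges u v" "converges u w"
  shows "v = w"
  using assms T_closed by (intro cod.rn_limit_unique[of "\<lambda>n. T (u n)"]) auto

text \<open>An additive isometry carries the Cauchy condition to \<open>W\<close>, where
  completeness turns it into convergence. From here on a Cauchy sequence is handled through the
  limit of its image.\<close>

lemma rn_Cauchy_iff:
  "u \<in> rn_Cauchy M V \<longleftrightarrow> range u \<subseteq> carrier V \<and> (\<exists>w\<in>carrier W. converges u w)"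
proof (cases "range u \<subseteq> carrier V")
  case True
  then have u: "u n \<in> carrier V" for n by auto
  have "u \<in> rn_Cauchy M V \<longleftrightarrow> (\<lambda>n. T (u n)) \<in> rn_Cauchy M W"
    using u T_closed by (auto simp: rn_Cauchy_def rn_dist_T)
  also have "\<dots> \<longleftrightarrow> (\<exists>w\<in>carrier W. converges u w)"
    using u T_closed by (auto intro!: cod.rn_Cauchy_if_limit cod_complete)
  finally show ?thesis using True by simp
qed (auto simp: rn_Cauchy_def)

text \<open>Two sequences in \<open>V\<close> are at vanishing distance exactly when their images
  have the same limit in \<open>W\<close>, so a completion class is a fibre of the limit map.
  Independence of representatives and injectivity of the extension reduce to this.\<close>

lemma rn_completion_class_iff:
  assumes "range u \<subseteq> carrier V" "w \<in> carrier W" "converges u w"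
  shows "v \<in> rn_completion_class M V u \<longleftrightarrow> range v \<subseteq> carrier V \<and> converges v w"
proof -
  have "(\<lambda>n. rn_dist M V (v n) (u n)) \<longlonglongrightarrow> 0 \<longleftrightarrow> converges v w" if "range v \<subseteq> carrier V"
  proof -
    have c: "v n \<in> carrier V" "u n \<in> carrier V" for n using that assms(1) by auto
    show ?thesis
      using cod.rn_limit_cong[of "\<lambda>n. T (u n)" "\<lambda>n. T (v n)" w] c assms T_closed
      by (auto simp: rn_dist_T)
  qed
  then show ?thesis
    using assms by (auto simp: rn_completion_class_def rn_Cauchy_iff)
qed

lemma rn_completion_class_cong:
  assumes "range u \<subseteq> carrier V" "range v \<subseteq> carrier V" "w \<in> carrier W" "converges u w" "converges v w"
  shows "rn_completion_class M V u = rn_completion_class M V v"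
  using rn_completion_class_iff[of u w] rn_completion_class_iff[of v w] assms by auto

text \<open>The limit of the image of any representative. The map is restricted to the carrier
  because isomorphisms are required to be extensional, without which they could not be unique as
  functions.\<close>

definition extension :: "(nat \<Rightarrow> 'b) set \<Rightarrow> 'c"
  where "extension = (\<lambda>U\<in>carrier (rn_completion M V). THE w. w \<in> carrier W \<and> converges (repr U) w)"

lemma rn_completion_carrierI:
  assumes "range u \<subseteq> carrier V" "w \<in> carrier W" "converges u w"
  shows "rn_completion_class M V u \<in> carrier (rn_completion M V)"
proof -
  have "u \<in> rn_Cauchy M V" using assms by (auto simp: rn_Cauchy_iff)
  then show ?thesis by (simp add: rn_completion_def)
qed

lemma extension_class:
  assumes "range u \<subseteq> carrier V" "w \<in> carrier W" "converges u w"
  shows "extension (rn_completion_class M V u) = w"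
proof -
  have "u \<in> rn_completion_class M V u" using rn_completion_class_iff assms by auto
  from repr_mem[OF this] have *: "range (repr (rn_completion_class M V u)) \<subseteq> carrier V"
    "converges (repr (rn_completion_class M V u)) w"
    using rn_completion_class_iff assms by auto
  with assms(2) have "(THE w. w \<in> carrier W \<and> converges (repr (rn_completion_class M V u)) w) = w"
    by (intro the_equality) (auto intro: converges_unique)
  then show ?thesis
    using rn_completion_carrierI[OF assms] by (simp add: extension_def)
qed

lemma
  assumes "U \<in> carrier (rn_completion M V)"
  shows range_repr_completion: "range (repr U) \<subseteq> carrier V"
    and extension_closed: "extension U \<in> carrier W"
    and converges_repr_completion: "converges (repr U) (extension U)"
    and class_repr_completion: "rn_completion_class M V (repr U) = U"
proof -
  obtain u w where u: "range u \<subseteq> carrier V" "w \<in> carrier W" "converges u w"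
    and U: "U = rn_completion_class M V u"
    using assms by (auto simp: rn_completion_def rn_Cauchy_iff)
  have "u \<in> U" using u rn_completion_class_iff U by auto
  from repr_mem[OF this] have r: "range (repr U) \<subseteq> carrier V" "converges (repr U) w"
    using u rn_completion_class_iff U by auto
  show "range (repr U) \<subseteq> carrier V" by (rule r(1))
  show "extension U \<in> carrier W" "converges (repr U) (extension U)"
    using extension_class[OF u] u r by (auto simp: U)
  show "rn_completion_class M V (repr U) = U"
    using rn_completion_class_cong[OF r(1) u(1,2) r(2) u(3)] U by simp
qed

lemma
  assumes "U \<in> carrier (rn_completion M V)" "U' \<in> carrier (rn_completion M V)"
  shows rn_completion_add_closed: "U \<oplus>\<^bsub>rn_completion M V\<^esub> U' \<in> carrier (rn_completion M V)"
    and extension_add: "extension (U \<oplus>\<^bsub>rn_completion M V\<^esub> U') = extension U \<oplus>\<^bsub>W\<^esub> extension U'"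
proof -
  let ?u = "\<lambda>n. repr U n \<oplus>\<^bsub>V\<^esub> repr U' n"
  have c: "repr U n \<in> carrier V" "repr U' n \<in> carrier V" for n
    using range_repr_completion assms by blast+
  have "converges ?u (extension U \<oplus>\<^bsub>W\<^esub> extension U')"
    using cod.tendsto_rn_dist_add[of "\<lambda>n. T (repr U n)" "\<lambda>n. T (repr U' n)"] assms c
    by (simp add: T_add T_closed image_subset_iff extension_closed converges_repr_completion)
  moreover have "range ?u \<subseteq> carrier V" "extension U \<oplus>\<^bsub>W\<^esub> extension U' \<in> carrier W"
    using c assms by (auto intro: extension_closed)
  ultimately show "U \<oplus>\<^bsub>rn_completion M V\<^esub> U' \<in> carrier (rn_completion M V)"
    "extension (U \<oplus>\<^bsub>rn_completion M V\<^esub> U') = extension U \<oplus>\<^bsub>W\<^esub> extension U'"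
    using rn_completion_carrierI[of ?u] extension_class[of ?u]
    by (simp_all add: rn_completion_def)
qed

lemma
  assumes f: "f \<in> carrier (L0 M)" and U: "U \<in> carrier (rn_completion M V)"
  shows rn_completion_smult_closed: "f \<odot>\<^bsub>rn_completion M V\<^esub> U \<in> carrier (rn_completion M V)"
    and extension_smult: "extension (f \<odot>\<^bsub>rn_completion M V\<^esub> U) = f \<odot>\<^bsub>W\<^esub> extension U"
proof -
  let ?u = "\<lambda>n. f \<odot>\<^bsub>V\<^esub> repr U n"
  have c: "repr U n \<in> carrier V" for n
    using range_repr_completion U by blast
  have "converges ?u (f \<odot>\<^bsub>W\<^esub> extension U)"
    using cod.tendsto_rn_dist_smult[of f "\<lambda>n. T (repr U n)"] f U c
    by (simp add: T_smult T_closed image_subset_iff extension_closed converges_repr_completion)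
  moreover have "range ?u \<subseteq> carrier V" "f \<odot>\<^bsub>W\<^esub> extension U \<in> carrier W"
    using c f U by (auto intro: extension_closed smult_closed)
  ultimately show "f \<odot>\<^bsub>rn_completion M V\<^esub> U \<in> carrier (rn_completion M V)"
    "extension (f \<odot>\<^bsub>rn_completion M V\<^esub> U) = f \<odot>\<^bsub>W\<^esub> extension U"
    using rn_completion_carrierI[of ?u] extension_class[of ?u]
    by (simp_all add: rn_completion_def)
qed

lemma extension_const:
  assumes "v \<in> carrier V"
  shows "rn_completion_embed M V v \<in> carrier (rn_completion M V)"
    and "extension (rn_completion_embed M V v) = T v"
proof -
  have "converges (\<lambda>_. v) (T v)" using assms by (simp add: cod.rn_dist_self T_closed)
  then show "rn_completion_embed M V v \<in> carrier (rn_completion M V)"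
    "extension (rn_completion_embed M V v) = T v"
    unfolding rn_completion_embed_def
    using assms by (auto intro!: rn_completion_carrierI extension_class T_closed)
qed

text \<open>The norms along a representative converge in \<open>L0 M\<close> by the reverse triangle
  inequality, and limits for \<open>L0_dist\<close> are unique. So the definite description in the
  norm of the completion denotes the norm of the limit.\<close>

lemma extension_lnorm:
  assumes U: "U \<in> carrier (rn_completion M V)"
  shows "lnorm W (extension U) = lnorm (rn_completion M V) U"
proof -
  let ?F = "lnorm W (extension U)"
  have c: "repr U n \<in> carrier V" for n
    using range_repr_completion U by blast
  have lim: "(\<lambda>n. L0_dist M (lnorm V (repr U n)) ?F) \<longlonglongrightarrow> 0"
    by (rule Lim_null_comparison[OF _ converges_repr_completion[OF U]])
      (use cod.L0_dist_lnorm_le[OF T_closed[OF c] extension_closed[OF U]] c in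
        \<open>auto intro!: always_eventually simp: T_lnorm cod.L0_dist_nonneg\<close>)
  have "lnorm (rn_completion M V) U
      = (THE F. F \<in> L0_pos M \<and> (\<lambda>n. L0_dist M (lnorm V (repr U n)) F) \<longlonglongrightarrow> 0)"
    by (simp add: rn_completion_def)
  also have "\<dots> = ?F"
  proof (rule the_equality)
    show "?F \<in> L0_pos M \<and> (\<lambda>n. L0_dist M (lnorm V (repr U n)) ?F) \<longlonglongrightarrow> 0"
      using lim U by (auto intro: cod.lnorm_pos extension_closed)
  next
    fix F assume F: "F \<in> L0_pos M \<and> (\<lambda>n. L0_dist M (lnorm V (repr U n)) F) \<longlonglongrightarrow> 0"
    have cl: "F \<in> carrier (L0 M)" "?F \<in> carrier (L0 M)"
      "lnorm V (repr U n) \<in> carrier (L0 M)" for n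
      using F U c by (auto simp: L0_pos_iff extension_closed T_lnorm[symmetric] T_closed)
    have "L0_dist M F ?F \<le> L0_dist M (lnorm V (repr U n)) F + L0_dist M (lnorm V (repr U n)) ?F" for n
      by (rule cod.L0_dist_triangle) (use cl in auto)
    moreover have "(\<lambda>n. L0_dist M (lnorm V (repr U n)) F + L0_dist M (lnorm V (repr U n)) ?F) \<longlonglongrightarrow> 0"
      using tendsto_add[OF conjunct2[OF F] lim] by simp
    ultimately have "L0_dist M F ?F \<le> 0" by (intro LIMSEQ_le_const) auto
    then show "F = ?F" using cl cod.L0_dist_nonneg[of F ?F] by (intro cod.L0_dist_eq_0_imp_eq) auto
  qed
  finally show ?thesis by simp
qed

text \<open>Sequences with the same limit form one class, which gives injectivity even when
  \<open>V\<close> contains nonzero elements of norm zero. Surjectivity is density: a sequence of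
  ever closer approximants represents a class with the prescribed limit.\<close>

lemma extension_bij: "bij_betw extension (carrier (rn_completion M V)) (carrier W)"
proof (rule bij_betw_imageI)
  show "inj_on extension (carrier (rn_completion M V))"
  proof (rule inj_onI)
    fix U U' assume U: "U \<in> carrier (rn_completion M V)" "U' \<in> carrier (rn_completion M V)"
      and eq: "extension U = extension U'"
    have "rn_completion_class M V (repr U) = rn_completion_class M V (repr U')"
      using U converges_repr_completion[of U] converges_repr_completion[of U']
      by (intro rn_completion_class_cong[where w="extension U"])
        (auto simp: eq intro: extension_closed dest: range_repr_completion)
    then show "U = U'" using U by (simp add: class_repr_completion)
  qed
  have "w \<in> extension ` carrier (rn_completion M V)" if w: "w \<in> carrier W" for w
  proof -
    have "\<forall>n. \<exists>v\<in>carrier V. rn_dist M W (T v) w < inverse (real (Suc n))"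
      using T_dense[OF w] by simp
    then obtain u where u: "\<And>n. u n \<in> carrier V" "\<And>n. rn_dist M W (T (u n)) w < inverse (real (Suc n))"
      by metis
    have "converges u w"
      by (rule Lim_null_comparison[OF always_eventually LIMSEQ_inverse_real_of_nat], rule allI)
        (use u w in \<open>simp only: real_norm_def abs_of_nonneg cod.rn_dist_nonneg T_closed less_imp_le\<close>)
    then show ?thesis
      using u w extension_class[of u w] rn_completion_carrierI[of u w] by (auto intro!: image_eqI)
  qed
  then show "extension ` carrier (rn_completion M V) = carrier W"
    by (auto intro: extension_closed)
qed

text \<open>\<open>extension\<close> is already bijective, compatible with the operations and norm
  preserving. The completion therefore becomes a random normed module by transport from
  \<open>W\<close>, and only after that can \<open>extension\<close> be called an isomorphism of
  such modules.\<close>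

theorem extension_isometric_iso: "rn_module_isometric_iso M (rn_completion M V) W extension"
proof -
  have zero: "\<zero>\<^bsub>rn_completion M V\<^esub> = rn_completion_embed M V \<zero>\<^bsub>V\<^esub>"
    by (simp add: rn_completion_def rn_completion_embed_def)
  have "random_normed_module M (rn_completion M V)"
    by (rule random_normed_module_transport[OF cod.random_normed_module_axioms extension_bij])
      (simp_all add: zero extension_const T_zero rn_completion_add_closed extension_add
        rn_completion_smult_closed extension_smult extension_lnorm)
  moreover have "extension \<in> extensional (carrier (rn_completion M V))"
    by (simp add: extension_def)
  ultimately show ?thesis
    by (intro rn_module_isometric_iso.intro rn_module_isometric_iso_axioms.intro)
      (auto simp: cod.random_normed_module_axioms extension_bij extension_add
        extension_smult extension_lnorm PiE_def
        intro: extension_closed)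
qed

end

section \<open>The space \<open>L1\<close> of a foliation\<close>

text \<open>Sum and integral commute for nonnegative terms, and a function with finite integral is
  finite a.e. The completeness proof applies this over the base to truncated norms and in each fibre
  to increments.\<close>

lemma AE_summable_if_summable_integral:
  fixes f :: "nat \<Rightarrow> 'a \<Rightarrow> real"
  assumes int: "\<And>n. integrable M (f n)" and pos: "\<And>n. AE x in M. 0 \<le> f n x"
    and summ: "summable (\<lambda>n. \<integral>x. f n x \<partial>M)"
  shows "AE x in M. summable (\<lambda>n. f n x)"
proof -
  have [measurable]: "f n \<in> borel_measurable M" for n using int by auto
  have "(\<integral>\<^sup>+x. (\<Sum>n. ennreal (f n x)) \<partial>M) = (\<Sum>n. \<integral>\<^sup>+x. ennreal (f n x) \<partial>M)"
    by (intro nn_integral_suminf) measurable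
  also have "\<dots> = (\<Sum>n. ennreal (\<integral>x. f n x \<partial>M))"
    by (intro suminf_cong nn_integral_eq_integral int pos)
  also have "\<dots> = ennreal (\<Sum>n. \<integral>x. f n x \<partial>M)"
    by (intro suminf_ennreal2 summ integral_nonneg_AE pos)
  finally have "(\<integral>\<^sup>+x. (\<Sum>n. ennreal (f n x)) \<partial>M) \<noteq> \<infinity>" by simp
  then have "AE x in M. (\<Sum>n. ennreal (f n x)) \<noteq> \<infinity>"
    by (intro nn_integral_PInf_AE) measurable
  moreover have "AE x in M. \<forall>n. 0 \<le> f n x" using pos by (simp add: AE_all_countable)
  ultimately show ?thesis
    by eventually_elim (auto intro: summable_suminf_not_top)
qed

text \<open>Isolates the family of fibre measures, which together with the two underlying spaces
  determines \<open>L1t\<close>. The \<open>L0\<close>-valued measure joins later, through its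
  relation to this family.\<close>

locale prob_kernel = prob_space M
  for M :: "'x measure" +
  fixes \<Omega> :: "'w measure" and \<mu>x :: "'x \<Rightarrow> 'w measure"
  assumes prob_space_kernel: "x \<in> space M \<Longrightarrow> prob_space (\<mu>x x)"
    and sets_kernel: "x \<in> space M \<Longrightarrow> sets (\<mu>x x) = sets \<Omega>"
    and measurable_measure_kernel: "A \<in> sets \<Omega> \<Longrightarrow>
      (\<lambda>x. measure (\<mu>x x) A) \<in> borel_measurable (completion M)"
begin

abbreviation \<L> :: "('w \<times> 'x \<Rightarrow> real) set"
  where "\<L> \<equiv> L1t_functions \<Omega> M \<mu>x"

abbreviation cls :: "('w \<times> 'x \<Rightarrow> real) \<Rightarrow> ('w \<times> 'x \<Rightarrow> real) set"
  where "cls \<equiv> L1t_class \<Omega> M \<mu>x"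

definition norm1 :: "('w \<times> 'x \<Rightarrow> real) \<Rightarrow> 'x \<Rightarrow> real"
  where "norm1 F x = (\<integral>p. \<bar>F (p, x)\<bar> \<partial>\<mu>x x)"

lemma space_kernel: "x \<in> space M \<Longrightarrow> space (\<mu>x x) = space \<Omega>"
  by (intro sets_eq_imp_space_eq sets_kernel)

text \<open>Views the family as a measurable map into the space of subprobability measures, so that
  integrals of jointly measurable functions over the fibres are measurable in the parameter.\<close>

lemma measurable_kernel: "\<mu>x \<in> completion M \<rightarrow>\<^sub>M subprob_algebra \<Omega>"
proof (rule measurable_subprob_algebra)
  fix x assume "x \<in> space (completion M)"
  then interpret K: prob_space "\<mu>x x" by (simp add: prob_space_kernel)
  show "subprob_space (\<mu>x x)" by unfold_locales
next
  fix A assume A: "A \<in> sets \<Omega>"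
  have "emeasure (\<mu>x x) A = ennreal (measure (\<mu>x x) A)" if "x \<in> space (completion M)" for x
  proof -
    interpret K: prob_space "\<mu>x x" using that by (simp add: prob_space_kernel)
    show ?thesis by (rule K.emeasure_eq_measure)
  qed
  moreover have "(\<lambda>x. ennreal (measure (\<mu>x x) A)) \<in> borel_measurable (completion M)"
    using measurable_measure_kernel[OF A] by measurable
  ultimately show "(\<lambda>x. emeasure (\<mu>x x) A) \<in> borel_measurable (completion M)"
    by (subst measurable_cong) auto
qed (simp add: sets_kernel)

lemma measurable_section:
  assumes "F \<in> borel_measurable (\<Omega> \<Otimes>\<^sub>M completion M)" "x \<in> space M"
  shows "(\<lambda>p. F (p, x)) \<in> borel_measurable (\<mu>x x)"
proof -
  have "(\<lambda>p. F (p, x)) \<in> borel_measurable \<Omega>"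
    using assms by (intro measurable_compose[OF _ assms(1)]) simp
  then show ?thesis using sets_kernel[OF assms(2)] measurable_cong_sets by blast
qed

lemma measurable_norm1:
  assumes [measurable]: "F \<in> borel_measurable (\<Omega> \<Otimes>\<^sub>M completion M)"
  shows "norm1 F \<in> borel_measurable (completion M)"
proof -
  have [measurable]: "(\<lambda>x. \<integral>\<^sup>+p. ennreal \<bar>F (p, x)\<bar> \<partial>\<mu>x x) \<in> borel_measurable (completion M)"
  proof (rule nn_integral_measurable_subprob_algebra2[OF _ measurable_kernel])
    have "(\<lambda>z. ennreal \<bar>F (snd z, fst z)\<bar>) \<in> borel_measurable (completion M \<Otimes>\<^sub>M \<Omega>)"
      by measurable
    then show "(\<lambda>(x, p). ennreal \<bar>F (p, x)\<bar>) \<in> borel_measurable (completion M \<Otimes>\<^sub>M \<Omega>)"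
      by (simp add: case_prod_beta')
  qed
  \<comment> \<open>Valid at every \<open>x\<close> of the base: where the section is not
    integrable, the Bochner integral is 0, and so is \<open>enn2real \<infinity>\<close>.\<close>
  have "norm1 F x = enn2real (\<integral>\<^sup>+p. ennreal \<bar>F (p, x)\<bar> \<partial>\<mu>x x)" if "x \<in> space M" for x
    unfolding norm1_def using measurable_section[OF assms that]
    by (intro integral_eq_nn_integral) auto
  moreover have "(\<lambda>x. enn2real (\<integral>\<^sup>+p. ennreal \<bar>F (p, x)\<bar> \<partial>\<mu>x x)) \<in> borel_measurable (completion M)"
    by measurable
  ultimately show ?thesis
    by (subst measurable_cong) auto
qed

lemma norm1_nonneg: "0 \<le> norm1 F x"
  by (simp add: norm1_def)

lemma L1t_functions_iff: "F \<in> \<L> \<longleftrightarrow> F \<in> borel_measurable (\<Omega> \<Otimes>\<^sub>M completion M) \<and>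
    (AE x in M. integrable (\<mu>x x) (\<lambda>p. F (p, x)))"
  by (simp add: L1t_functions_def)

lemma
  assumes "F \<in> \<L>"
  shows L1t_functions_measurable: "F \<in> borel_measurable (\<Omega> \<Otimes>\<^sub>M completion M)"
    and L1t_functions_integrable: "AE x in M. integrable (\<mu>x x) (\<lambda>p. F (p, x))"
  using assms by (auto simp: L1t_functions_iff)

lemma L1t_functions_add:
  assumes "F \<in> \<L>" "G \<in> \<L>"
  shows "(\<lambda>z. F z + G z) \<in> \<L>"
  using assms unfolding L1t_functions_iff by (auto elim: AE_mp)

lemma L1t_functions_diff:
  assumes "F \<in> \<L>" "G \<in> \<L>"
  shows "(\<lambda>z. F z - G z) \<in> \<L>"
  using assms unfolding L1t_functions_iff by (auto elim: AE_mp)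

lemma L1t_functions_smult:
  assumes "f \<in> borel_measurable (completion M)" "F \<in> \<L>"
  shows "(\<lambda>(p, x). f x * F (p, x)) \<in> \<L>"
  using assms unfolding L1t_functions_iff by (auto elim: AE_mp simp: case_prod_beta)

lemma L1t_functions_bounded:
  assumes "F \<in> borel_measurable (\<Omega> \<Otimes>\<^sub>M completion M)" "\<And>z. \<bar>F z\<bar> \<le> B"
  shows "F \<in> \<L>"
  unfolding L1t_functions_iff
proof (intro conjI assms(1) AE_I2)
  fix x assume x: "x \<in> space M"
  interpret x: prob_space "\<mu>x x" by (rule prob_space_kernel[OF x])
  show "integrable (\<mu>x x) (\<lambda>p. F (p, x))"
    by (rule x.integrable_const_bound[where B=B]) (use assms x in \<open>auto intro: measurable_section\<close>)
qed

lemma L1t_functions_dominated: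
  assumes F: "F \<in> borel_measurable (\<Omega> \<Otimes>\<^sub>M completion M)" and G: "G \<in> \<L>"
    and le: "\<And>p x. p \<in> space \<Omega> \<Longrightarrow> x \<in> space M \<Longrightarrow> \<bar>F (p, x)\<bar> \<le> G (p, x)"
  shows "F \<in> \<L>"
  unfolding L1t_functions_iff
proof (intro conjI F)
  show "AE x in M. integrable (\<mu>x x) (\<lambda>p. F (p, x))"
    using L1t_functions_integrable[OF G] AE_space
  proof eventually_elim
    case (elim x)
    show ?case
      by (rule Bochner_Integration.integrable_bound[OF elim(1) measurable_section[OF F elim(2)]])
        (rule AE_I2, use order_trans[OF le abs_ge_self] elim(2) in \<open>simp add: space_kernel\<close>)
  qed
qed

lemma L1t_class_cong:
  assumes "AE x in M. AE p in \<mu>x x. F (p, x) = G (p, x)"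
  shows "cls F = cls G"
proof -
  have "(AE x in M. AE p in \<mu>x x. H (p, x) = F (p, x)) \<longleftrightarrow> (AE x in M. AE p in \<mu>x x. H (p, x) = G (p, x))" for H
  proof
    assume "AE x in M. AE p in \<mu>x x. H (p, x) = F (p, x)"
    with assms show "AE x in M. AE p in \<mu>x x. H (p, x) = G (p, x)"
    proof eventually_elim
      case (elim x)
      then show ?case by eventually_elim simp
    qed
  next
    assume "AE x in M. AE p in \<mu>x x. H (p, x) = G (p, x)"
    with assms show "AE x in M. AE p in \<mu>x x. H (p, x) = F (p, x)"
    proof eventually_elim
      case (elim x)
      then show ?case by eventually_elim simp
    qed
  qed
  then show ?thesis by (auto simp: L1t_class_def)
qed

lemma L1t_class_cong_space:
  assumes "\<And>p x. p \<in> space \<Omega> \<Longrightarrow> x \<in> space M \<Longrightarrow> F (p, x) = G (p, x)"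
  shows "cls F = cls G"
  by (intro L1t_class_cong AE_I2) (use assms space_kernel in auto)

lemma
  assumes "F \<in> \<L>"
  shows repr_L1t_class: "repr (cls F) \<in> \<L>"
    and AE_repr_L1t_class: "AE x in M. AE p in \<mu>x x. repr (cls F) (p, x) = F (p, x)"
proof -
  have "F \<in> cls F" using assms by (simp add: L1t_class_def)
  from repr_mem[OF this]
  show "repr (cls F) \<in> \<L>" "AE x in M. AE p in \<mu>x x. repr (cls F) (p, x) = F (p, x)"
    by (auto simp: L1t_class_def)
qed

lemma norm1_cong:
  assumes "F \<in> \<L>" "G \<in> \<L>" "AE x in M. AE p in \<mu>x x. F (p, x) = G (p, x)"
  shows "AE x in M. norm1 F x = norm1 G x"
  using assms(3) AE_space
proof eventually_elim
  case (elim x)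
  note [measurable] = measurable_section[OF L1t_functions_measurable[OF assms(1)] elim(2)]
    measurable_section[OF L1t_functions_measurable[OF assms(2)] elim(2)]
  show ?case unfolding norm1_def
    by (rule integral_cong_AE) (use elim(1) in auto)
qed

lemma L1t_carrierE:
  assumes "C \<in> carrier (L1t \<Omega> M \<mu>x)"
  obtains F where "F \<in> \<L>" "C = cls F"
  using assms by (auto simp: L1t_def)

lemma L1t_carrierI: "F \<in> \<L> \<Longrightarrow> cls F \<in> carrier (L1t \<Omega> M \<mu>x)"
  by (auto simp: L1t_def)

lemma lnorm_L1t:
  assumes "F \<in> \<L>"
  shows "lnorm (L1t \<Omega> M \<mu>x) (cls F) = L0_class M (norm1 F)"
proof -
  have "lnorm (L1t \<Omega> M \<mu>x) (cls F) = L0_class M (norm1 (repr (cls F)))"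
    by (simp add: L1t_def norm1_def[abs_def])
  also have "\<dots> = L0_class M (norm1 F)"
    by (intro L0_class_cong_AE norm1_cong repr_L1t_class AE_repr_L1t_class assms)
  finally show ?thesis .
qed

lemma add_L1t:
  assumes "F \<in> \<L>" "G \<in> \<L>"
  shows "cls F \<oplus>\<^bsub>L1t \<Omega> M \<mu>x\<^esub> cls G = cls (\<lambda>z. F z + G z)"
proof -
  have "AE x in M. AE p in \<mu>x x. repr (cls F) (p, x) + repr (cls G) (p, x) = F (p, x) + G (p, x)"
    using AE_repr_L1t_class[OF assms(1)] AE_repr_L1t_class[OF assms(2)]
  proof eventually_elim
    case (elim x)
    then show ?case by eventually_elim simp
  qed
  then show ?thesis by (auto simp: L1t_def intro!: L1t_class_cong)
qed

lemma smult_L1t: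
  assumes "F \<in> \<L>"
  shows "f \<odot>\<^bsub>L1t \<Omega> M \<mu>x\<^esub> cls F = cls (\<lambda>(p, x). repr f x * F (p, x))"
proof -
  have "AE x in M. AE p in \<mu>x x. repr f x * repr (cls F) (p, x) = repr f x * F (p, x)"
    using AE_repr_L1t_class[OF assms]
  proof eventually_elim
    case (elim x)
    then show ?case by eventually_elim simp
  qed
  then show ?thesis by (auto simp: L1t_def intro!: L1t_class_cong)
qed

lemma smult_L1t_class:
  assumes "f \<in> borel_measurable (completion M)" "F \<in> \<L>"
  shows "L0_class M f \<odot>\<^bsub>L1t \<Omega> M \<mu>x\<^esub> cls F = cls (\<lambda>(p, x). f x * F (p, x))"
  unfolding smult_L1t[OF assms(2)]
  by (rule L1t_class_cong) (use AE_repr_L0_class[OF assms(1)] in auto)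

lemma zero_L1t: "\<zero>\<^bsub>L1t \<Omega> M \<mu>x\<^esub> = cls (\<lambda>_. 0)"
  by (simp add: L1t_def)

lemma L1t_functions_zero: "(\<lambda>_. 0) \<in> \<L>"
  by (rule L1t_functions_bounded) auto

lemma L1t_functions_smult_L0:
  "f \<in> carrier (L0 M) \<Longrightarrow> F \<in> \<L> \<Longrightarrow> (\<lambda>(p, x). repr f x * F (p, x)) \<in> \<L>"
  by (intro L1t_functions_smult measurable_repr_L0_completion)

lemma norm1_eq_0_iff:
  assumes "F \<in> \<L>"
  shows "(AE x in M. norm1 F x = 0) \<longleftrightarrow> (AE x in M. AE p in \<mu>x x. F (p, x) = 0)"
proof -
  have "AE x in M. norm1 F x = 0 \<longleftrightarrow> (AE p in \<mu>x x. F (p, x) = 0)"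
    using L1t_functions_integrable[OF assms]
  proof eventually_elim
    case (elim x)
    then have "norm1 F x = 0 \<longleftrightarrow> (AE p in \<mu>x x. \<bar>F (p, x)\<bar> = 0)"
      unfolding norm1_def by (intro integral_nonneg_eq_0_iff_AE) auto
    then show ?case by simp
  qed
  then show ?thesis by (auto elim: AE_mp)
qed

lemma norm1_add_le:
  assumes "F \<in> \<L>" "G \<in> \<L>"
  shows "AE x in M. norm1 (\<lambda>z. F z + G z) x \<le> norm1 F x + norm1 G x"
  using L1t_functions_integrable[OF assms(1)] L1t_functions_integrable[OF assms(2)]
proof eventually_elim
  case (elim x)
  have "norm1 (\<lambda>z. F z + G z) x \<le> (\<integral>p. \<bar>F (p, x)\<bar> + \<bar>G (p, x)\<bar> \<partial>\<mu>x x)"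
    unfolding norm1_def using elim by (intro integral_mono) auto
  also have "\<dots> = norm1 F x + norm1 G x"
    unfolding norm1_def using elim by (intro Bochner_Integration.integral_add) auto
  finally show ?case .
qed

lemma L1t_class_eq_iff:
  assumes "F \<in> \<L>" "G \<in> \<L>"
  shows "cls F = cls G \<longleftrightarrow> (AE x in M. AE p in \<mu>x x. F (p, x) = G (p, x))"
proof
  assume "cls F = cls G"
  then have "F \<in> cls G" using assms by (auto simp: L1t_class_def)
  then show "AE x in M. AE p in \<mu>x x. F (p, x) = G (p, x)" by (simp add: L1t_class_def)
qed (rule L1t_class_cong)

text \<open>The group laws and distributivity over vectors hold for representatives at every point.
  The laws that involve ring operations on scalars hold only for a.e. \<open>x\<close>, because
  \<open>repr\<close> commutes with these operations up to null sets.\<close>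

lemma random_normed_module_L1t: "random_normed_module M (L1t \<Omega> M \<mu>x)"
proof (intro random_normed_module.intro random_normed_module_axioms.intro)
  show "prob_space M" by (rule prob_space_axioms)
  show "Module.module (L0 M) (L1t \<Omega> M \<mu>x)"
  proof (rule moduleI)
    show "abelian_group (L1t \<Omega> M \<mu>x)"
    proof (rule abelian_groupI)
      fix C assume "C \<in> carrier (L1t \<Omega> M \<mu>x)"
      then obtain F where F: "F \<in> \<L>" "C = cls F" by (rule L1t_carrierE)
      have "(\<lambda>z. 0 - F z) \<in> \<L>" by (intro L1t_functions_diff L1t_functions_zero F)
      with F show "\<exists>D\<in>carrier (L1t \<Omega> M \<mu>x). D \<oplus>\<^bsub>L1t \<Omega> M \<mu>x\<^esub> C = \<zero>\<^bsub>L1t \<Omega> M \<mu>x\<^esub>"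
        by (intro bexI[of _ "cls (\<lambda>z. 0 - F z)"]) (auto simp: add_L1t zero_L1t L1t_carrierI)
    qed (auto elim!: L1t_carrierE intro!: L1t_carrierI simp: add_L1t zero_L1t L1t_functions_add
        L1t_functions_zero ac_simps)
  next
    fix f C assume f: "f \<in> carrier (L0 M)" and "C \<in> carrier (L1t \<Omega> M \<mu>x)"
    then obtain F where F: "F \<in> \<L>" "C = cls F" by (elim L1t_carrierE)
    note fF = L1t_functions_smult_L0[OF f F(1)]
    show "f \<odot>\<^bsub>L1t \<Omega> M \<mu>x\<^esub> C \<in> carrier (L1t \<Omega> M \<mu>x)"
      using F fF by (auto simp: smult_L1t intro!: L1t_carrierI)
    show "f \<odot>\<^bsub>L1t \<Omega> M \<mu>x\<^esub> (C \<oplus>\<^bsub>L1t \<Omega> M \<mu>x\<^esub> D)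
        = f \<odot>\<^bsub>L1t \<Omega> M \<mu>x\<^esub> C \<oplus>\<^bsub>L1t \<Omega> M \<mu>x\<^esub> f \<odot>\<^bsub>L1t \<Omega> M \<mu>x\<^esub> D"
      if "D \<in> carrier (L1t \<Omega> M \<mu>x)" for D
    proof -
      from that obtain G where G: "G \<in> \<L>" "D = cls G" by (rule L1t_carrierE)
      show ?thesis
        by (simp add: F G smult_L1t add_L1t L1t_functions_add L1t_functions_smult_L0 f)
          (simp add: case_prod_beta' distrib_left)
    qed
    fix g assume g: "g \<in> carrier (L0 M)"
    note gF = L1t_functions_smult_L0[OF g F(1)]
    show "(f \<oplus>\<^bsub>L0 M\<^esub> g) \<odot>\<^bsub>L1t \<Omega> M \<mu>x\<^esub> C
        = f \<odot>\<^bsub>L1t \<Omega> M \<mu>x\<^esub> C \<oplus>\<^bsub>L1t \<Omega> M \<mu>x\<^esub> g \<odot>\<^bsub>L1t \<Omega> M \<mu>x\<^esub> C"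
      unfolding F(2) smult_L1t[OF F(1)] add_L1t[OF fF gF]
      by (rule L1t_class_cong) (use AE_repr_L0_add[OF f g] in \<open>auto simp: distrib_right\<close>)
    show "(f \<otimes>\<^bsub>L0 M\<^esub> g) \<odot>\<^bsub>L1t \<Omega> M \<mu>x\<^esub> C
        = f \<odot>\<^bsub>L1t \<Omega> M \<mu>x\<^esub> (g \<odot>\<^bsub>L1t \<Omega> M \<mu>x\<^esub> C)"
      unfolding F(2) smult_L1t[OF F(1)] smult_L1t[OF gF]
      by (rule L1t_class_cong) (use AE_repr_L0_mult[OF f g] in auto)
  next
    fix C assume "C \<in> carrier (L1t \<Omega> M \<mu>x)"
    then obtain F where F: "F \<in> \<L>" "C = cls F" by (elim L1t_carrierE)
    show "\<one>\<^bsub>L0 M\<^esub> \<odot>\<^bsub>L1t \<Omega> M \<mu>x\<^esub> C = C"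
      unfolding F(2) smult_L1t[OF F(1)]
      by (rule L1t_class_cong) (use AE_repr_L0_one[of M] in auto)
  qed (rule cring_L0)
next
  fix C assume "C \<in> carrier (L1t \<Omega> M \<mu>x)"
  then obtain F where F: "F \<in> \<L>" "C = cls F" by (elim L1t_carrierE)
  note mF = measurable_norm1[OF L1t_functions_measurable[OF F(1)]]
  show "lnorm (L1t \<Omega> M \<mu>x) C \<in> L0_pos M"
    unfolding F(2) lnorm_L1t[OF F(1)] by (intro L0_class_pos mF AE_I2 norm1_nonneg)
  have "L0_class M (norm1 F) = \<zero>\<^bsub>L0 M\<^esub> \<longleftrightarrow> (AE x in M. norm1 F x = 0)"
    using L0_class_eq_iff[OF mF, of "\<lambda>_. 0"] by (simp add: L0_def)
  then show "lnorm (L1t \<Omega> M \<mu>x) C = \<zero>\<^bsub>L0 M\<^esub> \<longleftrightarrow> C = \<zero>\<^bsub>L1t \<Omega> M \<mu>x\<^esub>"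
    unfolding F(2) lnorm_L1t[OF F(1)] zero_L1t L1t_class_eq_iff[OF F(1) L1t_functions_zero]
    using norm1_eq_0_iff[OF F(1)] by simp
  show "lnorm (L1t \<Omega> M \<mu>x) (C \<oplus>\<^bsub>L1t \<Omega> M \<mu>x\<^esub> D) \<sqsubseteq>\<^bsub>L0_order M\<^esub>
      lnorm (L1t \<Omega> M \<mu>x) C \<oplus>\<^bsub>L0 M\<^esub> lnorm (L1t \<Omega> M \<mu>x) D"
    if "D \<in> carrier (L1t \<Omega> M \<mu>x)" for D
  proof -
    from that obtain G where G: "G \<in> \<L>" "D = cls G" by (elim L1t_carrierE)
    note mG = measurable_norm1[OF L1t_functions_measurable[OF G(1)]]
    note FG = L1t_functions_add[OF F(1) G(1)]
    note mFG = measurable_norm1[OF L1t_functions_measurable[OF FG]]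
    show ?thesis
      unfolding F(2) G(2) add_L1t[OF F(1) G(1)] lnorm_L1t[OF F(1)] lnorm_L1t[OF G(1)] lnorm_L1t[OF FG]
        L0_le_iff
      using AE_repr_L0_class[OF mF] AE_repr_L0_class[OF mG] AE_repr_L0_class[OF mFG]
        AE_repr_L0_add[OF L0_carrierI[OF mF] L0_carrierI[OF mG]] norm1_add_le[OF F(1) G(1)]
      by eventually_elim simp
  qed
  show "lnorm (L1t \<Omega> M \<mu>x) (f \<odot>\<^bsub>L1t \<Omega> M \<mu>x\<^esub> C) = L0_abs M f \<otimes>\<^bsub>L0 M\<^esub> lnorm (L1t \<Omega> M \<mu>x) C"
    if f: "f \<in> carrier (L0 M)" for f
  proof -
    note fF = L1t_functions_smult_L0[OF f F(1)]
    have "AE x in M. norm1 (\<lambda>(p, x). repr f x * F (p, x)) x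
        = repr (L0_abs M f) x * repr (L0_class M (norm1 F)) x"
      using AE_repr_L0_class[OF mF] AE_repr_L0_abs[OF f]
      by eventually_elim (simp add: norm1_def abs_mult)
    then show ?thesis
      unfolding F(2) smult_L1t[OF F(1)] lnorm_L1t[OF F(1)] lnorm_L1t[OF fF] L0_mult_def
      by (rule L0_class_cong_AE)
  qed
qed

end

sublocale prob_kernel \<subseteq> L1t: random_normed_module M "L1t \<Omega> M \<mu>x"
  by (rule random_normed_module_L1t)

context prob_kernel
begin

lemma minus_L1t:
  assumes "F \<in> \<L>" "G \<in> \<L>"
  shows "cls F \<ominus>\<^bsub>L1t \<Omega> M \<mu>x\<^esub> cls G = cls (\<lambda>z. F z - G z)"
proof -
  have "(\<lambda>z. 0 - G z) \<in> \<L>" by (intro L1t_functions_diff L1t_functions_zero assms)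
  then have n: "(\<lambda>z. - G z) \<in> \<L>" by simp
  have "\<ominus>\<^bsub>L1t \<Omega> M \<mu>x\<^esub> cls G = cls (\<lambda>z. - G z)"
    using assms n by (intro L1t.mod.M.minus_equality) (auto simp: add_L1t zero_L1t intro: L1t_carrierI)
  then show ?thesis using assms n by (simp add: a_minus_def add_L1t)
qed

text \<open>The norm, as an element of \<open>L0 M\<close>, has an \<open>M\<close>-measurable
  representative, whereas \<open>norm1\<close> is known to be measurable only for the completion.
  Integrating over \<open>completion M\<close> lets one replace the other.\<close>

lemma rn_dist_L1t:
  assumes "F \<in> \<L>" "G \<in> \<L>"
  shows "rn_dist M (L1t \<Omega> M \<mu>x) (cls F) (cls G)
    = (\<integral>x. min (norm1 (\<lambda>z. F z - G z) x) 1 \<partial>completion M)"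
proof -
  note FG = L1t_functions_diff[OF assms]
  note m[measurable] = measurable_norm1[OF L1t_functions_measurable[OF FG]]
  note [measurable] = measurable_repr_L0_class[OF m]
  let ?h = "repr (L0_class M (norm1 (\<lambda>z. F z - G z)))"
  have "rn_dist M (L1t \<Omega> M \<mu>x) (cls F) (cls G) = (\<integral>x. min (?h x) 1 \<partial>M)"
    by (simp add: rn_dist_def minus_L1t assms lnorm_L1t FG)
  also have "\<dots> = (\<integral>x. min (?h x) 1 \<partial>completion M)"
    by (rule integral_completion[symmetric]) measurable
  also have "\<dots> = (\<integral>x. min (norm1 (\<lambda>z. F z - G z) x) 1 \<partial>completion M)"
    by (rule integral_cong_AE)
      (use AE_completion[OF AE_repr_L0_class[OF m]] in \<open>auto intro!: borel_measurable_min measurable_completion measurable_repr_L0_class m\<close>)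
  finally show ?thesis .
qed

text \<open>Truncation at 1 supplies an integrable bound on the base, so a.e. convergence of the
  fibre norms is enough.\<close>

lemma tendsto_L1t:
  assumes "\<And>n. F n \<in> \<L>" "G \<in> \<L>" "AE x in M. (\<lambda>n. norm1 (\<lambda>z. F n z - G z) x) \<longlonglongrightarrow> 0"
  shows "(\<lambda>n. rn_dist M (L1t \<Omega> M \<mu>x) (cls (F n)) (cls G)) \<longlonglongrightarrow> 0"
proof -
  interpret c: prob_space "completion M" by (rule prob_space_completion)
  note [measurable] = measurable_norm1[OF L1t_functions_measurable[OF L1t_functions_diff[OF assms(1,2)]]]
  have "(\<lambda>n. \<integral>x. min (norm1 (\<lambda>z. F n z - G z) x) 1 \<partial>completion M)
      \<longlonglongrightarrow> (\<integral>x. 0 \<partial>completion M)"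
  proof (rule integral_dominated_convergence[where w="\<lambda>_. 1"])
    show "AE x in completion M. (\<lambda>n. min (norm1 (\<lambda>z. F n z - G z) x) 1) \<longlonglongrightarrow> 0"
      using AE_completion[OF assms(3)]
    proof eventually_elim
      case (elim x)
      from tendsto_min[OF this tendsto_const[of 1]] show ?case by simp
    qed
  qed (auto simp: norm1_nonneg)
  then show ?thesis by (simp add: rn_dist_L1t assms)
qed

text \<open>Dominated convergence is used twice: in the fibre with bound
  \<open>H + \<bar>G\<bar>\<close>, then on the base with bound 1. The fibre integrals of
  \<open>H\<close> may be unbounded in \<open>x\<close>.\<close>

lemma tendsto_L1t_dominated:
  assumes F: "\<And>n. F n \<in> \<L>" and G: "G \<in> \<L>" and H: "H \<in> \<L>"
    and lim: "AE x in M. AE p in \<mu>x x. (\<lambda>n. F n (p, x)) \<longlonglongrightarrow> G (p, x)"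
    and bound: "AE x in M. AE p in \<mu>x x. \<forall>n. \<bar>F n (p, x)\<bar> \<le> H (p, x)"
  shows "(\<lambda>n. rn_dist M (L1t \<Omega> M \<mu>x) (cls (F n)) (cls G)) \<longlonglongrightarrow> 0"
proof (intro tendsto_L1t F G)
  show "AE x in M. (\<lambda>n. norm1 (\<lambda>z. F n z - G z) x) \<longlonglongrightarrow> 0"
    using lim bound L1t_functions_integrable[OF G] L1t_functions_integrable[OF H] AE_space
  proof eventually_elim
    case (elim x)
    note [measurable] = measurable_section[OF L1t_functions_measurable[OF F] elim(5)]
      measurable_section[OF L1t_functions_measurable[OF G] elim(5)]
    have "(\<lambda>n. \<integral>p. \<bar>F n (p, x) - G (p, x)\<bar> \<partial>\<mu>x x) \<longlonglongrightarrow> (\<integral>p. 0 \<partial>\<mu>x x)"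
    proof (rule integral_dominated_convergence[where w="\<lambda>p. H (p, x) + \<bar>G (p, x)\<bar>"])
      show "AE p in \<mu>x x. (\<lambda>n. \<bar>F n (p, x) - G (p, x)\<bar>) \<longlonglongrightarrow> 0"
        using elim(1) by eventually_elim (auto intro: tendsto_rabs_zero LIM_zero)
      show "AE p in \<mu>x x. norm \<bar>F n (p, x) - G (p, x)\<bar> \<le> H (p, x) + \<bar>G (p, x)\<bar>" for n
        using elim(2)
      proof eventually_elim
        case (elim p)
        then have "\<bar>F n (p, x)\<bar> \<le> H (p, x)" by blast
        then show ?case by simp
      qed
    qed (use elim(3,4) in auto)
    then show ?case by (simp add: norm1_def)
  qed
qed

text \<open>The Riesz-Fischer argument in two layers. Along rapidly chosen members the truncated
  norms of the increments have summable integrals, so for a.e. \<open>x\<close> the norms themselves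
  are summable. Then in almost every fibre the increments are absolutely summable a.e., which yields
  a pointwise limit together with a dominating function.\<close>

lemma L1t_complete:
  assumes C: "C \<in> rn_Cauchy M (L1t \<Omega> M \<mu>x)"
  shows "\<exists>w\<in>carrier (L1t \<Omega> M \<mu>x). (\<lambda>n. rn_dist M (L1t \<Omega> M \<mu>x) (C n) w) \<longlonglongrightarrow> 0"
proof -
  let ?d = "rn_dist M (L1t \<Omega> M \<mu>x)"
  have car: "C n \<in> carrier (L1t \<Omega> M \<mu>x)" for n using C by (auto simp: rn_Cauchy_def)
  then have "\<forall>n. \<exists>F\<in>\<L>. C n = cls F" by (meson L1t_carrierE)
  then obtain F where F: "\<And>n. F n \<in> \<L>" "\<And>n. C n = cls (F n)" by metis
  have "\<forall>k. \<exists>N. \<forall>m\<ge>N. \<forall>n\<ge>N. ?d (C m) (C n) < (1/2) ^ k"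
    using C by (auto simp: rn_Cauchy_def)
  then obtain N where N: "\<And>k m n. m \<ge> N k \<Longrightarrow> n \<ge> N k \<Longrightarrow> ?d (C m) (C n) < (1/2) ^ k" by metis
  \<comment> \<open>Summing the thresholds puts both \<open>r k\<close> and \<open>r (Suc k)\<close>
    beyond \<open>N k\<close>, so consecutive chosen members are within \<open>(1/2) ^ k\<close> of
    each other.\<close>
  define r where "r k = sum N {..k}" for k
  have r: "r k \<ge> N k" "r (Suc k) \<ge> N k" for k
  proof -
    show "r k \<ge> N k" unfolding r_def by (rule member_le_sum) auto
    then show "r (Suc k) \<ge> N k" by (simp add: r_def)
  qed
  define G where "G k = F (r k)" for k
  define h where "h k z = G (Suc k) z - G k z" for k z
  have G: "G k \<in> \<L>" for k by (simp add: G_def F)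
  have h: "h k \<in> \<L>" for k unfolding h_def using G by (intro L1t_functions_diff)
  have [measurable]: "G k \<in> borel_measurable (\<Omega> \<Otimes>\<^sub>M completion M)"
    "h k \<in> borel_measurable (\<Omega> \<Otimes>\<^sub>M completion M)" for k
    using G h by (auto intro: L1t_functions_measurable)
  have small: "(\<integral>x. min (norm1 (h k) x) 1 \<partial>completion M) < (1/2) ^ k" for k
    using N[OF r(2) r(1), of k] rn_dist_L1t[OF G[of "Suc k"] G[of k]]
    by (simp add: F(2) G_def h_def[abs_def])
  interpret c: prob_space "completion M" by (rule prob_space_completion)
  note [measurable] = measurable_norm1[OF L1t_functions_measurable[OF h]]
  have "AE x in completion M. summable (\<lambda>k. min (norm1 (h k) x) 1)"
  proof (rule AE_summable_if_summable_integral)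
    show "summable (\<lambda>k. \<integral>x. min (norm1 (h k) x) 1 \<partial>completion M)"
    proof (rule summable_comparison_test_ev)
      show "summable (\<lambda>k. (1/2::real) ^ k)" by simp
      show "\<forall>\<^sub>F k in sequentially. norm (\<integral>x. min (norm1 (h k) x) 1 \<partial>completion M) \<le> (1/2) ^ k"
        using small
        by (intro always_eventually allI) (simp add: c.integral_min_1_nonneg norm1_nonneg less_imp_le)
    qed
  qed (auto intro!: c.integrable_min_1 simp: norm1_nonneg)
  then have "AE x in M. summable (\<lambda>k. min (norm1 (h k) x) 1)"
    by (simp add: AE_completion_iff)
  then have summ: "AE x in M. summable (\<lambda>k. norm1 (h k) x)"
  proof eventually_elim
    case (elim x)
    \<comment> \<open>Terms of a convergent series tend to 0, so they are eventually below 1 and the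
      truncation is eventually inactive.\<close>
    from summable_LIMSEQ_zero[OF this]
    have "\<forall>\<^sub>F k in sequentially. min (norm1 (h k) x) 1 < 1"
      by (rule order_tendstoD) simp
    then have "\<forall>\<^sub>F k in sequentially. norm (norm1 (h k) x) \<le> min (norm1 (h k) x) 1"
      by eventually_elim (auto simp: norm1_nonneg)
    with elim show ?case by (rule summable_comparison_test_ev[rotated])
  qed
  \<comment> \<open>Both functions are total and take default values where the limit or the sum does
    not exist. In almost every fibre such points lie in a null set.\<close>
  define Fl where "Fl z = lim (\<lambda>k. G k z)" for z
  define H where "H z = \<bar>G 0 z\<bar> + (\<Sum>k. \<bar>h k z\<bar>)" for z
  have [measurable]: "Fl \<in> borel_measurable (\<Omega> \<Otimes>\<^sub>M completion M)"
    unfolding Fl_def[abs_def] by (rule borel_measurable_lim_metric) measurable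
  have [measurable]: "H \<in> borel_measurable (\<Omega> \<Otimes>\<^sub>M completion M)"
    unfolding H_def[abs_def] by measurable
  have "AE x in M. \<forall>k. integrable (\<mu>x x) (\<lambda>p. h k (p, x))"
    by (simp add: AE_all_countable L1t_functions_integrable h)
  with summ have good: "AE x in M. (\<forall>k. integrable (\<mu>x x) (\<lambda>p. h k (p, x))) \<and>
      summable (\<lambda>k. norm1 (h k) x) \<and> (AE p in \<mu>x x. summable (\<lambda>k. \<bar>h k (p, x)\<bar>))"
  proof eventually_elim
    case (elim x)
    then have "AE p in \<mu>x x. summable (\<lambda>k. \<bar>h k (p, x)\<bar>)"
      by (intro AE_summable_if_summable_integral) (auto simp: norm1_def)
    with elim show ?case by simp
  qed
  have pointwise: "(\<lambda>k. G k z) \<longlonglongrightarrow> Fl z \<and> (\<forall>k. \<bar>G k z\<bar> \<le> H z) \<and> \<bar>Fl z\<bar> \<le> H z"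
    if z: "summable (\<lambda>k. \<bar>h k z\<bar>)" for z
  proof -
    have tel: "G k z = G 0 z + (\<Sum>j<k. h j z)" for k
      unfolding h_def by (subst sum_lessThan_telescope) simp
    have "summable (\<lambda>k. h k z)" using z by (rule summable_rabs_cancel)
    then have "(\<lambda>k. G 0 z + (\<Sum>j<k. h j z)) \<longlonglongrightarrow> G 0 z + (\<Sum>j. h j z)"
      by (intro tendsto_add tendsto_const summable_LIMSEQ)
    then have "convergent (\<lambda>k. G k z)" unfolding tel[symmetric] by (rule convergentI)
    then have lim: "(\<lambda>k. G k z) \<longlonglongrightarrow> Fl z" unfolding Fl_def by (simp add: convergent_LIMSEQ_iff)
    have le: "\<bar>G k z\<bar> \<le> H z" for k
    proof -
      have "\<bar>G k z\<bar> \<le> \<bar>G 0 z\<bar> + \<bar>\<Sum>j<k. h j z\<bar>" unfolding tel[of k] by (rule abs_triangle_ineq)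
      also have "\<dots> \<le> \<bar>G 0 z\<bar> + (\<Sum>j<k. \<bar>h j z\<bar>)" by (intro add_left_mono sum_abs)
      also have "\<dots> \<le> H z" unfolding H_def using z by (intro add_left_mono sum_le_suminf) auto
      finally show ?thesis .
    qed
    then have "\<bar>Fl z\<bar> \<le> H z" by (intro LIMSEQ_le_const2[OF tendsto_rabs[OF lim]]) auto
    with lim le show ?thesis by simp
  qed
  have H_int: "AE x in M. integrable (\<mu>x x) (\<lambda>p. H (p, x))"
    using good L1t_functions_integrable[OF G[of 0]]
  proof eventually_elim
    case (elim x)
    have "integrable (\<mu>x x) (\<lambda>p. \<Sum>k. \<bar>h k (p, x)\<bar>)"
      using elim by (intro integrable_suminf) (auto simp: norm1_def)
    with elim(2) show ?case unfolding H_def by auto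
  qed
  have H: "H \<in> \<L>" unfolding L1t_functions_iff using H_int by simp
  have Fl: "Fl \<in> \<L>"
    unfolding L1t_functions_iff
  proof
    show "AE x in M. integrable (\<mu>x x) (\<lambda>p. Fl (p, x))"
      using good H_int AE_space
    proof eventually_elim
      case (elim x)
      have "AE p in \<mu>x x. norm (Fl (p, x)) \<le> norm (H (p, x))"
        using elim(1)[THEN conjunct2, THEN conjunct2]
      proof eventually_elim
        case (elim p)
        from pointwise[OF this] have "\<bar>Fl (p, x)\<bar> \<le> H (p, x)" by blast
        then show ?case using abs_ge_self[of "H (p, x)"] by simp
      qed
      then show ?case
        by (intro Bochner_Integration.integrable_bound[OF elim(2)] measurable_section elim) measurable
    qed
  qed measurable
  have "AE x in M. AE p in \<mu>x x. (\<lambda>k. G k (p, x)) \<longlonglongrightarrow> Fl (p, x) \<and> (\<forall>k. \<bar>G k (p, x)\<bar> \<le> H (p, x))"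
    using good
  proof eventually_elim
    case (elim x)
    from elim[THEN conjunct2, THEN conjunct2] show ?case
    proof eventually_elim
      case (elim p)
      from pointwise[OF this] show ?case by simp
    qed
  qed
  then have lim: "(\<lambda>k. ?d (cls (G k)) (cls Fl)) \<longlonglongrightarrow> 0"
    by (intro tendsto_L1t_dominated[OF G Fl H]) auto
  note FlC = L1t_carrierI[OF Fl]
  have "(\<lambda>n. ?d (C n) (cls Fl)) \<longlonglongrightarrow> 0"
  proof (rule LIMSEQ_I)
    fix \<epsilon> :: real assume \<epsilon>: "0 < \<epsilon>"
    have "\<forall>\<^sub>F k in sequentially. (1/2::real) ^ k < \<epsilon> / 2"
      using \<epsilon> by (intro order_tendstoD(2)[OF LIMSEQ_power_zero]) auto
    moreover have "\<forall>\<^sub>F k in sequentially. ?d (cls (G k)) (cls Fl) < \<epsilon> / 2"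
      using \<epsilon> by (intro order_tendstoD(2)[OF lim]) auto
    ultimately obtain k where k: "(1/2::real) ^ k < \<epsilon> / 2" "?d (cls (G k)) (cls Fl) < \<epsilon> / 2"
      using eventually_happens'[OF sequentially_bot eventually_conj] by blast
    \<comment> \<open>The comparison index \<open>r k\<close> lies beyond \<open>N k\<close>, so the
      Cauchy estimate controls the distance from \<open>C n\<close> to the chosen member, whose
      distance to the limit is already small.\<close>
    have "norm (?d (C n) (cls Fl) - 0) < \<epsilon>" if "n \<ge> N k" for n
      using L1t.rn_dist_triangle[OF car car FlC, of n "r k"] N[OF that r(1)[of k]] k
        L1t.rn_dist_nonneg[OF car FlC, of n]
      by (simp add: F(2) G_def)
    then show "\<exists>N. \<forall>n\<ge>N. norm (?d (C n) (cls Fl) - 0) < \<epsilon>" by blast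
  qed
  with FlC show ?thesis by blast
qed

section \<open>A monotone class principle for \<open>L1t\<close>\<close>

lemma L1t_functions_indicator: "E \<in> sets (\<Omega> \<Otimes>\<^sub>M completion M) \<Longrightarrow> indicator E \<in> \<L>"
  by (rule L1t_functions_bounded[where B=1]) (auto simp: indicator_def)

lemma L1t_functions_indicator_fst:
  assumes "A \<in> sets \<Omega>"
  shows "(\<lambda>(p, x). indicator A p) \<in> \<L>"
  by (rule L1t_functions_bounded[where B=1]) (use assms in \<open>auto simp: indicator_def case_prod_beta'\<close>)

text \<open>Cast as an induction rule so that approximability by simple maps and agreement of two
  isomorphisms are both instances. Differences need no case of their own, as \<open>-1\<close> is a
  scalar. The limit case is phrased in the module distance; fibrewise dominated convergence makes it
  available for pointwise limits.\<close>

lemma L1t_induct [consumes 1, case_names indicator add smult closed]: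
  assumes W: "W \<in> carrier (L1t \<Omega> M \<mu>x)"
    and indicator: "\<And>A. A \<in> sets \<Omega> \<Longrightarrow> P (cls (\<lambda>(p, x). indicator A p))"
    and add: "\<And>U V. U \<in> carrier (L1t \<Omega> M \<mu>x) \<Longrightarrow> V \<in> carrier (L1t \<Omega> M \<mu>x) \<Longrightarrow>
      P U \<Longrightarrow> P V \<Longrightarrow> P (U \<oplus>\<^bsub>L1t \<Omega> M \<mu>x\<^esub> V)"
    and smult: "\<And>f U. f \<in> carrier (L0 M) \<Longrightarrow> U \<in> carrier (L1t \<Omega> M \<mu>x) \<Longrightarrow>
      P U \<Longrightarrow> P (f \<odot>\<^bsub>L1t \<Omega> M \<mu>x\<^esub> U)"
    and closed: "\<And>u U. (\<And>n. u n \<in> carrier (L1t \<Omega> M \<mu>x)) \<Longrightarrow> (\<And>n. P (u n)) \<Longrightarrow>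
      U \<in> carrier (L1t \<Omega> M \<mu>x) \<Longrightarrow> (\<lambda>n. rn_dist M (L1t \<Omega> M \<mu>x) (u n) U) \<longlonglongrightarrow> 0 \<Longrightarrow> P U"
  shows "P W"
proof -
  have P_add: "P (cls (\<lambda>z. F z + G z))" if "F \<in> \<L>" "G \<in> \<L>" "P (cls F)" "P (cls G)" for F G
    using add[of "cls F" "cls G"] that by (simp add: add_L1t L1t_carrierI)
  have P_smult: "P (cls (\<lambda>(p, x). f x * F (p, x)))"
    if "F \<in> \<L>" "P (cls F)" "f \<in> borel_measurable (completion M)" for f F
    using smult[of "L0_class M f" "cls F"] that by (simp add: smult_L1t_class L1t_carrierI L0_carrierI)
  have P_cmult: "P (cls (\<lambda>z. c * F z))" if "F \<in> \<L>" "P (cls F)" for c F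
    using P_smult[OF that, of "\<lambda>_. c"] by (simp add: case_prod_beta')
  have L_cmult: "(\<lambda>z. c * F z) \<in> \<L>" if "F \<in> \<L>" for c F
    using L1t_functions_smult[OF _ that, of "\<lambda>_. c"] by (simp add: case_prod_beta')
  have P_lim: "P (cls G)"
    if "\<And>n. F n \<in> \<L>" "\<And>n. P (cls (F n))" "G \<in> \<L>" "H \<in> \<L>"
      "\<And>p x. p \<in> space \<Omega> \<Longrightarrow> x \<in> space M \<Longrightarrow> (\<lambda>n. F n (p, x)) \<longlonglongrightarrow> G (p, x)"
      "\<And>n p x. p \<in> space \<Omega> \<Longrightarrow> x \<in> space M \<Longrightarrow> \<bar>F n (p, x)\<bar> \<le> H (p, x)" for F G H
    using that
    by (intro closed[of "\<lambda>n. cls (F n)" "cls G"] tendsto_L1t_dominated[of F G H])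
      (auto intro!: AE_I2 L1t_carrierI simp: space_kernel)
  have P_ind: "P (cls (indicator E))" if "E \<in> sets (\<Omega> \<Otimes>\<^sub>M completion M)" for E
  proof -
    let ?G = "{a \<times> b | a b. a \<in> sets \<Omega> \<and> b \<in> sets (completion M)}"
    have rect: "P (cls (indicator (a \<times> b)))" if "a \<in> sets \<Omega>" "b \<in> sets (completion M)" for a b
    proof -
      have "indicator (a \<times> b) = (\<lambda>(p, x). indicator b x * (\<lambda>(p, x). indicator a p) (p, x) :: real)"
        by (auto simp: indicator_def fun_eq_iff)
      then show ?thesis
        using P_smult[OF L1t_functions_indicator_fst[OF that(1)] indicator[OF that(1)],
            of "indicator b"] that by simp
    qed
    have P_empty: "P (cls (indicator {}))"
      using rect[OF sets.empty_sets sets.empty_sets] by (simp only: Sigma_empty1)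
    have sets_eq: "sigma_sets (space \<Omega> \<times> space (completion M)) ?G
        = sets (\<Omega> \<Otimes>\<^sub>M completion M)"
      by (simp add: sets_pair_measure)
    have "Int_stable ?G" by (rule Int_stable_pair_measure_generator)
    moreover have "?G \<subseteq> Pow (space \<Omega> \<times> space (completion M))" by (rule pair_measure_closed)
    moreover have "E \<in> sigma_sets (space \<Omega> \<times> space (completion M)) ?G"
      using that by (simp add: sets_pair_measure)
    ultimately show ?thesis
    proof (induction rule: sigma_sets_induct_disjoint[consumes 3, case_names basic empty compl union])
      case (basic E)
      then show ?case using rect by auto
    next
      case empty
      show ?case by (rule P_empty)
    next
      case (compl E)
      let ?S = "space \<Omega> \<times> space (completion M)"
      have E: "E \<in> sets (\<Omega> \<Otimes>\<^sub>M completion M)" using compl.hyps sets_eq by simp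
      \<comment> \<open>The complement is the whole rectangle plus the multiple of \<open>E\<close>
        by the scalar \<open>-1\<close>; the two functions agree on the product space, which is all
        that a class sees.\<close>
      have "cls (indicator (?S - E)) = cls (\<lambda>z. indicator ?S z + (- 1) * indicator E z)"
        by (rule L1t_class_cong_space) (auto simp: indicator_def)
      also have "P \<dots>"
        using compl.IH rect[of "space \<Omega>" "space (completion M)"] E
        by (intro P_add P_cmult L_cmult L1t_functions_indicator) auto
      finally show ?case .
    next
      case (union A)
      have A: "A i \<in> sets (\<Omega> \<Otimes>\<^sub>M completion M)" for i
        using union.hyps sets_eq by auto
      \<comment> \<open>Finite unions come from additivity, by disjointness; the countable union is
        then a pointwise limit dominated by the constant 1.\<close>
      have "P (cls (indicator (\<Union>i<n. A i)))" for n
      proof (induction n)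
        case 0
        show ?case using P_empty by (simp only: lessThan_0 UN_empty)
      next
        case (Suc n)
        have "A n \<inter> A i = {}" if "i < n" for i
          using union.hyps that by (simp add: disjoint_family_on_def)
        then have "A n \<inter> (\<Union>i<n. A i) = {}" by auto
        then have eq: "indicator (\<Union>i<Suc n. A i) = (\<lambda>z. indicator (A n) z + indicator (\<Union>i<n. A i) z :: real)"
          by (auto simp: fun_eq_iff indicator_def lessThan_Suc)
        show ?case
          unfolding eq by (intro P_add L1t_functions_indicator Suc.IH union.IH) (use A in auto)
      qed
      then have P_UN: "P (cls (indicator (\<Union>i<n. A i)))" for n .
      show ?case
      proof (rule P_lim[of "\<lambda>n. indicator (\<Union>i<n. A i)" _ "\<lambda>_. 1"])
        show "(\<lambda>_. 1) \<in> \<L>" by (rule L1t_functions_bounded[where B=1]) auto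
        show "(\<lambda>n. indicator (\<Union>i<n. A i) (p, x)) \<longlonglongrightarrow> indicator (\<Union>i. A i) (p, x)" for p x
          by (rule LIMSEQ_indicator_UN)
        show "indicator (\<Union>i. A i) \<in> \<L>" "indicator (\<Union>i<n. A i) \<in> \<L>" for n
          using A by (intro L1t_functions_indicator; blast)+
      qed (use P_UN in \<open>auto simp: indicator_def\<close>)
    qed
  qed
  \<comment> \<open>Integrability sits inside the induction predicate because the functions from
    which \<open>F\<close> is built have to inherit it from the composite function.\<close>
  have P_pos: "F \<in> \<L> \<longrightarrow> P (cls F)"
    if "F \<in> borel_measurable (\<Omega> \<Otimes>\<^sub>M completion M)" "\<And>z. 0 \<le> F z" for F
    using that
  proof (induction rule: borel_measurable_induct_real)
    case (set A)
    then show ?case using P_ind by simp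
  next
    case (mult u c)
    show ?case
    \<comment> \<open>For \<open>c = 0\<close> the product is integrable whatever \<open>u\<close>
      is, so nothing can be inferred about \<open>u\<close>; the class is then that of the indicator
      of the empty set.\<close>
    proof (cases "c = 0")
      case True
      have "cls (indicator {}) = cls (\<lambda>z. c * u z)"
        using True by (intro L1t_class_cong_space) simp
      then show ?thesis using P_ind[OF sets.empty_sets] by (simp only: simp_thms)
    next
      case False
      show ?thesis
      proof
        assume "(\<lambda>z. c * u z) \<in> \<L>"
        from L_cmult[OF this, of "1 / c"] False have "u \<in> \<L>" by simp
        with mult.IH show "P (cls (\<lambda>z. c * u z))" by (intro P_cmult) auto
      qed
    qed
  next
    case (add u v)
    show ?case
    proof
      assume uv: "(\<lambda>z. v z + u z) \<in> \<L>"
      \<comment> \<open>Both summands are nonnegative, hence dominated by their sum.\<close>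
      have "u \<in> \<L>" "v \<in> \<L>"
        using add.hyps by (auto intro: L1t_functions_dominated[OF _ uv])
      with add.IH show "P (cls (\<lambda>z. v z + u z))" by (intro P_add) auto
    qed
  next
    case (seq U)
    show ?case
    proof
      assume F: "F \<in> \<L>"
      have le: "U n (p, x) \<le> F (p, x)" if "p \<in> space \<Omega>" "x \<in> space M" for n p x
        using that seq.hyps(3,4)
        by (intro incseq_le) (auto simp: space_pair_measure incseq_def le_fun_def)
      \<comment> \<open>The members of the increasing sequence lie between 0 and \<open>F\<close>,
        so \<open>F\<close> is both their limit and their dominating function.\<close>
      have "U n \<in> \<L>" for n
        using seq.hyps le by (intro L1t_functions_dominated[OF _ F]) auto
      then show "P (cls F)"
        using seq.IH seq.hyps le F by (auto intro: P_lim[of U F F] simp: space_pair_measure)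
    qed
  qed
  obtain F where F: "F \<in> \<L>" "W = cls F" using W by (rule L1t_carrierE)
  note [measurable] = L1t_functions_measurable[OF F(1)]
  have abs: "(\<lambda>z. \<bar>F z\<bar>) \<in> \<L>"
    using F(1) unfolding L1t_functions_iff by (auto elim: AE_mp)
  have pos: "(\<lambda>z. max (F z) 0) \<in> \<L>" "(\<lambda>z. max (- F z) 0) \<in> \<L>"
    by (rule L1t_functions_dominated[OF _ abs]; simp)+
  have "P (cls (\<lambda>z. max (F z) 0 + (- 1) * max (- F z) 0))"
    using pos P_pos[of "\<lambda>z. max (F z) 0"] P_pos[of "\<lambda>z. max (- F z) 0"]
    by (intro P_add P_cmult L_cmult) auto
  moreover have "(\<lambda>z. max (F z) 0 + (- 1) * max (- F z) 0) = F"
    by (auto simp: fun_eq_iff max_def)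
  ultimately show ?thesis using F(2) by simp
qed

end

section \<open>Simple maps as functions of two variables\<close>

locale foliated_L0_measure = prob_kernel M \<Omega> \<mu>x
  for M :: "'x measure" and \<Omega> :: "'w measure" and \<mu>x :: "'x \<Rightarrow> 'w measure" +
  fixes \<mu> :: "'w set \<Rightarrow> ('x \<Rightarrow> real) set"
  assumes \<mu>_eq: "A \<in> sets \<Omega> \<Longrightarrow> \<mu> A = L0_class M (\<lambda>x. measure (\<mu>x x) A)"
begin

definition uncurried :: "('w \<Rightarrow> ('x \<Rightarrow> real) set) \<Rightarrow> 'w \<times> 'x \<Rightarrow> real"
  where "uncurried f = (\<lambda>(p, x). repr (f p) x)"

text \<open>Measurability into a countable discrete space replaces a partition: rules for composing
  measurable functions apply directly, and a countable set of values is at hand for uniting null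
  sets. The link with partitions is \<open>countably_valued_iff\<close>.\<close>

definition countably_valued :: "('w \<Rightarrow> ('x \<Rightarrow> real) set) \<Rightarrow> bool"
  where "countably_valued f \<longleftrightarrow>
    (\<exists>R. countable R \<and> R \<subseteq> carrier (L0 M) \<and> f \<in> \<Omega> \<rightarrow>\<^sub>M count_space R)"

lemma space_\<Omega>_nonempty: "space \<Omega> \<noteq> {}"
proof -
  obtain x where x: "x \<in> space M" using not_empty by blast
  then interpret K: prob_space "\<mu>x x" by (rule prob_space_kernel)
  show ?thesis using K.not_empty space_kernel[OF x] by simp
qed

lemma \<mu>_closed: "A \<in> sets \<Omega> \<Longrightarrow> \<mu> A \<in> carrier (L0 M)"
  by (simp add: \<mu>_eq L0_carrierI measurable_measure_kernel)

lemma AE_repr_\<mu>: "A \<in> sets \<Omega> \<Longrightarrow> AE x in M. repr (\<mu> A) x = measure (\<mu>x x) A"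
  by (simp add: \<mu>_eq AE_repr_L0_class measurable_measure_kernel)

text \<open>An element of \<open>L0 M\<close> vanishes iff its representatives vanish a.e., and a
  fibre measure vanishes on \<open>N\<close> iff fibre-almost every point avoids \<open>N\<close>.
  This matches the null sets behind \<open>S1_class\<close> with those behind
  \<open>L1t_class\<close>.\<close>

lemma \<mu>_eq_zero_iff:
  assumes "N \<in> sets \<Omega>"
  shows "\<mu> N = \<zero>\<^bsub>L0 M\<^esub> \<longleftrightarrow> (AE x in M. AE p in \<mu>x x. p \<notin> N)"
proof -
  have "\<mu> N = \<zero>\<^bsub>L0 M\<^esub> \<longleftrightarrow> (AE x in M. measure (\<mu>x x) N = 0)"
    using L0_class_eq_iff[OF measurable_measure_kernel[OF assms], of "\<lambda>_. 0"]
    by (simp add: \<mu>_eq[OF assms] L0_def)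
  also have "\<dots> \<longleftrightarrow> (AE x in M. AE p in \<mu>x x. p \<notin> N)"
  proof (rule AE_cong)
    fix x assume x: "x \<in> space M"
    interpret K: prob_space "\<mu>x x" using x by (rule prob_space_kernel)
    have "N \<in> sets (\<mu>x x)" using assms sets_kernel[OF x] by simp
    then show "measure (\<mu>x x) N = 0 \<longleftrightarrow> (AE p in \<mu>x x. p \<notin> N)"
      using AE_iff_measurable[of N "\<mu>x x" "\<lambda>p. p \<notin> N"] sets.sets_into_space[of N "\<mu>x x"]
      by (auto simp: K.emeasure_eq_measure)
  qed
  finally show ?thesis .
qed

text \<open>Representatives of different values are chosen independently, so joint measurability is
  not automatic. For each fixed value the function depends on \<open>x\<close> alone, measurably,
  and countably many such pieces are glued along a measurable map.\<close>

lemma measurable_uncurried: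
  assumes "countably_valued f"
  shows "uncurried f \<in> borel_measurable (\<Omega> \<Otimes>\<^sub>M completion M)"
proof -
  obtain R where R: "countable R" "R \<subseteq> carrier (L0 M)" and [measurable]: "f \<in> \<Omega> \<rightarrow>\<^sub>M count_space R"
    using assms by (auto simp: countably_valued_def)
  have "(\<lambda>z. repr (f (fst z)) (snd z)) \<in> borel_measurable (\<Omega> \<Otimes>\<^sub>M completion M)"
  proof (rule measurable_compose_countable'[OF _ _ R(1)])
    fix r assume "r \<in> R"
    then have [measurable]: "repr r \<in> borel_measurable (completion M)"
      using R(2) by (intro measurable_repr_L0_completion) auto
    show "(\<lambda>z. repr r (snd z)) \<in> borel_measurable (\<Omega> \<Otimes>\<^sub>M completion M)" by measurable
  qed measurable
  then show ?thesis by (simp add: uncurried_def case_prod_beta')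
qed

text \<open>The values of the combination lie in the image of the countable set
  \<open>R \<times> S\<close>, so no common refinement of two partitions has to be formed.\<close>

lemma countably_valued_comp2:
  assumes f: "countably_valued f" and g: "countably_valued g"
    and h: "\<And>r s. r \<in> carrier (L0 M) \<Longrightarrow> s \<in> carrier (L0 M) \<Longrightarrow> h r s \<in> carrier (L0 M)"
  shows "countably_valued (\<lambda>p. h (f p) (g p))"
proof -
  obtain R where R: "countable R" "R \<subseteq> carrier (L0 M)" "f \<in> \<Omega> \<rightarrow>\<^sub>M count_space R"
    using f by (auto simp: countably_valued_def)
  obtain S where S: "countable S" "S \<subseteq> carrier (L0 M)" "g \<in> \<Omega> \<rightarrow>\<^sub>M count_space S"
    using g by (auto simp: countably_valued_def)
  let ?Q = "(\<lambda>(r, s). h r s) ` (R \<times> S)"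
  have "(\<lambda>p. h (f p) (g p)) \<in> \<Omega> \<rightarrow>\<^sub>M count_space ?Q"
    by (rule measurable_compose_countable'[where f="\<lambda>r p. h r (g p)", OF _ R(3,1)],
        rule measurable_compose_countable'[where f="\<lambda>s p. h _ s", OF _ S(3,1)])
      (rule measurable_const, force)
  moreover have "countable ?Q" using R(1) S(1) by (intro countable_image countable_SIGMA)
  moreover have "?Q \<subseteq> carrier (L0 M)"
  proof clarify
    fix r s assume "r \<in> R" "s \<in> S"
    then have "r \<in> carrier (L0 M)" "s \<in> carrier (L0 M)" using R(2) S(2) by blast+
    then show "h r s \<in> carrier (L0 M)" by (rule h)
  qed
  ultimately show ?thesis unfolding countably_valued_def by blast
qed

lemma countably_valued_const: "c \<in> carrier (L0 M) \<Longrightarrow> countably_valued (\<lambda>_. c)"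
  unfolding countably_valued_def by (intro exI[of _ "{c}"]) auto

text \<open>A property of elements of \<open>L0 M\<close> may fail on a null set that depends on the
  element. Only countably many elements occur as values, so one null set serves all points of
  \<open>\<Omega>\<close>.\<close>

lemma AE_all_values:
  assumes "countably_valued f" and "\<And>r. r \<in> carrier (L0 M) \<Longrightarrow> AE x in M. Q x r"
  shows "AE x in M. \<forall>p\<in>space \<Omega>. Q x (f p)"
proof -
  obtain R where R: "countable R" "R \<subseteq> carrier (L0 M)" "f \<in> \<Omega> \<rightarrow>\<^sub>M count_space R"
    using assms(1) by (auto simp: countably_valued_def)
  then have ae: "AE x in M. \<forall>r\<in>R. Q x r"
    using assms(2) by (subst AE_ball_countable) blast+
  have "f p \<in> R" if "p \<in> space \<Omega>" for p using measurable_space[OF R(3) that] by simp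
  with ae show ?thesis by (auto elim: eventually_mono)
qed

lemma AE_all_values2:
  assumes f: "countably_valued f" and g: "countably_valued g"
    and Q: "\<And>r s. r \<in> carrier (L0 M) \<Longrightarrow> s \<in> carrier (L0 M) \<Longrightarrow> AE x in M. Q x r s"
  shows "AE x in M. \<forall>p\<in>space \<Omega>. Q x (f p) (g p)"
proof -
  obtain R where R: "countable R" "R \<subseteq> carrier (L0 M)" "f \<in> \<Omega> \<rightarrow>\<^sub>M count_space R"
    using f by (auto simp: countably_valued_def)
  have ae: "AE x in M. \<forall>r\<in>R. \<forall>p\<in>space \<Omega>. Q x r (g p)"
    unfolding AE_ball_countable[OF R(1)]
  proof
    fix r assume "r \<in> R"
    then have "r \<in> carrier (L0 M)" using R(2) by blast
    then show "AE x in M. \<forall>p\<in>space \<Omega>. Q x r (g p)"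
      using Q by (intro AE_all_values[OF g, where Q="\<lambda>x. Q x r"])
  qed
  have "f p \<in> R" if "p \<in> space \<Omega>" for p using measurable_space[OF R(3) that] by simp
  with ae show ?thesis by (auto elim: eventually_mono)
qed

text \<open>Fibrewise a.e. equality carries integrability over but not joint measurability, which is
  therefore a premise. This recognises sums and multiples of simple maps as simple maps.\<close>

lemma L1t_functions_cong:
  assumes F: "F \<in> borel_measurable (\<Omega> \<Otimes>\<^sub>M completion M)" and G: "G \<in> \<L>"
    and eq: "AE x in M. AE p in \<mu>x x. F (p, x) = G (p, x)"
  shows "F \<in> \<L>"
  unfolding L1t_functions_iff
proof (intro conjI F)
  show "AE x in M. integrable (\<mu>x x) (\<lambda>p. F (p, x))"
    using eq L1t_functions_integrable[OF G] AE_space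
  proof eventually_elim
    case (elim x)
    then show ?case
      using integrable_cong_AE[OF measurable_section[OF F elim(3)]
          measurable_section[OF L1t_functions_measurable[OF G] elim(3)]] by blast
  qed
qed

lemma AE_kernel_if_space:
  assumes "AE x in M. \<forall>p\<in>space \<Omega>. Q p x"
  shows "AE x in M. AE p in \<mu>x x. Q p x"
  using assms AE_space by eventually_elim (auto intro!: AE_I2 simp: space_kernel)

text \<open>\<open>simple_repr\<close> without its summability condition, which is matched below
  with integrability of the uncurried map.\<close>

definition partition_repr ::
    "(nat \<Rightarrow> 'w set) \<Rightarrow> (nat \<Rightarrow> ('x \<Rightarrow> real) set) \<Rightarrow> ('w \<Rightarrow> ('x \<Rightarrow> real) set) \<Rightarrow> bool"
  where "partition_repr A c f \<longleftrightarrow>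
    range A \<subseteq> sets \<Omega> \<and> disjoint_family A \<and> (\<Union>i. A i) = space \<Omega> \<and>
    range c \<subseteq> carrier (L0 M) \<and> (\<forall>i. \<forall>p\<in>A i. f p = c i)"

lemma simple_repr_iff: "simple_repr \<Omega> M \<mu> A c f \<longleftrightarrow>
    partition_repr A c f \<and> L0_summable M (\<lambda>i. \<mu> (A i) \<otimes>\<^bsub>L0 M\<^esub> L0_abs M (c i))"
  by (auto simp: simple_repr_def partition_repr_def)

lemma countably_valued_iff: "countably_valued f \<longleftrightarrow> (\<exists>A c. partition_repr A c f)"
proof
  assume "countably_valued f"
  then obtain R where R: "countable R" "R \<subseteq> carrier (L0 M)" "f \<in> \<Omega> \<rightarrow>\<^sub>M count_space R"
    by (auto simp: countably_valued_def)
  have fR: "f p \<in> R" if "p \<in> space \<Omega>" for p using measurable_space[OF R(3) that] by simp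
  then have ne: "R \<noteq> {}" using space_\<Omega>_nonempty by blast
  \<comment> \<open>Cells are the fibres of an enumeration of \<open>R\<close>. An index that
    numbers no value gives an empty cell, on which \<open>from_nat_into\<close> supplies some
    element of \<open>R\<close>; hence \<open>R\<close> has to be nonempty.\<close>
  define A where "A i = {p \<in> space \<Omega>. to_nat_on R (f p) = i}" for i
  have "A i \<in> sets \<Omega>" for i
  proof -
    have "A i = f -` {r \<in> R. to_nat_on R r = i} \<inter> space \<Omega>"
      using fR by (auto simp: A_def)
    also have "\<dots> \<in> sets \<Omega>" by (rule measurable_sets[OF R(3)]) auto
    finally show ?thesis .
  qed
  moreover have "disjoint_family A" "(\<Union>i. A i) = space \<Omega>"
    unfolding A_def disjoint_family_on_def by auto
  moreover have "f p = from_nat_into R i" if "p \<in> A i" for i p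
    using that R(1) fR by (auto simp: A_def)
  ultimately have "partition_repr A (from_nat_into R) f"
    using from_nat_into[OF ne] R(2) unfolding partition_repr_def by blast
  then show "\<exists>A c. partition_repr A c f" by blast
next
  assume "\<exists>A c. partition_repr A c f"
  then obtain A c where *: "partition_repr A c f" by blast
  have "f \<in> \<Omega> \<rightarrow>\<^sub>M count_space (range c)"
  proof -
    have sp: "space \<Omega> = (\<Union>i. A i)" and fc: "\<And>i p. p \<in> A i \<Longrightarrow> f p = c i"
      and A: "\<And>i. A i \<in> sets \<Omega>"
      using * by (auto simp: partition_repr_def)
    have "f -` {a} \<inter> space \<Omega> = (\<Union>i\<in>{i. c i = a}. A i)" for a
    proof (intro equalityI subsetI)
      fix p assume p: "p \<in> f -` {a} \<inter> space \<Omega>"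
      then obtain i where i: "p \<in> A i" using sp by blast
      with p fc[OF i] show "p \<in> (\<Union>i\<in>{i. c i = a}. A i)" by auto
    next
      fix p assume "p \<in> (\<Union>i\<in>{i. c i = a}. A i)"
      then obtain i where i: "p \<in> A i" "c i = a" by blast
      with fc[OF i(1)] sp show "p \<in> f -` {a} \<inter> space \<Omega>" by blast
    qed
    then have "f -` {a} \<inter> space \<Omega> \<in> sets \<Omega>" for a
      using A by (simp add: sets.countable_UN')
    moreover have "f \<in> space \<Omega> \<rightarrow> range c"
    proof
      fix p assume "p \<in> space \<Omega>"
      then obtain i where i: "p \<in> A i" using sp by blast
      show "f p \<in> range c" unfolding fc[OF i] by simp
    qed
    ultimately show ?thesis by (subst measurable_count_space_eq_countable) simp_all
  qed
  with * show "countably_valued f"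
    unfolding countably_valued_def partition_repr_def by (intro exI[of _ "range c"]) auto
qed

text \<open>At each point only the cell containing it contributes. In the extended nonnegative reals
  sum and integral commute unconditionally, so this one identity yields both the criterion for
  integrability and the value of the integral.\<close>

lemma nn_integral_uncurried:
  assumes f: "partition_repr A c f" and x: "x \<in> space M"
  shows "(\<integral>\<^sup>+p. ennreal \<bar>uncurried f (p, x)\<bar> \<partial>\<mu>x x)
    = (\<Sum>i. ennreal (measure (\<mu>x x) (A i) * \<bar>repr (c i) x\<bar>))"
proof -
  interpret K: prob_space "\<mu>x x" using x by (rule prob_space_kernel)
  have A[measurable]: "A i \<in> sets (\<mu>x x)" for i
    using f sets_kernel[OF x] by (auto simp: partition_repr_def)
  have "(\<integral>\<^sup>+p. ennreal \<bar>uncurried f (p, x)\<bar> \<partial>\<mu>x x)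
      = (\<integral>\<^sup>+p. (\<Sum>i. ennreal \<bar>repr (c i) x\<bar> * indicator (A i) p) \<partial>\<mu>x x)"
  proof (rule nn_integral_cong)
    fix p assume "p \<in> space (\<mu>x x)"
    then have "p \<in> (\<Union>i. A i)" using f space_kernel[OF x] by (simp add: partition_repr_def)
    then obtain i where i: "p \<in> A i" by blast
    have "(\<Sum>i. ennreal \<bar>repr (c i) x\<bar> * indicator (A i) p) = ennreal \<bar>repr (c i) x\<bar>"
      using f i by (intro suminf_cmult_indicator) (auto simp: partition_repr_def)
    then show "ennreal \<bar>uncurried f (p, x)\<bar> = (\<Sum>i. ennreal \<bar>repr (c i) x\<bar> * indicator (A i) p)"
      using f i by (simp add: partition_repr_def uncurried_def)
  qed
  also have "\<dots> = (\<Sum>i. \<integral>\<^sup>+p. ennreal \<bar>repr (c i) x\<bar> * indicator (A i) p \<partial>\<mu>x x)"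
    by (rule nn_integral_suminf) measurable
  also have "\<dots> = (\<Sum>i. ennreal (measure (\<mu>x x) (A i) * \<bar>repr (c i) x\<bar>))"
    by (intro suminf_cong, subst nn_integral_cmult_indicator)
      (auto simp: K.emeasure_eq_measure ennreal_mult mult.commute)
  finally show ?thesis .
qed

lemma
  assumes f: "partition_repr A c f" and x: "x \<in> space M"
  shows integrable_uncurried_iff: "integrable (\<mu>x x) (\<lambda>p. uncurried f (p, x))
      \<longleftrightarrow> summable (\<lambda>i. measure (\<mu>x x) (A i) * \<bar>repr (c i) x\<bar>)"
    and norm1_uncurried: "summable (\<lambda>i. measure (\<mu>x x) (A i) * \<bar>repr (c i) x\<bar>) \<Longrightarrow>
      norm1 (uncurried f) x = (\<Sum>i. measure (\<mu>x x) (A i) * \<bar>repr (c i) x\<bar>)"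
proof -
  have m: "(\<lambda>p. uncurried f (p, x)) \<in> borel_measurable (\<mu>x x)"
    using f x by (intro measurable_section measurable_uncurried) (auto simp: countably_valued_iff)
  note nn = nn_integral_uncurried[OF f x]
  have fin: "(\<Sum>i. ennreal (measure (\<mu>x x) (A i) * \<bar>repr (c i) x\<bar>))
      = ennreal (\<Sum>i. measure (\<mu>x x) (A i) * \<bar>repr (c i) x\<bar>)"
    if "summable (\<lambda>i. measure (\<mu>x x) (A i) * \<bar>repr (c i) x\<bar>)"
    using that by (intro suminf_ennreal2) auto
  show "integrable (\<mu>x x) (\<lambda>p. uncurried f (p, x))
      \<longleftrightarrow> summable (\<lambda>i. measure (\<mu>x x) (A i) * \<bar>repr (c i) x\<bar>)"
  proof
    assume "integrable (\<mu>x x) (\<lambda>p. uncurried f (p, x))"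
    then have "(\<Sum>i. ennreal (measure (\<mu>x x) (A i) * \<bar>repr (c i) x\<bar>)) < \<infinity>"
      using nn by (simp add: integrable_iff_bounded)
    then show "summable (\<lambda>i. measure (\<mu>x x) (A i) * \<bar>repr (c i) x\<bar>)"
      by (intro summable_suminf_not_top) (auto simp: less_top)
  next
    assume s: "summable (\<lambda>i. measure (\<mu>x x) (A i) * \<bar>repr (c i) x\<bar>)"
    have "(\<integral>\<^sup>+p. ennreal \<bar>uncurried f (p, x)\<bar> \<partial>\<mu>x x) < \<infinity>"
      unfolding nn fin[OF s] by simp
    with m show "integrable (\<mu>x x) (\<lambda>p. uncurried f (p, x))"
      by (simp add: integrable_iff_bounded)
  qed
  assume s: "summable (\<lambda>i. measure (\<mu>x x) (A i) * \<bar>repr (c i) x\<bar>)"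
  have "norm1 (uncurried f) x = enn2real (\<integral>\<^sup>+p. ennreal \<bar>uncurried f (p, x)\<bar> \<partial>\<mu>x x)"
    unfolding norm1_def using m by (intro integral_eq_nn_integral) auto
  also have "\<dots> = (\<Sum>i. measure (\<mu>x x) (A i) * \<bar>repr (c i) x\<bar>)"
    unfolding nn fin[OF s] using s by (intro enn2real_ennreal suminf_nonneg) auto
  finally show "norm1 (uncurried f) x = (\<Sum>i. measure (\<mu>x x) (A i) * \<bar>repr (c i) x\<bar>)" .
qed

text \<open>For a.e. \<open>x\<close>, simultaneously for all \<open>i\<close>, the
  \<open>i\<close>-th term is represented by
  \<open>measure (\<mu>x x) (A i) * \<bar>repr (c i) x\<bar>\<close>. Order summability is thus
  summability in almost every fibre, which is integrability of the section. The right-hand sides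
  mention only \<open>f\<close>, so nothing depends on the chosen partition.\<close>

lemma
  assumes f: "partition_repr A c f"
  shows L0_summable_partition_iff:
      "L0_summable M (\<lambda>i. \<mu> (A i) \<otimes>\<^bsub>L0 M\<^esub> L0_abs M (c i)) \<longleftrightarrow> uncurried f \<in> \<L>"
    and L0_suminf_partition: "uncurried f \<in> \<L> \<Longrightarrow>
      L0_suminf M (\<lambda>i. \<mu> (A i) \<otimes>\<^bsub>L0 M\<^esub> L0_abs M (c i)) = L0_class M (norm1 (uncurried f))"
proof -
  let ?F = "\<lambda>i. \<mu> (A i) \<otimes>\<^bsub>L0 M\<^esub> L0_abs M (c i)"
  have A: "A i \<in> sets \<Omega>" and c: "c i \<in> carrier (L0 M)" for i
    using f by (auto simp: partition_repr_def)
  have eq: "AE x in M. repr (?F i) x = measure (\<mu>x x) (A i) * \<bar>repr (c i) x\<bar>" for i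
    using AE_repr_L0_mult[OF \<mu>_closed[OF A] L0_abs_closed[OF c], of i i] AE_repr_\<mu>[OF A, of i]
      AE_repr_L0_abs[OF c, of i]
    by eventually_elim simp
  then have eqs: "AE x in M. \<forall>i. repr (?F i) x = measure (\<mu>x x) (A i) * \<bar>repr (c i) x\<bar>"
    by (simp add: AE_all_countable)
  have pos: "?F \<in> UNIV \<rightarrow> L0_pos M"
  proof
    fix i
    have "AE x in M. 0 \<le> repr (?F i) x" using eq[of i] by eventually_elim simp
    then show "?F i \<in> L0_pos M"
      by (simp add: L0_pos_iff L0_mult_closed \<mu>_closed[OF A] L0_abs_closed[OF c])
  qed
  have "uncurried f \<in> borel_measurable (\<Omega> \<Otimes>\<^sub>M completion M)"
    using f by (intro measurable_uncurried) (auto simp: countably_valued_iff)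
  then have "uncurried f \<in> \<L> \<longleftrightarrow> (AE x in M. integrable (\<mu>x x) (\<lambda>p. uncurried f (p, x)))"
    by (simp add: L1t_functions_iff)
  also have "\<dots> \<longleftrightarrow> (AE x in M. summable (\<lambda>i. measure (\<mu>x x) (A i) * \<bar>repr (c i) x\<bar>))"
    by (intro AE_cong integrable_uncurried_iff f)
  finally have iff: "uncurried f \<in> \<L>
    \<longleftrightarrow> (AE x in M. summable (\<lambda>i. measure (\<mu>x x) (A i) * \<bar>repr (c i) x\<bar>))" .
  have "(AE x in M. summable (\<lambda>i. repr (?F i) x))
      \<longleftrightarrow> (AE x in M. summable (\<lambda>i. measure (\<mu>x x) (A i) * \<bar>repr (c i) x\<bar>))"
  proof
    assume "AE x in M. summable (\<lambda>i. repr (?F i) x)"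
    with eqs show "AE x in M. summable (\<lambda>i. measure (\<mu>x x) (A i) * \<bar>repr (c i) x\<bar>)"
      by eventually_elim simp
  next
    assume "AE x in M. summable (\<lambda>i. measure (\<mu>x x) (A i) * \<bar>repr (c i) x\<bar>)"
    with eqs show "AE x in M. summable (\<lambda>i. repr (?F i) x)"
      by eventually_elim simp
  qed
  with iff show summ: "L0_summable M ?F \<longleftrightarrow> uncurried f \<in> \<L>"
    by (simp add: L0_summable_iff[OF pos])
  assume L: "uncurried f \<in> \<L>"
  have "AE x in M. (\<Sum>i. repr (?F i) x) = norm1 (uncurried f) x"
    using eqs L[unfolded iff] AE_space
    by eventually_elim (simp add: norm1_uncurried[OF f])
  then show "L0_suminf M ?F = L0_class M (norm1 (uncurried f))"
    using L summ by (simp add: L0_suminf_eq[OF pos] L0_class_cong_AE)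
qed

lemma simple_maps_iff: "f \<in> simple_maps \<Omega> M \<mu> \<longleftrightarrow> countably_valued f \<and> uncurried f \<in> \<L>"
  unfolding simple_maps_def mem_Collect_eq simple_repr_iff countably_valued_iff
  using L0_summable_partition_iff by blast

text \<open>Every representing partition gives the same sum, so the definite description in
  \<open>simple_norm\<close> denotes it.\<close>

lemma simple_norm_eq:
  assumes "f \<in> simple_maps \<Omega> M \<mu>"
  shows "simple_norm \<Omega> M \<mu> f = L0_class M (norm1 (uncurried f))"
proof -
  have L: "uncurried f \<in> \<L>" using assms by (simp add: simple_maps_iff)
  obtain A c where Ac: "simple_repr \<Omega> M \<mu> A c f" using assms by (auto simp: simple_maps_def)
  have "L0_class M (norm1 (uncurried f)) = L0_suminf M (\<lambda>i. \<mu> (A i) \<otimes>\<^bsub>L0 M\<^esub> L0_abs M (c i))"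
    using L Ac L0_suminf_partition[of A c f] by (simp add: simple_repr_iff)
  moreover have "s = L0_class M (norm1 (uncurried f))"
    if "\<exists>A c. simple_repr \<Omega> M \<mu> A c f \<and>
      s = L0_suminf M (\<lambda>i. \<mu> (A i) \<otimes>\<^bsub>L0 M\<^esub> L0_abs M (c i))" for s
  proof -
    from that obtain A c where Ac: "partition_repr A c f"
      "s = L0_suminf M (\<lambda>i. \<mu> (A i) \<otimes>\<^bsub>L0 M\<^esub> L0_abs M (c i))"
      by (auto simp: simple_repr_iff)
    then show ?thesis using L0_suminf_partition[OF Ac(1) L] by simp
  qed
  ultimately show ?thesis
    unfolding simple_norm_def using Ac by (intro the_equality) blast+
qed

section \<open>Operations on simple maps\<close>

lemma
  assumes "f \<in> simple_maps \<Omega> M \<mu>" "g \<in> simple_maps \<Omega> M \<mu>"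
  shows simple_maps_add: "(\<lambda>p. f p \<oplus>\<^bsub>L0 M\<^esub> g p) \<in> simple_maps \<Omega> M \<mu>"
    and L1t_class_uncurried_add:
      "cls (uncurried (\<lambda>p. f p \<oplus>\<^bsub>L0 M\<^esub> g p)) = cls (\<lambda>z. uncurried f z + uncurried g z)"
proof -
  have f: "countably_valued f" "uncurried f \<in> \<L>" and g: "countably_valued g" "uncurried g \<in> \<L>"
    using assms by (auto simp: simple_maps_iff)
  have fg: "countably_valued (\<lambda>p. f p \<oplus>\<^bsub>L0 M\<^esub> g p)"
    by (rule countably_valued_comp2[OF f(1) g(1)]) (rule L0_add_closed)
  have eq: "AE x in M. AE p in \<mu>x x.
      uncurried (\<lambda>p. f p \<oplus>\<^bsub>L0 M\<^esub> g p) (p, x) = uncurried f (p, x) + uncurried g (p, x)"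
    unfolding uncurried_def prod.case
    by (intro AE_kernel_if_space AE_repr_L0_add AE_all_values2[OF f(1) g(1),
          where Q="\<lambda>x r s. repr (r \<oplus>\<^bsub>L0 M\<^esub> s) x = repr r x + repr s x"])
  show "(\<lambda>p. f p \<oplus>\<^bsub>L0 M\<^esub> g p) \<in> simple_maps \<Omega> M \<mu>"
    using fg L1t_functions_cong[OF measurable_uncurried[OF fg] L1t_functions_add[OF f(2) g(2)] eq]
    by (simp add: simple_maps_iff)
  show "cls (uncurried (\<lambda>p. f p \<oplus>\<^bsub>L0 M\<^esub> g p)) = cls (\<lambda>z. uncurried f z + uncurried g z)"
    by (rule L1t_class_cong[OF eq])
qed

lemma
  assumes a: "a \<in> carrier (L0 M)" and "f \<in> simple_maps \<Omega> M \<mu>"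
  shows simple_maps_smult: "(\<lambda>p. a \<otimes>\<^bsub>L0 M\<^esub> f p) \<in> simple_maps \<Omega> M \<mu>"
    and L1t_class_uncurried_smult:
      "cls (uncurried (\<lambda>p. a \<otimes>\<^bsub>L0 M\<^esub> f p)) = cls (\<lambda>(p, x). repr a x * uncurried f (p, x))"
proof -
  have f: "countably_valued f" "uncurried f \<in> \<L>" using assms by (auto simp: simple_maps_iff)
  have af: "countably_valued (\<lambda>p. a \<otimes>\<^bsub>L0 M\<^esub> f p)"
    by (rule countably_valued_comp2[OF countably_valued_const[OF a] f(1)]) (rule L0_mult_closed)
  have eq: "AE x in M. AE p in \<mu>x x.
      uncurried (\<lambda>p. a \<otimes>\<^bsub>L0 M\<^esub> f p) (p, x) = (\<lambda>(p, x). repr a x * uncurried f (p, x)) (p, x)"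
    unfolding uncurried_def prod.case
    by (intro AE_kernel_if_space AE_repr_L0_mult a AE_all_values[OF f(1),
          where Q="\<lambda>x r. repr (a \<otimes>\<^bsub>L0 M\<^esub> r) x = repr a x * repr r x"])
  show "(\<lambda>p. a \<otimes>\<^bsub>L0 M\<^esub> f p) \<in> simple_maps \<Omega> M \<mu>"
    using af L1t_functions_cong[OF measurable_uncurried[OF af] L1t_functions_smult_L0[OF a f(2)] eq]
    by (simp add: simple_maps_iff)
  show "cls (uncurried (\<lambda>p. a \<otimes>\<^bsub>L0 M\<^esub> f p)) = cls (\<lambda>(p, x). repr a x * uncurried f (p, x))"
    by (rule L1t_class_cong[OF eq])
qed

lemma
  assumes "A \<in> sets \<Omega>"
  shows simple_maps_indicator:
      "(\<lambda>p. if p \<in> A then \<one>\<^bsub>L0 M\<^esub> else \<zero>\<^bsub>L0 M\<^esub>) \<in> simple_maps \<Omega> M \<mu>"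
    and L1t_class_uncurried_indicator:
      "cls (uncurried (\<lambda>p. if p \<in> A then \<one>\<^bsub>L0 M\<^esub> else \<zero>\<^bsub>L0 M\<^esub>))
        = cls (\<lambda>(p, x). indicator A p)"
proof -
  let ?f = "\<lambda>p. if p \<in> A then \<one>\<^bsub>L0 M\<^esub> else \<zero>\<^bsub>L0 M\<^esub>"
  have "?f \<in> \<Omega> \<rightarrow>\<^sub>M count_space {\<one>\<^bsub>L0 M\<^esub>, \<zero>\<^bsub>L0 M\<^esub>}"
    using assms by (intro measurable_If_set) auto
  then have f: "countably_valued ?f"
    unfolding countably_valued_def
    by (intro exI[of _ "{\<one>\<^bsub>L0 M\<^esub>, \<zero>\<^bsub>L0 M\<^esub>}"]) (auto simp: L0_one_closed L0_zero_closed)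
  have eq: "AE x in M. AE p in \<mu>x x. uncurried ?f (p, x) = (\<lambda>(p, x). indicator A p) (p, x)"
    using AE_repr_L0_one[of M] AE_repr_L0_zero[of M]
    by eventually_elim (auto simp: uncurried_def)
  show "?f \<in> simple_maps \<Omega> M \<mu>"
    using f L1t_functions_cong[OF measurable_uncurried[OF f] L1t_functions_indicator_fst[OF assms] eq]
    by (simp add: simple_maps_iff)
  show "cls (uncurried ?f) = cls (\<lambda>(p, x). indicator A p)"
    by (rule L1t_class_cong[OF eq])
qed

section \<open>The quotient \<open>S1\<close> and its map into \<open>L1t\<close>\<close>

definition \<mu>_eq_maps :: "('w \<Rightarrow> ('x \<Rightarrow> real) set) \<Rightarrow> ('w \<Rightarrow> ('x \<Rightarrow> real) set) \<Rightarrow> bool"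
  where "\<mu>_eq_maps f g \<longleftrightarrow>
    (\<exists>N\<in>sets \<Omega>. \<mu> N = \<zero>\<^bsub>L0 M\<^esub> \<and> (\<forall>p\<in>space \<Omega> - N. f p = g p))"

lemma \<mu>_eq_maps_space: "(\<And>p. p \<in> space \<Omega> \<Longrightarrow> f p = g p) \<Longrightarrow> \<mu>_eq_maps f g"
  unfolding \<mu>_eq_maps_def by (intro bexI[of _ "{}"]) (auto simp: \<mu>_eq_zero_iff)

lemma \<mu>_eq_maps_sym: "\<mu>_eq_maps f g \<Longrightarrow> \<mu>_eq_maps g f"
  unfolding \<mu>_eq_maps_def by metis

text \<open>Serves as transitivity or as compatibility with an operation, depending on the choice of
  \<open>h\<close> and \<open>h'\<close>. The two exceptional sets are united, and the union is null
  because it is null in almost every fibre.\<close>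

lemma \<mu>_eq_maps_comp2:
  assumes "\<mu>_eq_maps f f'" "\<mu>_eq_maps g g'"
    and h: "\<And>p. p \<in> space \<Omega> \<Longrightarrow> f p = f' p \<Longrightarrow> g p = g' p \<Longrightarrow> h p = h' p"
  shows "\<mu>_eq_maps h h'"
proof -
  obtain N where N: "N \<in> sets \<Omega>" "\<mu> N = \<zero>\<^bsub>L0 M\<^esub>" "\<And>p. p \<in> space \<Omega> - N \<Longrightarrow> f p = f' p"
    using assms(1) by (auto simp: \<mu>_eq_maps_def)
  obtain N' where N': "N' \<in> sets \<Omega>" "\<mu> N' = \<zero>\<^bsub>L0 M\<^esub>" "\<And>p. p \<in> space \<Omega> - N' \<Longrightarrow> g p = g' p"
    using assms(2) by (auto simp: \<mu>_eq_maps_def)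
  have "AE x in M. AE p in \<mu>x x. p \<notin> N \<union> N'"
    using N(2)[unfolded \<mu>_eq_zero_iff[OF N(1)]] N'(2)[unfolded \<mu>_eq_zero_iff[OF N'(1)]]
  proof eventually_elim
    case (elim x)
    then show ?case by eventually_elim simp
  qed
  then have "\<mu> (N \<union> N') = \<zero>\<^bsub>L0 M\<^esub>" using N N' by (subst \<mu>_eq_zero_iff) auto
  with N N' h show ?thesis
    unfolding \<mu>_eq_maps_def by (intro bexI[of _ "N \<union> N'"]) auto
qed

lemma \<mu>_eq_maps_refl: "\<mu>_eq_maps f f"
  by (rule \<mu>_eq_maps_space) simp

lemma S1_class_cong:
  assumes "\<mu>_eq_maps f g"
  shows "S1_class \<Omega> M \<mu> f = S1_class \<Omega> M \<mu> g"
proof -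
  have "\<mu>_eq_maps h f \<longleftrightarrow> \<mu>_eq_maps h g" for h
    using \<mu>_eq_maps_comp2[of h f f g h g] \<mu>_eq_maps_comp2[of h g g f h f] assms
      \<mu>_eq_maps_sym[OF assms] by auto
  then show ?thesis by (simp add: S1_class_def \<mu>_eq_maps_def[symmetric])
qed

lemma
  assumes "f \<in> simple_maps \<Omega> M \<mu>"
  shows repr_S1_class: "repr (S1_class \<Omega> M \<mu> f) \<in> simple_maps \<Omega> M \<mu>"
    and \<mu>_eq_maps_repr_S1_class: "\<mu>_eq_maps (repr (S1_class \<Omega> M \<mu> f)) f"
proof -
  have "f \<in> S1_class \<Omega> M \<mu> f"
    using assms \<mu>_eq_maps_refl[of f] by (simp add: S1_class_def \<mu>_eq_maps_def)
  from repr_mem[OF this] show "repr (S1_class \<Omega> M \<mu> f) \<in> simple_maps \<Omega> M \<mu>"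
    "\<mu>_eq_maps (repr (S1_class \<Omega> M \<mu> f)) f"
    by (auto simp: S1_class_def \<mu>_eq_maps_def)
qed

lemma AE_uncurried_eq:
  assumes "\<mu>_eq_maps f g"
  shows "AE x in M. AE p in \<mu>x x. uncurried f (p, x) = uncurried g (p, x)"
proof -
  obtain N where N: "N \<in> sets \<Omega>" "\<mu> N = \<zero>\<^bsub>L0 M\<^esub>" "\<And>p. p \<in> space \<Omega> - N \<Longrightarrow> f p = g p"
    using assms by (auto simp: \<mu>_eq_maps_def)
  from N(2)[unfolded \<mu>_eq_zero_iff[OF N(1)]] AE_space show ?thesis
  proof eventually_elim
    case (elim x)
    from elim(1) AE_space show ?case
      by eventually_elim (use N(3) elim(2) in \<open>auto simp: uncurried_def space_kernel\<close>)
  qed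
qed

lemma S1_carrierE:
  assumes "C \<in> carrier (S1 \<Omega> M \<mu>)"
  obtains f where "f \<in> simple_maps \<Omega> M \<mu>" "C = S1_class \<Omega> M \<mu> f"
  using assms by (auto simp: S1_def)

lemma S1_carrierI: "f \<in> simple_maps \<Omega> M \<mu> \<Longrightarrow> S1_class \<Omega> M \<mu> f \<in> carrier (S1 \<Omega> M \<mu>)"
  by (auto simp: S1_def)

lemma add_S1:
  assumes "f \<in> simple_maps \<Omega> M \<mu>" "g \<in> simple_maps \<Omega> M \<mu>"
  shows "S1_class \<Omega> M \<mu> f \<oplus>\<^bsub>S1 \<Omega> M \<mu>\<^esub> S1_class \<Omega> M \<mu> g = S1_class \<Omega> M \<mu> (\<lambda>p. f p \<oplus>\<^bsub>L0 M\<^esub> g p)"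
  unfolding S1_def ring_record_simps
  by (intro S1_class_cong \<mu>_eq_maps_comp2[OF assms[THEN \<mu>_eq_maps_repr_S1_class]]) simp

lemma smult_S1:
  assumes "f \<in> simple_maps \<Omega> M \<mu>"
  shows "a \<odot>\<^bsub>S1 \<Omega> M \<mu>\<^esub> S1_class \<Omega> M \<mu> f = S1_class \<Omega> M \<mu> (\<lambda>p. a \<otimes>\<^bsub>L0 M\<^esub> f p)"
  unfolding S1_def module.simps
  by (intro S1_class_cong \<mu>_eq_maps_comp2[OF \<mu>_eq_maps_repr_S1_class[OF assms] \<mu>_eq_maps_refl])
    simp

lemma zero_S1: "\<zero>\<^bsub>S1 \<Omega> M \<mu>\<^esub> = S1_class \<Omega> M \<mu> (\<lambda>_. \<zero>\<^bsub>L0 M\<^esub>)"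
  by (simp add: S1_def)

lemma simple_maps_zero: "(\<lambda>_. \<zero>\<^bsub>L0 M\<^esub>) \<in> simple_maps \<Omega> M \<mu>"
  using simple_maps_indicator[of "{}"] by simp

lemma simple_maps_values: "f \<in> simple_maps \<Omega> M \<mu> \<Longrightarrow> p \<in> space \<Omega> \<Longrightarrow> f p \<in> carrier (L0 M)"
proof -
  assume "f \<in> simple_maps \<Omega> M \<mu>" "p \<in> space \<Omega>"
  then obtain R where R: "R \<subseteq> carrier (L0 M)" "f \<in> \<Omega> \<rightarrow>\<^sub>M count_space R"
    by (auto simp: simple_maps_iff countably_valued_def)
  then show "f p \<in> carrier (L0 M)" using measurable_space[OF R(2) \<open>p \<in> space \<Omega>\<close>] by auto
qed

lemma S1_class_cong_space:
  "(\<And>p. p \<in> space \<Omega> \<Longrightarrow> f p = g p) \<Longrightarrow> S1_class \<Omega> M \<mu> f = S1_class \<Omega> M \<mu> g"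
  by (intro S1_class_cong \<mu>_eq_maps_space)

lemma abelian_group_S1: "abelian_group (S1 \<Omega> M \<mu>)"
proof (rule abelian_groupI)
  fix C assume "C \<in> carrier (S1 \<Omega> M \<mu>)"
  then obtain f where f: "f \<in> simple_maps \<Omega> M \<mu>" "C = S1_class \<Omega> M \<mu> f" by (rule S1_carrierE)
  \<comment> \<open>The inverse is taken as the multiple by \<open>-1\<close>, so that closure under
    scalars shows it to be a simple map.\<close>
  let ?g = "\<lambda>p. (\<ominus>\<^bsub>L0 M\<^esub> \<one>\<^bsub>L0 M\<^esub>) \<otimes>\<^bsub>L0 M\<^esub> f p"
  have g: "?g \<in> simple_maps \<Omega> M \<mu>" by (rule simple_maps_smult) (auto simp: f)
  have "S1_class \<Omega> M \<mu> ?g \<oplus>\<^bsub>S1 \<Omega> M \<mu>\<^esub> C = \<zero>\<^bsub>S1 \<Omega> M \<mu>\<^esub>"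
    unfolding f(2) add_S1[OF g f(1)] zero_S1
    by (rule S1_class_cong_space) (simp add: simple_maps_values[OF f(1)] L1t.mod.R.l_minus L1t.mod.R.l_neg)
  with g show "\<exists>D\<in>carrier (S1 \<Omega> M \<mu>). D \<oplus>\<^bsub>S1 \<Omega> M \<mu>\<^esub> C = \<zero>\<^bsub>S1 \<Omega> M \<mu>\<^esub>"
    by (blast intro: S1_carrierI)
  show "\<zero>\<^bsub>S1 \<Omega> M \<mu>\<^esub> \<oplus>\<^bsub>S1 \<Omega> M \<mu>\<^esub> C = C"
    unfolding f(2) zero_S1 add_S1[OF simple_maps_zero f(1)]
    by (rule S1_class_cong_space) (simp add: simple_maps_values[OF f(1)])
  fix D assume "D \<in> carrier (S1 \<Omega> M \<mu>)"
  then obtain g where g: "g \<in> simple_maps \<Omega> M \<mu>" "D = S1_class \<Omega> M \<mu> g" by (rule S1_carrierE)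
  show "C \<oplus>\<^bsub>S1 \<Omega> M \<mu>\<^esub> D = D \<oplus>\<^bsub>S1 \<Omega> M \<mu>\<^esub> C"
    unfolding f(2) g(2) add_S1[OF f(1) g(1)] add_S1[OF g(1) f(1)]
    by (rule S1_class_cong_space) (simp add: simple_maps_values f(1) g(1) L1t.mod.R.a_comm)
  fix E assume "E \<in> carrier (S1 \<Omega> M \<mu>)"
  then obtain h where h: "h \<in> simple_maps \<Omega> M \<mu>" "E = S1_class \<Omega> M \<mu> h" by (rule S1_carrierE)
  show "(C \<oplus>\<^bsub>S1 \<Omega> M \<mu>\<^esub> D) \<oplus>\<^bsub>S1 \<Omega> M \<mu>\<^esub> E = C \<oplus>\<^bsub>S1 \<Omega> M \<mu>\<^esub> (D \<oplus>\<^bsub>S1 \<Omega> M \<mu>\<^esub> E)"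
    unfolding f(2) g(2) h(2) add_S1[OF f(1) g(1)] add_S1[OF g(1) h(1)]
      add_S1[OF simple_maps_add[OF f(1) g(1)] h(1)] add_S1[OF f(1) simple_maps_add[OF g(1) h(1)]]
    by (rule S1_class_cong_space) (simp add: simple_maps_values f(1) g(1) h(1) L1t.mod.R.a_assoc)
qed (auto elim!: S1_carrierE intro!: S1_carrierI simp: add_S1 zero_S1 simple_maps_add simple_maps_zero)

definition S1_to_L1t :: "('w \<Rightarrow> ('x \<Rightarrow> real) set) set \<Rightarrow> ('w \<times> 'x \<Rightarrow> real) set"
  where "S1_to_L1t C = cls (uncurried (repr C))"

lemma S1_to_L1t_class:
  assumes "f \<in> simple_maps \<Omega> M \<mu>"
  shows "S1_to_L1t (S1_class \<Omega> M \<mu> f) = cls (uncurried f)"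
  unfolding S1_to_L1t_def
  by (intro L1t_class_cong AE_uncurried_eq \<mu>_eq_maps_repr_S1_class assms)

lemma S1_to_L1t_closed: "C \<in> carrier (S1 \<Omega> M \<mu>) \<Longrightarrow> S1_to_L1t C \<in> carrier (L1t \<Omega> M \<mu>x)"
  by (elim S1_carrierE) (simp add: S1_to_L1t_class simple_maps_iff L1t_carrierI)

lemma S1_smult_closed:
  "a \<in> carrier (L0 M) \<Longrightarrow> C \<in> carrier (S1 \<Omega> M \<mu>) \<Longrightarrow> a \<odot>\<^bsub>S1 \<Omega> M \<mu>\<^esub> C \<in> carrier (S1 \<Omega> M \<mu>)"
  by (elim S1_carrierE) (simp add: smult_S1 S1_carrierI simple_maps_smult)

lemma S1_to_L1t_add:
  assumes "C \<in> carrier (S1 \<Omega> M \<mu>)" "D \<in> carrier (S1 \<Omega> M \<mu>)"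
  shows "S1_to_L1t (C \<oplus>\<^bsub>S1 \<Omega> M \<mu>\<^esub> D) = S1_to_L1t C \<oplus>\<^bsub>L1t \<Omega> M \<mu>x\<^esub> S1_to_L1t D"
proof -
  obtain f where f: "f \<in> simple_maps \<Omega> M \<mu>" "C = S1_class \<Omega> M \<mu> f" using assms(1) by (rule S1_carrierE)
  obtain g where g: "g \<in> simple_maps \<Omega> M \<mu>" "D = S1_class \<Omega> M \<mu> g" using assms(2) by (rule S1_carrierE)
  have "uncurried f \<in> \<L>" "uncurried g \<in> \<L>" using f(1) g(1) by (simp_all add: simple_maps_iff)
  then show ?thesis
    by (simp add: f g add_S1 simple_maps_add S1_to_L1t_class add_L1t L1t_class_uncurried_add)
qed

lemma S1_to_L1t_smult:
  assumes a: "a \<in> carrier (L0 M)" and "C \<in> carrier (S1 \<Omega> M \<mu>)"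
  shows "S1_to_L1t (a \<odot>\<^bsub>S1 \<Omega> M \<mu>\<^esub> C) = a \<odot>\<^bsub>L1t \<Omega> M \<mu>x\<^esub> S1_to_L1t C"
proof -
  obtain f where f: "f \<in> simple_maps \<Omega> M \<mu>" "C = S1_class \<Omega> M \<mu> f" using assms(2) by (rule S1_carrierE)
  have "uncurried f \<in> \<L>" using f(1) by (simp add: simple_maps_iff)
  then show ?thesis
    using a f(1) by (simp add: f(2) smult_S1 simple_maps_smult S1_to_L1t_class smult_L1t
        L1t_class_uncurried_smult)
qed

lemma S1_to_L1t_lnorm:
  assumes "C \<in> carrier (S1 \<Omega> M \<mu>)"
  shows "lnorm (L1t \<Omega> M \<mu>x) (S1_to_L1t C) = lnorm (S1 \<Omega> M \<mu>) C"
proof -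
  obtain f where f: "f \<in> simple_maps \<Omega> M \<mu>" "C = S1_class \<Omega> M \<mu> f" using assms by (rule S1_carrierE)
  have r: "repr C \<in> simple_maps \<Omega> M \<mu>" unfolding f(2) by (rule repr_S1_class[OF f(1)])
  then have "uncurried (repr C) \<in> \<L>" by (simp add: simple_maps_iff)
  then have "lnorm (L1t \<Omega> M \<mu>x) (S1_to_L1t C) = L0_class M (norm1 (uncurried (repr C)))"
    unfolding S1_to_L1t_def by (rule lnorm_L1t)
  also have "\<dots> = lnorm (S1 \<Omega> M \<mu>) C" by (simp add: S1_def simple_norm_eq[OF r])
  finally show ?thesis .
qed

lemma
  assumes "A \<in> sets \<Omega>"
  defines "C \<equiv> S1_class \<Omega> M \<mu> (\<lambda>p. if p \<in> A then \<one>\<^bsub>L0 M\<^esub> else \<zero>\<^bsub>L0 M\<^esub>)"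
  shows S1_indicator_closed: "C \<in> carrier (S1 \<Omega> M \<mu>)"
    and S1_to_L1t_indicator: "S1_to_L1t C = cls (\<lambda>(p, x). indicator A p)"
  unfolding C_def using assms(1)
  by (simp_all only: S1_carrierI S1_to_L1t_class simple_maps_indicator L1t_class_uncurried_indicator)

lemma S1_to_L1t_dense:
  assumes "W \<in> carrier (L1t \<Omega> M \<mu>x)" "0 < \<epsilon>"
  shows "\<exists>C\<in>carrier (S1 \<Omega> M \<mu>). rn_dist M (L1t \<Omega> M \<mu>x) (S1_to_L1t C) W < \<epsilon>"
  using assms
proof (induction W arbitrary: \<epsilon> rule: L1t_induct)
  case (indicator A)
  have "rn_dist M (L1t \<Omega> M \<mu>x) (cls (\<lambda>(p, x). indicator A p)) (cls (\<lambda>(p, x). indicator A p)) = 0"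
    by (intro L1t.rn_dist_self L1t_carrierI L1t_functions_indicator_fst indicator)
  then show ?case
    using S1_indicator_closed[OF indicator(1)] S1_to_L1t_indicator[OF indicator(1)] indicator(2) by metis
next
  case (add U V)
  obtain C where C: "C \<in> carrier (S1 \<Omega> M \<mu>)" "rn_dist M (L1t \<Omega> M \<mu>x) (S1_to_L1t C) U < \<epsilon> / 2"
    using add.IH(1)[of "\<epsilon> / 2"] add.prems by auto
  obtain D where D: "D \<in> carrier (S1 \<Omega> M \<mu>)" "rn_dist M (L1t \<Omega> M \<mu>x) (S1_to_L1t D) V < \<epsilon> / 2"
    using add.IH(2)[of "\<epsilon> / 2"] add.prems by auto
  have "rn_dist M (L1t \<Omega> M \<mu>x) (S1_to_L1t (C \<oplus>\<^bsub>S1 \<Omega> M \<mu>\<^esub> D)) (U \<oplus>\<^bsub>L1t \<Omega> M \<mu>x\<^esub> V) < \<epsilon>"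
    using L1t.rn_dist_add_le[OF S1_to_L1t_closed[OF C(1)] S1_to_L1t_closed[OF D(1)] add.hyps] C D
    by (simp add: S1_to_L1t_add)
  then show ?case
    using abelian_groupE(1)[OF abelian_group_S1 C(1) D(1)] by blast
next
  case (smult f U)
  \<comment> \<open>An unbounded scalar distorts distances by no fixed factor, so the accuracy
    required for \<open>U\<close> cannot be read off from \<open>\<epsilon>\<close> alone. A
    sequence of approximants is taken, and continuity of multiplication along it selects
    one.\<close>
  have "\<forall>n. \<exists>C\<in>carrier (S1 \<Omega> M \<mu>).
      rn_dist M (L1t \<Omega> M \<mu>x) (S1_to_L1t C) U < inverse (real (Suc n))"
    using smult.IH by simp
  then obtain C where C: "\<And>n. C n \<in> carrier (S1 \<Omega> M \<mu>)"
    "\<And>n. rn_dist M (L1t \<Omega> M \<mu>x) (S1_to_L1t (C n)) U < inverse (real (Suc n))"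
    by metis
  have T: "S1_to_L1t (C n) \<in> carrier (L1t \<Omega> M \<mu>x)" for n by (rule S1_to_L1t_closed[OF C(1)])
  have "norm (rn_dist M (L1t \<Omega> M \<mu>x) (S1_to_L1t (C n)) U) \<le> inverse (real (Suc n))" for n
    using C(2)[of n] L1t.rn_dist_nonneg[OF T smult.hyps(2), of n] by simp
  then have "(\<lambda>n. rn_dist M (L1t \<Omega> M \<mu>x) (S1_to_L1t (C n)) U) \<longlonglongrightarrow> 0"
    by (intro Lim_null_comparison[OF _ LIMSEQ_inverse_real_of_nat] always_eventually allI)
  then have "(\<lambda>n. rn_dist M (L1t \<Omega> M \<mu>x) (f \<odot>\<^bsub>L1t \<Omega> M \<mu>x\<^esub> S1_to_L1t (C n)) (f \<odot>\<^bsub>L1t \<Omega> M \<mu>x\<^esub> U)) \<longlonglongrightarrow> 0"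
    by (intro L1t.tendsto_rn_dist_smult smult.hyps) (use T in auto)
  from order_tendstoD(2)[OF this smult.prems]
  obtain n where "rn_dist M (L1t \<Omega> M \<mu>x) (f \<odot>\<^bsub>L1t \<Omega> M \<mu>x\<^esub> S1_to_L1t (C n)) (f \<odot>\<^bsub>L1t \<Omega> M \<mu>x\<^esub> U) < \<epsilon>"
    by (auto simp: eventually_sequentially)
  then show ?case
    using S1_to_L1t_smult[OF smult.hyps(1) C(1)] S1_smult_closed[OF smult.hyps(1) C(1)] by metis
next
  case (closed u U)
  have "\<forall>\<^sub>F n in sequentially. rn_dist M (L1t \<Omega> M \<mu>x) (u n) U < \<epsilon> / 2"
    using closed.prems by (intro order_tendstoD(2)[OF closed.hyps(3)]) simp
  then obtain n where n: "rn_dist M (L1t \<Omega> M \<mu>x) (u n) U < \<epsilon> / 2"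
    by (auto simp: eventually_sequentially)
  obtain C where C: "C \<in> carrier (S1 \<Omega> M \<mu>)" "rn_dist M (L1t \<Omega> M \<mu>x) (S1_to_L1t C) (u n) < \<epsilon> / 2"
    using closed.IH[of "\<epsilon> / 2" n] closed.prems by auto
  have "rn_dist M (L1t \<Omega> M \<mu>x) (S1_to_L1t C) U < \<epsilon>"
    using L1t.rn_dist_triangle[OF S1_to_L1t_closed[OF C(1)] closed.hyps(1)[of n] closed.hyps(2)] n C(2)
    by linarith
  with C(1) show ?case by blast
qed

end

sublocale foliated_L0_measure \<subseteq> L1: rn_dense_map M "S1 \<Omega> M \<mu>" "L1t \<Omega> M \<mu>x" S1_to_L1t
  by (intro rn_dense_map.intro rn_dense_map_axioms.intro random_normed_module_L1t abelian_group_S1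
      S1_smult_closed S1_to_L1t_closed S1_to_L1t_add S1_to_L1t_smult S1_to_L1t_lnorm
      S1_to_L1t_dense L1t_complete)

section \<open>Uniqueness of the isomorphism\<close>

context rn_module_isometric_iso
begin

lemma iso_closed: "v \<in> carrier V \<Longrightarrow> I v \<in> carrier W"
  using iso_extensional by auto

lemma iso_inj: "v \<in> carrier V \<Longrightarrow> w \<in> carrier V \<Longrightarrow> I v = I w \<Longrightarrow> v = w"
  using iso_bij by (auto simp: bij_betw_def inj_on_def)

lemma iso_obtain:
  assumes "w \<in> carrier W"
  obtains v where "v \<in> carrier V" "I v = w"
  using assms iso_bij unfolding bij_betw_def by (metis imageE)

text \<open>An additive map respects differences, and the distance is computed from the norm of a
  difference. This is how limits pass through an isomorphism.\<close>

lemma iso_rn_dist: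
  assumes v: "v \<in> carrier V" and w: "w \<in> carrier V"
  shows "rn_dist M W (I v) (I w) = rn_dist M V v w"
proof -
  have "I (v \<ominus>\<^bsub>V\<^esub> w) \<oplus>\<^bsub>W\<^esub> I w = I v"
    using v w by (simp add: iso_add[symmetric] dom.mod.M.minus_eq dom.mod.M.a_assoc dom.mod.M.l_neg)
  then have "I v \<ominus>\<^bsub>W\<^esub> I w = I (v \<ominus>\<^bsub>V\<^esub> w)"
    using v w iso_closed
    by (metis cod.mod.M.add.inv_solve_right cod.mod.M.minus_eq dom.mod.M.minus_closed)
  then show ?thesis using v w by (simp add: rn_dist_def iso_lnorm)
qed

end

text \<open>The induction runs over the common target, where the monotone class principle is
  available. Asking that \<open>J\<close> send every preimage of \<open>W\<close> under
  \<open>I\<close> to \<open>W\<close> expresses agreement at \<open>W\<close> without an inverse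
  map.\<close>

lemma (in foliated_L0_measure) isometric_iso_L1t_unique:
  assumes I: "rn_module_isometric_iso M V (L1t \<Omega> M \<mu>x) I"
    and J: "rn_module_isometric_iso M V (L1t \<Omega> M \<mu>x) J"
    and closed: "\<And>A. A \<in> sets \<Omega> \<Longrightarrow> E A \<in> carrier V"
    and I_E: "\<And>A. A \<in> sets \<Omega> \<Longrightarrow> I (E A) = cls (\<lambda>(p, x). indicator A p)"
    and J_E: "\<And>A. A \<in> sets \<Omega> \<Longrightarrow> J (E A) = cls (\<lambda>(p, x). indicator A p)"
  shows "I = J"
proof -
  interpret I: rn_module_isometric_iso M V "L1t \<Omega> M \<mu>x" I by (rule I)
  interpret J: rn_module_isometric_iso M V "L1t \<Omega> M \<mu>x" J by (rule J)
  have "\<forall>v\<in>carrier V. I v = W \<longrightarrow> J v = W" if "W \<in> carrier (L1t \<Omega> M \<mu>x)" for W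
    using that
  proof (induction W rule: L1t_induct)
    case (indicator A)
    show ?case
    proof (intro ballI impI)
      fix v assume "v \<in> carrier V" "I v = cls (\<lambda>(p, x). indicator A p)"
      then have "v = E A" using indicator by (intro I.iso_inj) (simp_all add: closed I_E)
      then show "J v = cls (\<lambda>(p, x). indicator A p)" using indicator by (simp add: J_E)
    qed
  next
    case (add W W')
    show ?case
    proof (intro ballI impI)
      fix v assume v: "v \<in> carrier V" "I v = W \<oplus>\<^bsub>L1t \<Omega> M \<mu>x\<^esub> W'"
      obtain w where w: "w \<in> carrier V" "I w = W" using add.hyps(1) by (rule I.iso_obtain)
      obtain w' where w': "w' \<in> carrier V" "I w' = W'" using add.hyps(2) by (rule I.iso_obtain)
      have "v = w \<oplus>\<^bsub>V\<^esub> w'" using v w w' by (intro I.iso_inj) (simp_all add: I.iso_add)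
      then show "J v = W \<oplus>\<^bsub>L1t \<Omega> M \<mu>x\<^esub> W'" using w w' add.IH by (simp add: J.iso_add)
    qed
  next
    case (smult f W)
    show ?case
    proof (intro ballI impI)
      fix v assume v: "v \<in> carrier V" "I v = f \<odot>\<^bsub>L1t \<Omega> M \<mu>x\<^esub> W"
      obtain w where w: "w \<in> carrier V" "I w = W" using smult.hyps(2) by (rule I.iso_obtain)
      have "v = f \<odot>\<^bsub>V\<^esub> w" using v w smult.hyps(1)
        by (intro I.iso_inj) (simp_all add: I.iso_smult)
      then show "J v = f \<odot>\<^bsub>L1t \<Omega> M \<mu>x\<^esub> W" using w smult.hyps(1) smult.IH by (simp add: J.iso_smult)
    qed
  next
    case (closed u W)
    show ?case
    proof (intro ballI impI)
      fix v assume v: "v \<in> carrier V" "I v = W"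
      have "\<forall>n. \<exists>w\<in>carrier V. I w = u n" using closed.hyps(1) by (meson I.iso_obtain)
      then obtain w where w: "\<And>n. w n \<in> carrier V" "\<And>n. I (w n) = u n" by metis
      have Jw: "J (w n) = u n" for n using closed.IH w by simp
      \<comment> \<open>Both maps are isometries and agree at the preimages \<open>w n\<close>, so
        \<open>u n\<close> approaches \<open>J v\<close> exactly as fast as it approaches
        \<open>W\<close>.\<close>
      have "rn_dist M (L1t \<Omega> M \<mu>x) (u n) (J v) = rn_dist M (L1t \<Omega> M \<mu>x) (u n) W" for n
        using J.iso_rn_dist[OF w(1)[of n] v(1)] I.iso_rn_dist[OF w(1)[of n] v(1)]
        by (simp add: Jw w(2) v(2))
      then show "J v = W"
        using closed.hyps v(1)
        by (intro L1t.rn_limit_unique[of u]) (auto simp: J.iso_closed)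
    qed
  qed
  then have "I v = J v" if "v \<in> carrier V" for v
    using I.iso_closed[OF that] that by simp
  \<comment> \<open>Agreement on the carrier suffices, since both maps are extensional.\<close>
  then show ?thesis
    by (rule PiE_ext[OF I.iso_extensional J.iso_extensional])
qed

theorem theorem4p17:
  fixes M :: "'x measure" and \<Omega> :: "'w measure"
    and \<mu> :: "'w set \<Rightarrow> ('x \<Rightarrow> real) set" and \<mu>x :: "'x \<Rightarrow> 'w measure"
  assumes "prob_space M"
    and "\<mu> \<in> L0_prob_measures \<Omega> M"
    and "foliation \<Omega> M \<mu> \<mu>x"
  shows "\<exists>!I. rn_module_isometric_iso M (L1 \<Omega> M \<mu>) (L1t \<Omega> M \<mu>x) I \<and>
    (\<forall>A\<in>sets \<Omega>. I (L1_indicator \<Omega> M \<mu> A \<one>\<^bsub>L0 M\<^esub>) =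
      L1t_class \<Omega> M \<mu>x (\<lambda>(p, x). indicator A p))"
proof -
  interpret foliated_L0_measure M \<Omega> \<mu>x \<mu>
    using assms(1,3) by (auto simp: foliation_def foliated_L0_measure_def prob_kernel_def
        prob_kernel_axioms_def foliated_L0_measure_axioms_def)
  \<comment> \<open>Indicators enter the completion as constant sequences, so on them the extension
    takes the value of the dense map.\<close>
  have E: "L1_indicator \<Omega> M \<mu> A \<one>\<^bsub>L0 M\<^esub> \<in> carrier (L1 \<Omega> M \<mu>)"
    "L1.extension (L1_indicator \<Omega> M \<mu> A \<one>\<^bsub>L0 M\<^esub>) = cls (\<lambda>(p, x). indicator A p)"
    if "A \<in> sets \<Omega>" for A
    unfolding L1_indicator_def L1_def S1_to_L1t_indicator[OF that, symmetric]
    by (rule L1.extension_const[OF S1_indicator_closed[OF that]])+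
  show ?thesis
  proof (rule ex1I[of _ L1.extension])
    show "rn_module_isometric_iso M (L1 \<Omega> M \<mu>) (L1t \<Omega> M \<mu>x) L1.extension \<and>
        (\<forall>A\<in>sets \<Omega>. L1.extension (L1_indicator \<Omega> M \<mu> A \<one>\<^bsub>L0 M\<^esub>) = cls (\<lambda>(p, x). indicator A p))"
      using L1.extension_isometric_iso E(2) by (simp add: L1_def)
    fix I
    assume "rn_module_isometric_iso M (L1 \<Omega> M \<mu>) (L1t \<Omega> M \<mu>x) I \<and>
        (\<forall>A\<in>sets \<Omega>. I (L1_indicator \<Omega> M \<mu> A \<one>\<^bsub>L0 M\<^esub>) = cls (\<lambda>(p, x). indicator A p))"
    then show "I = L1.extension"
      using L1.extension_isometric_iso E
      by (intro isometric_iso_L1t_unique[where E="\<lambda>A. L1_indicator \<Omega> M \<mu> A \<one>\<^bsub>L0 M\<^esub>"])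
        (auto simp: L1_def)
  qed
qed

end
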